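(* Let $\Bbbk$ be a field and $A=\Bbbk[[x,y,z]]/(xyz)$. Let $M$ be a non-regular (i.e. not isomorphic to $A$) rank one object of $\mathsf{CM}^{\mathsf{lf}}(A)$. Then the minimal number of generators of $M$ is two or three. (1) Assume $M$ is generated by two elements. Then there exist a bijection $\{u,v,w\}\to\{x,y,z\}$, integers $p,q\ge1$ and $\lambda\in\Bbbk^*$ such that $M\cong\mathrm{coker}(A^2\xrightarrow{\theta}A^2)$ with $\theta=\theta_i((p,q),\lambda)$ for some $1\le i\le3$, where $$\theta_1((p,q),\lambda)=\begin{pmatrix}u&0\\ v^p+\lambda w^q&vw\end{pmatrix},\qquad\theta_2((p,q),\lambda)=\begin{pmatrix}\lambda u+v^pw^q&w^{q+1}\\ v^{p+1}&vw\end{pmatrix}$$ and $\theta_3((p,q),\lambda)=\theta_1((p,q),\lambda)^{\mathsf{tr}}$. (2) Assume $M$ is (minimally) generated by three elements. Then there exist a bijection $\{u,v,w\}\to\{x,y,z\}$, integers $m,n,l\ge1$ and $\lambda\in\Bbbk^*$ such that $M\cong\mathrm{coker}(A^3\xrightarrow{\theta}A^3)$ with $\theta=\theta_i((m,n,l),\lambda)$ for some $4\le i\le7$, where $$\theta_4((m,n,l),\lambda)=\begin{pmatrix}u&w^l&0\\0&v&u^m\\\lambda v^n&0&w\end{pmatrix},\qquad\theta_5((m,n,l),\lambda)=\begin{pmatrix}u&w^l&\lambda v^n\\0&v&u^m\\0&0&w\end{pmatrix},$$ $\theta_6((m,n,l),\lambda)=\theta_4((m,n,l),\lambda)^{\mathsf{tr}}$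 and $\theta_7((m,n,l),\lambda)=\theta_5((m,n,l),\lambda)^{\mathsf{tr}}$.
   Context: $\mathsf{CM}^{\mathsf{lf}}(A)$ is the category of maximal Cohen--Macaulay $A$-modules $M$ such that $M_{\mathfrak p}$ is free over $A_{\mathfrak p}$ for every non-maximal prime ideal $\mathfrak p$ of $A$; $M$ has rank one if all these localizations are free of rank one. The bijection means that $u,v,w$ denote the variables $x,y,z$ in some order. *)

theory Defs
  imports
    "HOL-Algebra.QuotRing"
    "HOL-Algebra.Module"
    "HOL-Algebra.Algebraic_Closure_Type"
    "HOL-Computational_Algebra.Formal_Power_Series"
    "HOL-Library.Extended_Nat"
    "Jordan_Normal_Form.Matrix"
begin

section \<open>Modules over a commutative ring\<close>

text \<open>The record type of modules extends that of rings. The ring multiplication and the unit of a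
  module play no role, and the constructions below leave them undefined.\<close>

definition module_iso ::
    "('a, 'r) ring_scheme \<Rightarrow> ('a, 'b, 'm) module_scheme \<Rightarrow> ('a, 'c, 'n) module_scheme \<Rightarrow> bool" where
  "module_iso R M N \<longleftrightarrow>
     (\<exists>f \<in> iso (add_monoid M) (add_monoid N).
        \<forall>a \<in> carrier R. \<forall>x \<in> carrier M. f (a \<odot>\<^bsub>M\<^esub> x) = a \<odot>\<^bsub>N\<^esub> f x)"

definition regular_module :: "('a, 'r) ring_scheme \<Rightarrow> ('a, 'a) module" where
  "regular_module R =
     \<lparr>carrier = carrier R, monoid.mult = monoid.mult R, one = one R, zero = zero R, add = add R,
      module.smult = monoid.mult R\<rparr>"

definition free_module :: "('a, 'r) ring_scheme \<Rightarrow> nat \<Rightarrow> ('a, 'a vec) module" where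
  "free_module R n =
     \<lparr>carrier = {v \<in> carrier_vec n. \<forall>i<n. v $ i \<in> carrier R},
      monoid.mult = undefined, one = undefined,
      zero = vec n (\<lambda>_. \<zero>\<^bsub>R\<^esub>),
      add = (\<lambda>v w. vec n (\<lambda>i. v $ i \<oplus>\<^bsub>R\<^esub> w $ i)),
      module.smult = (\<lambda>a v. vec n (\<lambda>i. a \<otimes>\<^bsub>R\<^esub> v $ i))\<rparr>"

definition free_of_rank :: "('a, 'r) ring_scheme \<Rightarrow> ('a, 'b, 'm) module_scheme \<Rightarrow> nat \<Rightarrow> bool" where
  "free_of_rank R M n \<longleftrightarrow> module_iso R M (free_module R n)"

definition quot_module ::
    "('a, 'r) ring_scheme \<Rightarrow> ('a, 'b, 'm) module_scheme \<Rightarrow> 'b set \<Rightarrow> ('a, 'b set) module" where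
  "quot_module R M N =
     \<lparr>carrier = a_rcosets\<^bsub>M\<^esub> N, monoid.mult = undefined, one = undefined,
      zero = N, add = set_add M,
      module.smult = (\<lambda>a F. \<Union>x\<in>F. N +>\<^bsub>M\<^esub> (a \<odot>\<^bsub>M\<^esub> x))\<rparr>"

definition submodule_span ::
    "('a, 'r) ring_scheme \<Rightarrow> ('a, 'b, 'm) module_scheme \<Rightarrow> 'b set \<Rightarrow> 'b set" where
  "submodule_span R M S = \<Inter>{N. submodule N R M \<and> S \<subseteq> N}"

definition generated_by :: "('a, 'r) ring_scheme \<Rightarrow> ('a, 'b, 'm) module_scheme \<Rightarrow> nat \<Rightarrow> bool" where
  "generated_by R M n \<longleftrightarrow>
     (\<exists>S \<subseteq> carrier M. finite S \<and> card S \<le> n \<and> submodule_span R M S = carrier M)"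

definition finitely_generated :: "('a, 'r) ring_scheme \<Rightarrow> ('a, 'b, 'm) module_scheme \<Rightarrow> bool" where
  "finitely_generated R M \<longleftrightarrow> (\<exists>n. generated_by R M n)"

definition min_generators :: "('a, 'r) ring_scheme \<Rightarrow> ('a, 'b, 'm) module_scheme \<Rightarrow> nat" where
  "min_generators R M = (LEAST n. generated_by R M n)"

text \<open>Matrices act on column vectors from the left.\<close>

definition mat_apply :: "('a, 'r) ring_scheme \<Rightarrow> 'a mat \<Rightarrow> 'a vec \<Rightarrow> 'a vec" where
  "mat_apply R \<theta> v =
     vec (dim_row \<theta>) (\<lambda>i. \<Oplus>\<^bsub>R\<^esub>j\<in>{..<dim_col \<theta>}. \<theta> $$ (i, j) \<otimes>\<^bsub>R\<^esub> v $ j)"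

definition coker :: "('a, 'r) ring_scheme \<Rightarrow> 'a mat \<Rightarrow> ('a, 'a vec set) module" where
  "coker R \<theta> =
     quot_module R (free_module R (dim_row \<theta>))
       (mat_apply R \<theta> ` carrier (free_module R (dim_col \<theta>)))"


section \<open>Localization\<close>

text \<open>The fraction \<open>m/s\<close>, as the class of all pairs \<open>(n, t)\<close> with \<open>u(tm - sn) = 0\<close> for
  some \<open>u \<in> S\<close>. Operations on fractions are unions over representatives, as for quotient rings.\<close>

definition fraction ::
    "('a, 'r) ring_scheme \<Rightarrow> 'a set \<Rightarrow> ('a, 'b, 'm) module_scheme \<Rightarrow> 'b \<Rightarrow> 'a \<Rightarrow> ('b \<times> 'a) set" where
  "fraction R S M m s =
     {(n, t). n \<in> carrier M \<and> t \<in> S \<and>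
        (\<exists>u\<in>S. u \<odot>\<^bsub>M\<^esub> (t \<odot>\<^bsub>M\<^esub> m) = u \<odot>\<^bsub>M\<^esub> (s \<odot>\<^bsub>M\<^esub> n))}"

definition localized_module ::
    "('a, 'r) ring_scheme \<Rightarrow> 'a set \<Rightarrow> ('a, 'b, 'm) module_scheme \<Rightarrow>
     (('a \<times> 'a) set, ('b \<times> 'a) set) module" where
  "localized_module R S M =
     \<lparr>carrier = {fraction R S M m s | m s. m \<in> carrier M \<and> s \<in> S},
      monoid.mult = undefined, one = undefined,
      zero = fraction R S M \<zero>\<^bsub>M\<^esub> \<one>\<^bsub>R\<^esub>,
      add = (\<lambda>F G. \<Union>(m, s)\<in>F. \<Union>(n, t)\<in>G.
               fraction R S M (t \<odot>\<^bsub>M\<^esub> m \<oplus>\<^bsub>M\<^esub> s \<odot>\<^bsub>M\<^esub> n) (s \<otimes>\<^bsub>R\<^esub> t)),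
      module.smult = (\<lambda>F G. \<Union>(a, s)\<in>F. \<Union>(m, t)\<in>G. fraction R S M (a \<odot>\<^bsub>M\<^esub> m) (s \<otimes>\<^bsub>R\<^esub> t))\<rparr>"

definition localized_ring :: "('a, 'r) ring_scheme \<Rightarrow> 'a set \<Rightarrow> ('a \<times> 'a) set ring" where
  "localized_ring R S =
     (let L = localized_module R S (regular_module R) in
      \<lparr>carrier = carrier L, monoid.mult = module.smult L,
       one = fraction R S (regular_module R) \<one>\<^bsub>R\<^esub> \<one>\<^bsub>R\<^esub>,
       zero = zero L, add = add L\<rparr>)"

definition localized_free_of_rank ::
    "('a, 'r) ring_scheme \<Rightarrow> ('a, 'b, 'm) module_scheme \<Rightarrow> 'a set \<Rightarrow> nat \<Rightarrow> bool" where
  "localized_free_of_rank R M \<pp> n \<longleftrightarrow>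
     free_of_rank (localized_ring R (carrier R - \<pp>)) (localized_module R (carrier R - \<pp>) M) n"


section \<open>Maximal Cohen--Macaulay modules over a local ring\<close>

definition krull_dim :: "('a, 'r) ring_scheme \<Rightarrow> enat" where
  "krull_dim R =
     Sup {enat n | n. \<exists>\<pp> :: nat \<Rightarrow> 'a set.
            (\<forall>i\<le>n. primeideal (\<pp> i) R) \<and> (\<forall>i<n. \<pp> i \<subset> \<pp> (Suc i))}"

definition max_ideal :: "('a, 'r) ring_scheme \<Rightarrow> 'a set" where
  "max_ideal R = (THE \<mm>. maximalideal \<mm> R)"

definition nonzerodivisor_on ::
    "('a, 'r) ring_scheme \<Rightarrow> ('a, 'b, 'm) module_scheme \<Rightarrow> 'a \<Rightarrow> bool" where
  "nonzerodivisor_on R M a \<longleftrightarrow> (\<forall>x\<in>carrier M. a \<odot>\<^bsub>M\<^esub> x = \<zero>\<^bsub>M\<^esub> \<longrightarrow> x = \<zero>\<^bsub>M\<^esub>)"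

text \<open>The submodule \<open>(T)M\<close>, where \<open>(T)\<close> is the ideal generated by \<open>T\<close>.\<close>

definition ideal_times ::
    "('a, 'r) ring_scheme \<Rightarrow> ('a, 'b, 'm) module_scheme \<Rightarrow> 'a set \<Rightarrow> 'b set" where
  "ideal_times R M T = submodule_span R M {a \<odot>\<^bsub>M\<^esub> x | a x. a \<in> T \<and> x \<in> carrier M}"

definition regular_sequence ::
    "('a, 'r) ring_scheme \<Rightarrow> ('a, 'b, 'm) module_scheme \<Rightarrow> 'a list \<Rightarrow> bool" where
  "regular_sequence R M as \<longleftrightarrow>
     set as \<subseteq> carrier R \<and>
     (\<forall>i<length as.
        nonzerodivisor_on R (quot_module R M (ideal_times R M (set (take i as)))) (as ! i)) \<and>
     ideal_times R M (set as) \<noteq> carrier M"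

definition depth :: "('a, 'r) ring_scheme \<Rightarrow> ('a, 'b, 'm) module_scheme \<Rightarrow> enat" where
  "depth R M = Sup {enat (length as) | as. set as \<subseteq> max_ideal R \<and> regular_sequence R M as}"

text \<open>The zero module counts as maximal Cohen--Macaulay, so that these modules form an additive
  category.\<close>

definition max_cohen_macaulay :: "('a, 'r) ring_scheme \<Rightarrow> ('a, 'b, 'm) module_scheme \<Rightarrow> bool" where
  "max_cohen_macaulay R M \<longleftrightarrow>
     module R M \<and> finitely_generated R M \<and>
     (carrier M = {\<zero>\<^bsub>M\<^esub>} \<or> depth R M = krull_dim R)"

text \<open>As these modules are finitely generated, free localizations are free of finite rank.\<close>

definition CM_lf :: "('a, 'r) ring_scheme \<Rightarrow> ('a, 'b, 'm) module_scheme \<Rightarrow> bool" where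
  "CM_lf R M \<longleftrightarrow>
     max_cohen_macaulay R M \<and>
     (\<forall>\<pp>. primeideal \<pp> R \<and> \<not> maximalideal \<pp> R \<longrightarrow> (\<exists>n. localized_free_of_rank R M \<pp> n))"

definition rank_one :: "('a, 'r) ring_scheme \<Rightarrow> ('a, 'b, 'm) module_scheme \<Rightarrow> bool" where
  "rank_one R M \<longleftrightarrow>
     (\<forall>\<pp>. primeideal \<pp> R \<and> \<not> maximalideal \<pp> R \<longrightarrow> localized_free_of_rank R M \<pp> 1)"


section \<open>The ring \<open>k[[x,y,z]]/(xyz)\<close>\<close>

text \<open>Power series in three variables are iterated: \<open>k[[x,y,z]] = k[[x]][[y]][[z]]\<close>.\<close>

type_synonym 'k fps3 = "'k fps fps fps"

definition var_x :: "'k::field fps3" where "var_x = fps_const (fps_const fps_X)"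
definition var_y :: "'k::field fps3" where "var_y = fps_const fps_X"
definition var_z :: "'k::field fps3" where "var_z = fps_X"

definition const3 :: "'k::field \<Rightarrow> 'k fps3" where
  "const3 c = fps_const (fps_const (fps_const c))"

definition xyz_ideal :: "'k::field fps3 set" where
  "xyz_ideal = Idl\<^bsub>ring_of_type_algebra\<^esub> {var_x * var_y * var_z}"

definition xyz_ring :: "'k::field fps3 set ring" where
  "xyz_ring = ring_of_type_algebra Quot xyz_ideal"

definition xyz_class :: "'k::field fps3 \<Rightarrow> 'k fps3 set" where
  "xyz_class f = xyz_ideal +>\<^bsub>ring_of_type_algebra\<^esub> f"

text \<open>The cokernel of the map \<open>A\<^sup>n \<rightarrow> A\<^sup>n\<close> over \<open>A = k[[x,y,z]]/(xyz)\<close> given by a matrix of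
  power series.\<close>

definition xyz_coker :: "'k::field fps3 mat \<Rightarrow> ('k fps3 set, 'k fps3 set vec set) module" where
  "xyz_coker \<theta> = coker xyz_ring (map_mat xyz_class \<theta>)"

definition theta1 ::
    "'k::field fps3 \<Rightarrow> 'k fps3 \<Rightarrow> 'k fps3 \<Rightarrow> nat \<times> nat \<Rightarrow> 'k \<Rightarrow> 'k fps3 mat" where
  "theta1 u v w = (\<lambda>(p, q) c. mat_of_rows_list 2
     [[u, 0],
      [v ^ p + const3 c * w ^ q, v * w]])"

definition theta2 ::
    "'k::field fps3 \<Rightarrow> 'k fps3 \<Rightarrow> 'k fps3 \<Rightarrow> nat \<times> nat \<Rightarrow> 'k \<Rightarrow> 'k fps3 mat" where
  "theta2 u v w = (\<lambda>(p, q) c. mat_of_rows_list 2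
     [[const3 c * u + v ^ p * w ^ q, w ^ (q + 1)],
      [v ^ (p + 1), v * w]])"

definition theta3 ::
    "'k::field fps3 \<Rightarrow> 'k fps3 \<Rightarrow> 'k fps3 \<Rightarrow> nat \<times> nat \<Rightarrow> 'k \<Rightarrow> 'k fps3 mat" where
  "theta3 u v w pq c = transpose_mat (theta1 u v w pq c)"

definition theta4 ::
    "'k::field fps3 \<Rightarrow> 'k fps3 \<Rightarrow> 'k fps3 \<Rightarrow> nat \<times> nat \<times> nat \<Rightarrow> 'k \<Rightarrow> 'k fps3 mat" where
  "theta4 u v w = (\<lambda>(m, n, l) c. mat_of_rows_list 3
     [[u, w ^ l, 0],
      [0, v, u ^ m],
      [const3 c * v ^ n, 0, w]])"

definition theta5 ::
    "'k::field fps3 \<Rightarrow> 'k fps3 \<Rightarrow> 'k fps3 \<Rightarrow> nat \<times> nat \<times> nat \<Rightarrow> 'k \<Rightarrow> 'k fps3 mat" where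
  "theta5 u v w = (\<lambda>(m, n, l) c. mat_of_rows_list 3
     [[u, w ^ l, const3 c * v ^ n],
      [0, v, u ^ m],
      [0, 0, w]])"

definition theta6 ::
    "'k::field fps3 \<Rightarrow> 'k fps3 \<Rightarrow> 'k fps3 \<Rightarrow> nat \<times> nat \<times> nat \<Rightarrow> 'k \<Rightarrow> 'k fps3 mat" where
  "theta6 u v w mnl c = transpose_mat (theta4 u v w mnl c)"

definition theta7 ::
    "'k::field fps3 \<Rightarrow> 'k fps3 \<Rightarrow> 'k fps3 \<Rightarrow> nat \<times> nat \<times> nat \<Rightarrow> 'k \<Rightarrow> 'k fps3 mat" where
  "theta7 u v w mnl c = transpose_mat (theta5 u v w mnl c)"

end

theory Submission
  imports Defs "HOL-Library.Product_Plus" "Jordan_Normal_Form.Determinant"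
begin

text \<open>Localizing at the three minimal primes embeds \<open>M\<close> into the product of the power series rings of
  the coordinate planes \<open>x = 0\<close>, \<open>y = 0\<close>, \<open>z = 0\<close>. Since \<open>M\<close> has depth two, the part of \<open>M\<close> supported
  on one plane is a principal ideal there. After rescaling each component it becomes the ideal \<open>(st)\<close>, and
  freeness along the axes together with depth two shows that \<open>M\<close> consists of all triples \<open>(f, g, h)\<close> whose
  restrictions to the axes satisfy one linear equation per axis. Units in these equations can be absorbed
  into the components, which leaves one integer exponent per axis and a single scalar. Up to rotations and
  reflections only four sign patterns of the exponents occur. For each of them two or three explicit triples
  generate; their relations are determined by applying the adjugate of the matrix and reducing modulo each of
  the three variables.\<close>

section \<open>Modules over a commutative ring\<close>

subsection \<open>Localization at a prime\<close>

text \<open>Depth two makes M behave like a line bundle on the punctured union of the three planes.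
  On a punctured plane a line bundle is trivial because k[[s,t]] is factorial; along a punctured
  axis two trivializations differ by a nonzero element of k((X)), that is, by X^d times a unit. The
  three planes meet in a cycle, so absorbing units leaves the exponents d1, d2, d3 and the holonomy
  of the cycle, a nonzero scalar: this is the origin of the integers and of \<lambda> in the
  statement. A itself has exponents zero and holonomy 1. The integers in the matrices are not always
  the gluing exponents. If no exponent is negative and A is excluded, every triple vanishes at the
  origin, and generators that vanish there raise each exponent by one; in the mixed case the middle
  exponent drops by one. The number of generators is read off from the matrices, since all their
  entries lie in the maximal ideal. Power series in three variables act on M throughout, so that
  \<open>u * v * w\<close> can be cancelled in a domain before passing to the quotient.\<close>

lemma regular_module_module: "cring R \<Longrightarrow> module R (regular_module R)"
proof -
  assume "cring R"
  then interpret cring R .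
  have "abelian_group (regular_module R)"
  proof (rule abelian_groupI)
    fix x assume "x \<in> carrier (regular_module R)"
    then show "\<exists>y\<in>carrier (regular_module R). y \<oplus>\<^bsub>regular_module R\<^esub> x = \<zero>\<^bsub>regular_module R\<^esub>"
      by (intro bexI[of _ "\<ominus>\<^bsub>R\<^esub> x"]) (simp_all add: regular_module_def l_neg)
  qed (simp_all add: regular_module_def a_ac)
  then show ?thesis
    by (rule moduleI[OF is_cring]) (simp_all add: regular_module_def l_distr r_distr m_assoc)
qed

definition mult_subset :: "('a, 'r) ring_scheme \<Rightarrow> 'a set \<Rightarrow> bool" where
  "mult_subset R S \<longleftrightarrow> S \<subseteq> carrier R \<and> \<one>\<^bsub>R\<^esub> \<in> S \<and> (\<forall>s\<in>S. \<forall>t\<in>S. s \<otimes>\<^bsub>R\<^esub> t \<in> S)"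

lemma mult_subset_compl_prime:
  assumes "primeideal \<pp> R" shows "mult_subset R (carrier R - \<pp>)"
proof -
  interpret primeideal \<pp> R by fact
  have "\<one>\<^bsub>R\<^esub> \<notin> \<pp>" using I_notcarr one_imp_carrier by blast
  then show ?thesis unfolding mult_subset_def using I_prime by auto
qed

context module
begin

lemma smult_left_commute:
  "\<lbrakk>a \<in> carrier R; b \<in> carrier R; x \<in> carrier M\<rbrakk> \<Longrightarrow> a \<odot>\<^bsub>M\<^esub> (b \<odot>\<^bsub>M\<^esub> x) = b \<odot>\<^bsub>M\<^esub> (a \<odot>\<^bsub>M\<^esub> x)"
  by (metis R.m_comm smult_assoc1)

text \<open>This is transitivity for equality of fractions; exchanging the two fractions gives the
  opposite inclusion. Since M may have torsion, nothing can be cancelled and the multipliers have to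
  be collected.\<close>

lemma fraction_eqI:
  assumes S: "mult_subset R S" and m: "m \<in> carrier M" and n: "n \<in> carrier M" and s: "s \<in> S" and t: "t \<in> S"
    and u: "u \<in> S" and eq: "u \<odot>\<^bsub>M\<^esub> (t \<odot>\<^bsub>M\<^esub> m) = u \<odot>\<^bsub>M\<^esub> (s \<odot>\<^bsub>M\<^esub> n)"
  shows "fraction R S M n t \<subseteq> fraction R S M m s"
proof (clarsimp simp: fraction_def)
  fix p r u' assume p: "p \<in> carrier M" and r: "r \<in> S" and u': "u' \<in> S"
    and eq': "u' \<odot>\<^bsub>M\<^esub> (r \<odot>\<^bsub>M\<^esub> n) = u' \<odot>\<^bsub>M\<^esub> (t \<odot>\<^bsub>M\<^esub> p)"
  have Sc: "S \<subseteq> carrier R" and Sm: "\<And>a b. a \<in> S \<Longrightarrow> b \<in> S \<Longrightarrow> a \<otimes>\<^bsub>R\<^esub> b \<in> S"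
    using S unfolding mult_subset_def by blast+
  have c: "u \<in> carrier R" "u' \<in> carrier R" "t \<in> carrier R" "s \<in> carrier R" "r \<in> carrier R"
    using Sc u u' t s r by auto
  \<comment> \<open>The extra factor \<open>t\<close> is the denominator of the middle fraction,
    which both equations share.\<close>
  have "(u \<otimes>\<^bsub>R\<^esub> u' \<otimes>\<^bsub>R\<^esub> t) \<odot>\<^bsub>M\<^esub> (r \<odot>\<^bsub>M\<^esub> m) = u' \<odot>\<^bsub>M\<^esub> (r \<odot>\<^bsub>M\<^esub> (u \<odot>\<^bsub>M\<^esub> (t \<odot>\<^bsub>M\<^esub> m)))"
    using c m by (simp add: smult_assoc1 smult_left_commute)
  also have "\<dots> = s \<odot>\<^bsub>M\<^esub> (u \<odot>\<^bsub>M\<^esub> (u' \<odot>\<^bsub>M\<^esub> (r \<odot>\<^bsub>M\<^esub> n)))"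
    unfolding eq using c n by (simp add: smult_left_commute)
  also have "\<dots> = (u \<otimes>\<^bsub>R\<^esub> u' \<otimes>\<^bsub>R\<^esub> t) \<odot>\<^bsub>M\<^esub> (s \<odot>\<^bsub>M\<^esub> p)"
    unfolding eq' using c p by (simp add: smult_assoc1 smult_left_commute)
  finally show "\<exists>u\<in>S. u \<odot>\<^bsub>M\<^esub> (r \<odot>\<^bsub>M\<^esub> m) = u \<odot>\<^bsub>M\<^esub> (s \<odot>\<^bsub>M\<^esub> p)"
    using Sm u u' t by blast
qed

lemma fraction_self:
  assumes "mult_subset R S" "m \<in> carrier M" "s \<in> S"
  shows "(m, s) \<in> fraction R S M m s"
  using assms unfolding fraction_def mult_subset_def by auto

lemma fraction_eq_iff:
  assumes S: "mult_subset R S" and m: "m \<in> carrier M" and n: "n \<in> carrier M" and s: "s \<in> S" and t: "t \<in> S"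
  shows "fraction R S M m s = fraction R S M n t \<longleftrightarrow>
    (\<exists>u\<in>S. u \<odot>\<^bsub>M\<^esub> (t \<odot>\<^bsub>M\<^esub> m) = u \<odot>\<^bsub>M\<^esub> (s \<odot>\<^bsub>M\<^esub> n))"
proof
  assume "fraction R S M m s = fraction R S M n t"
  then have "(n, t) \<in> fraction R S M m s" using fraction_self[OF S n t] by simp
  then show "\<exists>u\<in>S. u \<odot>\<^bsub>M\<^esub> (t \<odot>\<^bsub>M\<^esub> m) = u \<odot>\<^bsub>M\<^esub> (s \<odot>\<^bsub>M\<^esub> n)" unfolding fraction_def by auto
next
  assume "\<exists>u\<in>S. u \<odot>\<^bsub>M\<^esub> (t \<odot>\<^bsub>M\<^esub> m) = u \<odot>\<^bsub>M\<^esub> (s \<odot>\<^bsub>M\<^esub> n)"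
  then obtain u where "u \<in> S" "u \<odot>\<^bsub>M\<^esub> (t \<odot>\<^bsub>M\<^esub> m) = u \<odot>\<^bsub>M\<^esub> (s \<odot>\<^bsub>M\<^esub> n)" by blast
  then show "fraction R S M m s = fraction R S M n t"
    using fraction_eqI[OF S m n s t] fraction_eqI[OF S n m t s] by (metis subset_antisym)
qed

text \<open>The product is a union over all representatives, so every pair of representatives has to
  give the same class; the union of a nonempty family of equal sets then collapses. For
  \<open>regular_module R\<close> this is the multiplication of the localized ring.\<close>

lemma localized_smult:
  assumes S: "mult_subset R S" and a: "a \<in> carrier R" and s: "s \<in> S" and m: "m \<in> carrier M" and t: "t \<in> S"
  shows "fraction R S (regular_module R) a s \<odot>\<^bsub>localized_module R S M\<^esub> fraction R S M m t
    = fraction R S M (a \<odot>\<^bsub>M\<^esub> m) (s \<otimes>\<^bsub>R\<^esub> t)"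
proof -
  interpret reg: module R "regular_module R" by (rule regular_module_module) (rule R.is_cring)
  have Sc: "S \<subseteq> carrier R" and Sm: "\<And>a b. a \<in> S \<Longrightarrow> b \<in> S \<Longrightarrow> a \<otimes>\<^bsub>R\<^esub> b \<in> S"
    using S unfolding mult_subset_def by blast+
  have eq: "fraction R S M (a' \<odot>\<^bsub>M\<^esub> m') (s' \<otimes>\<^bsub>R\<^esub> t') = fraction R S M (a \<odot>\<^bsub>M\<^esub> m) (s \<otimes>\<^bsub>R\<^esub> t)"
    if 1: "(a', s') \<in> fraction R S (regular_module R) a s" and 2: "(m', t') \<in> fraction R S M m t" for a' s' m' t'
  proof -
    from 1 obtain u where u: "a' \<in> carrier R" "s' \<in> S" "u \<in> S" "u \<otimes>\<^bsub>R\<^esub> (s' \<otimes>\<^bsub>R\<^esub> a) = u \<otimes>\<^bsub>R\<^esub> (s \<otimes>\<^bsub>R\<^esub> a')"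
      unfolding fraction_def by (auto simp: regular_module_def)
    from 2 obtain u' where u': "m' \<in> carrier M" "t' \<in> S" "u' \<in> S" "u' \<odot>\<^bsub>M\<^esub> (t' \<odot>\<^bsub>M\<^esub> m) = u' \<odot>\<^bsub>M\<^esub> (t \<odot>\<^bsub>M\<^esub> m')"
      unfolding fraction_def by auto
    have c: "u \<in> carrier R" "u' \<in> carrier R" "s' \<in> carrier R" "t' \<in> carrier R" "s \<in> carrier R" "t \<in> carrier R"
      using u u' s t Sc by auto
    have "(u \<otimes>\<^bsub>R\<^esub> u') \<odot>\<^bsub>M\<^esub> ((s \<otimes>\<^bsub>R\<^esub> t) \<odot>\<^bsub>M\<^esub> (a' \<odot>\<^bsub>M\<^esub> m')) = (u \<otimes>\<^bsub>R\<^esub> (s \<otimes>\<^bsub>R\<^esub> a')) \<odot>\<^bsub>M\<^esub> (u' \<odot>\<^bsub>M\<^esub> (t \<odot>\<^bsub>M\<^esub> m'))"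
      using c u(1) u'(1) by (simp add: smult_assoc1 smult_left_commute)
    also have "\<dots> = (u \<otimes>\<^bsub>R\<^esub> (s' \<otimes>\<^bsub>R\<^esub> a)) \<odot>\<^bsub>M\<^esub> (u' \<odot>\<^bsub>M\<^esub> (t' \<odot>\<^bsub>M\<^esub> m))"
      using u u' by simp
    also have "\<dots> = (u \<otimes>\<^bsub>R\<^esub> u') \<odot>\<^bsub>M\<^esub> ((s' \<otimes>\<^bsub>R\<^esub> t') \<odot>\<^bsub>M\<^esub> (a \<odot>\<^bsub>M\<^esub> m))"
      using c a m by (simp add: smult_assoc1 smult_left_commute)
    finally show ?thesis
      by (intro iffD2[OF fraction_eq_iff[OF S]] bexI[of _ "u \<otimes>\<^bsub>R\<^esub> u'"] Sm smult_closed)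
        (use u u' a m s t in simp_all)
  qed
  have "(a, s) \<in> fraction R S (regular_module R) a s"
    using reg.fraction_self[OF S _ s] a by (simp add: regular_module_def)
  moreover have "(m, t) \<in> fraction R S M m t" using fraction_self[OF S m t] .
  ultimately have ne: "\<exists>x. x \<in> fraction R S (regular_module R) a s" "\<exists>x. x \<in> fraction R S M m t" by blast+
  have "fraction R S (regular_module R) a s \<odot>\<^bsub>localized_module R S M\<^esub> fraction R S M m t
     = (\<Union>x\<in>fraction R S (regular_module R) a s. \<Union>y\<in>fraction R S M m t.
          fraction R S M (fst x \<odot>\<^bsub>M\<^esub> fst y) (snd x \<otimes>\<^bsub>R\<^esub> snd y))"
    by (simp add: localized_module_def case_prod_beta)
  also have "\<dots> = (\<Union>x\<in>fraction R S (regular_module R) a s. \<Union>y\<in>fraction R S M m t.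
          fraction R S M (a \<odot>\<^bsub>M\<^esub> m) (s \<otimes>\<^bsub>R\<^esub> t))"
    by (intro SUP_cong refl) (rule eq, auto)
  finally show ?thesis using ne by auto
qed

text \<open>The vector \<open>e\<close> below is the numerator of a basis of the localization.\<close>

lemma localized_free_of_rank_one:
  assumes p: "primeideal \<pp> R" and free: "localized_free_of_rank R M \<pp> 1"
  obtains e where "e \<in> carrier M"
    "\<And>m. m \<in> carrier M \<Longrightarrow> \<exists>r\<in>carrier R - \<pp>. \<exists>r'\<in>carrier R. r \<odot>\<^bsub>M\<^esub> m = r' \<odot>\<^bsub>M\<^esub> e"
    "\<And>r. r \<in> carrier R \<Longrightarrow> r \<odot>\<^bsub>M\<^esub> e = \<zero>\<^bsub>M\<^esub> \<Longrightarrow> \<exists>u\<in>carrier R - \<pp>. u \<otimes>\<^bsub>R\<^esub> r = \<zero>\<^bsub>R\<^esub>"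
proof -
  interpret reg: module R "regular_module R" by (rule regular_module_module) (rule R.is_cring)
  define S where "S = carrier R - \<pp>"
  have S: "mult_subset R S" unfolding S_def by (rule mult_subset_compl_prime[OF p])
  then have Sc: "S \<subseteq> carrier R" and Sm: "\<And>a b. a \<in> S \<Longrightarrow> b \<in> S \<Longrightarrow> a \<otimes>\<^bsub>R\<^esub> b \<in> S" and S1: "\<one>\<^bsub>R\<^esub> \<in> S"
    by (auto simp: mult_subset_def)
  let ?L = "localized_module R S M" and ?A = "localized_ring R S"
  let ?fr = "fraction R S (regular_module R)" and ?fm = "fraction R S M"
  have rc: "carrier (regular_module R) = carrier R" by (simp add: regular_module_def)
  have carA: "carrier ?A = {?fr a s | a s. a \<in> carrier R \<and> s \<in> S}"
    by (simp add: localized_ring_def Let_def localized_module_def rc)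
  have multA: "?fr a s \<otimes>\<^bsub>?A\<^esub> ?fr b t = ?fr (a \<otimes>\<^bsub>R\<^esub> b) (s \<otimes>\<^bsub>R\<^esub> t)" if "a \<in> carrier R" "b \<in> carrier R" "s \<in> S" "t \<in> S" for a b s t
    using reg.localized_smult[OF S, of a s b t] that
    by (simp add: localized_ring_def Let_def rc) (simp add: regular_module_def)
  have carL: "carrier ?L = {?fm a s | a s. a \<in> carrier M \<and> s \<in> S}" by (simp add: localized_module_def)
  obtain f where f: "f \<in> iso (add_monoid ?L) (add_monoid (free_module ?A 1))"
    and lin: "\<And>a x. a \<in> carrier ?A \<Longrightarrow> x \<in> carrier ?L \<Longrightarrow> f (a \<odot>\<^bsub>?L\<^esub> x) = a \<odot>\<^bsub>free_module ?A 1\<^esub> f x"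
    using free unfolding localized_free_of_rank_def free_of_rank_def module_iso_def S_def by blast
  have bij: "bij_betw f (carrier ?L) (carrier (free_module ?A 1))" using f unfolding iso_def by simp
  \<comment> \<open>\<open>v\<close> is the standard basis vector of the free module of rank one.
    Its preimage \<open>e/s\<close> is a basis of the localization, and since \<open>s\<close> is
    invertible there, the numerator \<open>e\<close> alone will do.\<close>
  define v where "v = vec 1 (\<lambda>_. ?fr \<one>\<^bsub>R\<^esub> \<one>\<^bsub>R\<^esub>)"
  have inA: "?fr a s \<in> carrier ?A" if "a \<in> carrier R" "s \<in> S" for a s
    unfolding carA by (rule CollectI, rule exI[of _ a], rule exI[of _ s]) (simp add: that)
  have inL: "?fm m s \<in> carrier ?L" if "m \<in> carrier M" "s \<in> S" for m s
    unfolding carL by (rule CollectI, rule exI[of _ m], rule exI[of _ s]) (simp add: that)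
  have carF: "x \<in> carrier (free_module B 1)" if "x \<in> carrier_vec 1" "vec_index x 0 \<in> carrier B" for x and B :: "'z ring"
    using that unfolding free_module_def by simp
  have v: "v \<in> carrier (free_module ?A 1)"
    by (rule carF) (unfold v_def, simp, subst index_vec, simp, rule inA[OF R.one_closed S1])
  have "v \<in> f ` carrier ?L" using v by (simp only: bij_betw_imp_surj_on[OF bij])
  then obtain E where E: "E \<in> carrier ?L" "f E = v" by (elim imageE) simp
  have "\<exists>e s. E = ?fm e s \<and> e \<in> carrier M \<and> s \<in> S" using E(1) unfolding carL by (rule CollectD)
  then obtain e s where es: "e \<in> carrier M" "s \<in> S" "E = ?fm e s" by metis
  have sR: "s \<in> carrier R" using es Sc by blast
  have scal: "f (?fr a t \<odot>\<^bsub>?L\<^esub> E) = vec 1 (\<lambda>_. ?fr a t)" if "a \<in> carrier R" "t \<in> S" for a t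
  proof -
    have tR: "t \<in> carrier R" using that Sc by blast
    have "?fr a t \<in> carrier ?A" using inA that .
    then have "f (?fr a t \<odot>\<^bsub>?L\<^esub> E) = vec 1 (\<lambda>_. ?fr a t \<otimes>\<^bsub>?A\<^esub> ?fr \<one>\<^bsub>R\<^esub> \<one>\<^bsub>R\<^esub>)"
      using lin[OF _ E(1)] by (simp add: E(2) free_module_def v_def) (intro eq_vecI, simp_all)
    also have "\<dots> = vec 1 (\<lambda>_. ?fr a t)" using that S1 tR by (simp add: multA)
    finally show ?thesis .
  qed
  have tm: "?fr a t \<odot>\<^bsub>?L\<^esub> E = ?fm (a \<odot>\<^bsub>M\<^esub> e) (t \<otimes>\<^bsub>R\<^esub> s)" if "a \<in> carrier R" "t \<in> S" for a t
    using localized_smult[OF S _ _ es(1,2)] that es by simp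
  have inL': "?fm (a \<odot>\<^bsub>M\<^esub> e) (t \<otimes>\<^bsub>R\<^esub> s) \<in> carrier ?L" if "a \<in> carrier R" "t \<in> S" for a t
    using inL Sm that es smult_closed by simp
  show ?thesis
  proof (rule that[OF es(1)])
    fix m assume m: "m \<in> carrier M"
    have mL: "?fm m \<one>\<^bsub>R\<^esub> \<in> carrier ?L" using inL m S1 .
    then have "f (?fm m \<one>\<^bsub>R\<^esub>) \<in> carrier (free_module ?A 1)" by (rule bij_betw_apply[OF bij])
    then obtain w where w: "f (?fm m \<one>\<^bsub>R\<^esub>) = w" "w \<in> carrier_vec 1" "vec_index w 0 \<in> carrier ?A"
      by (auto simp: free_module_def)
    then have "\<exists>a t. vec_index w 0 = ?fr a t \<and> a \<in> carrier R \<and> t \<in> S" unfolding carA by (elim CollectD)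
    then obtain a t where at: "a \<in> carrier R" "t \<in> S" "vec_index w 0 = ?fr a t" by metis
    have "w = vec 1 (\<lambda>_. ?fr a t)" using w at by (intro eq_vecI) auto
    then have "f (?fm m \<one>\<^bsub>R\<^esub>) = f (?fm (a \<odot>\<^bsub>M\<^esub> e) (t \<otimes>\<^bsub>R\<^esub> s))"
      using scal[OF at(1,2)] tm[OF at(1,2)] w(1) by simp
    then have "?fm m \<one>\<^bsub>R\<^esub> = ?fm (a \<odot>\<^bsub>M\<^esub> e) (t \<otimes>\<^bsub>R\<^esub> s)"
      by (rule inj_onD[OF bij_betw_imp_inj_on[OF bij] _ mL inL'[OF at(1,2)]])
    then obtain u where u: "u \<in> S" "u \<odot>\<^bsub>M\<^esub> ((t \<otimes>\<^bsub>R\<^esub> s) \<odot>\<^bsub>M\<^esub> m) = u \<odot>\<^bsub>M\<^esub> (\<one>\<^bsub>R\<^esub> \<odot>\<^bsub>M\<^esub> (a \<odot>\<^bsub>M\<^esub> e))"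
      using fraction_eq_iff[OF S m _ S1, of "a \<odot>\<^bsub>M\<^esub> e" "t \<otimes>\<^bsub>R\<^esub> s"] at(1,2) es(1,2) Sm smult_closed by metis
    have uR: "u \<in> carrier R" "t \<in> carrier R" using u at Sc by auto
    have "(u \<otimes>\<^bsub>R\<^esub> (t \<otimes>\<^bsub>R\<^esub> s)) \<odot>\<^bsub>M\<^esub> m = (u \<otimes>\<^bsub>R\<^esub> a) \<odot>\<^bsub>M\<^esub> e"
      using u uR at m sR es by (simp add: smult_assoc1)
    moreover have "u \<otimes>\<^bsub>R\<^esub> (t \<otimes>\<^bsub>R\<^esub> s) \<in> carrier R - \<pp>" using u at es Sm unfolding S_def[symmetric] by blast
    ultimately show "\<exists>r\<in>carrier R - \<pp>. \<exists>r'\<in>carrier R. r \<odot>\<^bsub>M\<^esub> m = r' \<odot>\<^bsub>M\<^esub> e"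
      using uR at by blast
  next
    fix r assume r: "r \<in> carrier R" "r \<odot>\<^bsub>M\<^esub> e = \<zero>\<^bsub>M\<^esub>"
    have z: "\<zero>\<^bsub>R\<^esub> \<odot>\<^bsub>M\<^esub> e = \<zero>\<^bsub>M\<^esub>" using es(1) smult_l_null by blast
    have "?fr r \<one>\<^bsub>R\<^esub> \<odot>\<^bsub>?L\<^esub> E = ?fr \<zero>\<^bsub>R\<^esub> \<one>\<^bsub>R\<^esub> \<odot>\<^bsub>?L\<^esub> E" using tm[of r "\<one>\<^bsub>R\<^esub>"] tm[of "\<zero>\<^bsub>R\<^esub>" "\<one>\<^bsub>R\<^esub>"] S1 r z by simp
    then have "vec 1 (\<lambda>_. ?fr r \<one>\<^bsub>R\<^esub>) = vec 1 (\<lambda>_. ?fr \<zero>\<^bsub>R\<^esub> \<one>\<^bsub>R\<^esub>)" using scal[of r "\<one>\<^bsub>R\<^esub>"] scal[of "\<zero>\<^bsub>R\<^esub>" "\<one>\<^bsub>R\<^esub>"] S1 r by simp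
    then have "?fr r \<one>\<^bsub>R\<^esub> = ?fr \<zero>\<^bsub>R\<^esub> \<one>\<^bsub>R\<^esub>" by (metis index_vec less_one)
    then have "\<exists>u\<in>S. u \<otimes>\<^bsub>R\<^esub> (\<one>\<^bsub>R\<^esub> \<otimes>\<^bsub>R\<^esub> r) = u \<otimes>\<^bsub>R\<^esub> (\<one>\<^bsub>R\<^esub> \<otimes>\<^bsub>R\<^esub> \<zero>\<^bsub>R\<^esub>)"
      using reg.fraction_eq_iff[OF S, of r "\<zero>\<^bsub>R\<^esub>" "\<one>\<^bsub>R\<^esub>" "\<one>\<^bsub>R\<^esub>"] S1 r by (simp add: rc) (simp add: regular_module_def)
    then obtain u where u: "u \<in> S" "u \<otimes>\<^bsub>R\<^esub> (\<one>\<^bsub>R\<^esub> \<otimes>\<^bsub>R\<^esub> r) = u \<otimes>\<^bsub>R\<^esub> (\<one>\<^bsub>R\<^esub> \<otimes>\<^bsub>R\<^esub> \<zero>\<^bsub>R\<^esub>)" by blast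
    moreover have "u \<in> carrier R" using u Sc by blast
    ultimately show "\<exists>u\<in>carrier R - \<pp>. u \<otimes>\<^bsub>R\<^esub> r = \<zero>\<^bsub>R\<^esub>" using r unfolding S_def[symmetric] by auto
  qed
qed

subsection \<open>Regular sequences\<close>

lemma submodule_span_minimal:
  "submodule N R M \<Longrightarrow> S \<subseteq> N \<Longrightarrow> submodule_span R M S \<subseteq> N"
  unfolding submodule_span_def by blast

lemma submodule_span_incl: "S \<subseteq> submodule_span R M S"
  unfolding submodule_span_def by blast

lemma zero_mem_submodule: "submodule N R M \<Longrightarrow> \<zero>\<^bsub>M\<^esub> \<in> N"
  using subgroup.one_closed[OF submodule.axioms(1)] by fastforce

lemma submodule_zero: "submodule {\<zero>\<^bsub>M\<^esub>} R M"
  by (rule submoduleI) auto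

lemma submodule_carrier: "submodule (carrier M) R M"
  by (rule submoduleI) auto

lemma ideal_times_empty: "ideal_times R M {} = {\<zero>\<^bsub>M\<^esub>}"
proof -
  have "ideal_times R M {} \<subseteq> {\<zero>\<^bsub>M\<^esub>}"
    unfolding ideal_times_def by (rule submodule_span_minimal[OF submodule_zero]) auto
  moreover have "\<zero>\<^bsub>M\<^esub> \<in> ideal_times R M {}"
    unfolding ideal_times_def submodule_span_def
    using zero_mem_submodule by blast
  ultimately show ?thesis by blast
qed

lemma submodule_smult_image:
  assumes a: "a \<in> carrier R" shows "submodule {a \<odot>\<^bsub>M\<^esub> x | x. x \<in> carrier M} R M"
proof (rule submoduleI)
  show "\<zero>\<^bsub>M\<^esub> \<in> {a \<odot>\<^bsub>M\<^esub> x | x. x \<in> carrier M}" using smult_r_null[OF a] by (metis (mono_tags, lifting) M.zero_closed mem_Collect_eq)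
  show "\<ominus>\<^bsub>M\<^esub> y \<in> {a \<odot>\<^bsub>M\<^esub> x | x. x \<in> carrier M}" if "y \<in> {a \<odot>\<^bsub>M\<^esub> x | x. x \<in> carrier M}" for y
    using that smult_r_minus[OF a] by (clarsimp) (metis M.a_inv_closed)
  show "y \<oplus>\<^bsub>M\<^esub> z \<in> {a \<odot>\<^bsub>M\<^esub> x | x. x \<in> carrier M}"
    if "y \<in> {a \<odot>\<^bsub>M\<^esub> x | x. x \<in> carrier M}" "z \<in> {a \<odot>\<^bsub>M\<^esub> x | x. x \<in> carrier M}" for y z
    using that smult_r_distr[OF a] by (clarsimp) (metis M.a_closed)
  show "b \<odot>\<^bsub>M\<^esub> y \<in> {a \<odot>\<^bsub>M\<^esub> x | x. x \<in> carrier M}"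
    if "b \<in> carrier R" "y \<in> {a \<odot>\<^bsub>M\<^esub> x | x. x \<in> carrier M}" for b y
    using that smult_left_commute[OF a] by (clarsimp) (metis smult_closed)
qed (use a in auto)

lemma ideal_times_singleton:
  assumes a: "a \<in> carrier R" shows "ideal_times R M {a} \<subseteq> {a \<odot>\<^bsub>M\<^esub> x | x. x \<in> carrier M}"
  unfolding ideal_times_def by (rule submodule_span_minimal[OF submodule_smult_image[OF a]]) auto

lemma ideal_times_singleton_mem:
  assumes "x \<in> carrier M" shows "a \<odot>\<^bsub>M\<^esub> x \<in> ideal_times R M {a}"
  unfolding ideal_times_def by (rule subsetD[OF submodule_span_incl]) (use assms in auto)

lemma submodule_ideal_times_singleton:
  assumes "a \<in> carrier R" shows "submodule (ideal_times R M {a}) R M"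
proof -
  have "ideal_times R M {a} = {a \<odot>\<^bsub>M\<^esub> x | x. x \<in> carrier M}"
    using ideal_times_singleton[OF assms] ideal_times_singleton_mem by blast
  then show ?thesis using submodule_smult_image[OF assms] by simp
qed

text \<open>Multiplication by \<open>a\<close> on a coset is a union over its elements; because
  \<open>a x\<close> lies in N, each of them contributes the coset N, so the union is the zero of
  the quotient.\<close>

lemma nonzerodivisor_quot:
  assumes N: "submodule N R M" and a: "a \<in> carrier R"
    and nzd: "nonzerodivisor_on R (quot_module R M N) a"
    and x: "x \<in> carrier M" and ax: "a \<odot>\<^bsub>M\<^esub> x \<in> N"
  shows "x \<in> N"
proof -
  have sg: "subgroup N (add_monoid M)" using N submodule.axioms(1) by blast
  interpret as: abelian_subgroup N M
    by (rule abelian_subgroupI3[OF _ M.abelian_group_axioms])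
      (use sg in \<open>simp add: additive_subgroup.intro\<close>)
  have NM: "N \<subseteq> carrier M" using submoduleE(1)[OF N] .
  let ?Z = "N +>\<^bsub>M\<^esub> x"
  have X: "?Z \<in> carrier (quot_module R M N)"
    using x NM by (simp add: quot_module_def A_RCOSETS_defs a_r_coset_def) blast
  have inX: "x \<in> ?Z" using as.a_rcos_self[OF x] .
  have "N +>\<^bsub>M\<^esub> (a \<odot>\<^bsub>M\<^esub> y) = N" if y: "y \<in> ?Z" for y
  proof -
    obtain n where n: "n \<in> N" "y = n \<oplus>\<^bsub>M\<^esub> x" using y unfolding a_r_coset_def' by auto
    then have "a \<odot>\<^bsub>M\<^esub> y = a \<odot>\<^bsub>M\<^esub> n \<oplus>\<^bsub>M\<^esub> a \<odot>\<^bsub>M\<^esub> x" using smult_r_distr a x NM by blast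
    then have "a \<odot>\<^bsub>M\<^esub> y \<in> N" using submoduleE(4,5)[OF N] a n ax by auto
    then show ?thesis by (rule as.a_rcos_const)
  qed
  then have "a \<odot>\<^bsub>quot_module R M N\<^esub> ?Z = \<zero>\<^bsub>quot_module R M N\<^esub>"
    using inX by (auto simp: quot_module_def)
  then have "?Z = N" using nzd X unfolding nonzerodivisor_on_def by (auto simp: quot_module_def)
  then show ?thesis using inX by simp
qed

text \<open>The elementary form in which depth at least two is used from here on. For the first
  element the quotient by the zero submodule stands for M; for the second, vanishing of
  \<open>b x\<close> in \<open>M/aM\<close> is written as \<open>b x = a y\<close>.\<close>

lemma regular_sequence_two:
  assumes reg: "regular_sequence R M as" and len: "length as \<ge> 2"
  obtains a b where "a \<in> set as" "b \<in> set as"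
    "\<And>x. x \<in> carrier M \<Longrightarrow> a \<odot>\<^bsub>M\<^esub> x = \<zero>\<^bsub>M\<^esub> \<Longrightarrow> x = \<zero>\<^bsub>M\<^esub>"
    "\<And>x y. x \<in> carrier M \<Longrightarrow> y \<in> carrier M \<Longrightarrow> b \<odot>\<^bsub>M\<^esub> x = a \<odot>\<^bsub>M\<^esub> y \<Longrightarrow> \<exists>z\<in>carrier M. x = a \<odot>\<^bsub>M\<^esub> z"
proof -
  obtain a b cs where as: "as = a # b # cs"
    using len by (metis (no_types) Suc_le_length_iff numeral_2_eq_2)
  have ab: "a \<in> carrier R" "b \<in> carrier R" using reg as unfolding regular_sequence_def by auto
  have "nonzerodivisor_on R (quot_module R M (ideal_times R M (set (take 0 as)))) (as ! 0)"
    using reg len unfolding regular_sequence_def by (meson less_le_trans zero_less_numeral)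
  then have 0: "nonzerodivisor_on R (quot_module R M {\<zero>\<^bsub>M\<^esub>}) a"
    by (simp add: ideal_times_empty as)
  have "nonzerodivisor_on R (quot_module R M (ideal_times R M (set (take 1 as)))) (as ! 1)"
    using reg len unfolding regular_sequence_def by (meson less_le_trans one_less_numeral_iff semiring_norm(76))
  then have 1: "nonzerodivisor_on R (quot_module R M (ideal_times R M {a})) b"
    by (simp add: as)
  show ?thesis
  proof (rule that)
    show "x = \<zero>\<^bsub>M\<^esub>" if "x \<in> carrier M" "a \<odot>\<^bsub>M\<^esub> x = \<zero>\<^bsub>M\<^esub>" for x
      using nonzerodivisor_quot[OF submodule_zero ab(1) 0 that(1)] that by simp
    show "\<exists>z\<in>carrier M. x = a \<odot>\<^bsub>M\<^esub> z" if "x \<in> carrier M" "y \<in> carrier M" "b \<odot>\<^bsub>M\<^esub> x = a \<odot>\<^bsub>M\<^esub> y" for x y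
    proof -
      have "b \<odot>\<^bsub>M\<^esub> x \<in> ideal_times R M {a}" using ideal_times_singleton_mem[OF that(2)] that(3) by simp
      then have "x \<in> ideal_times R M {a}"
        using nonzerodivisor_quot[OF submodule_ideal_times_singleton[OF ab(1)] ab(2) 1 that(1)] by simp
      then show ?thesis using ideal_times_singleton[OF ab(1)] by blast
    qed
  qed (auto simp: as)
qed

lemma submodule_submodule_span: "S \<subseteq> carrier M \<Longrightarrow> submodule (submodule_span R M S) R M"
  unfolding submodule_span_def
  by (rule submoduleI)
    (auto intro: zero_mem_submodule submoduleE(3-5) simp: submodule_carrier)

end

subsection \<open>Cokernels\<close>

text \<open>The maps that arise naturally run from a cokernel, or from the ring, to M, whereas
  \<open>module_iso\<close> asks for one out of M. Linearity of the inverse follows from injectivity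
  and from closure of Q under its operations.\<close>

lemma module_isoI_inverse:
  assumes bij: "bij_betw f (carrier Q) (carrier M)"
    and plus_closed: "\<And>x y. x \<in> carrier Q \<Longrightarrow> y \<in> carrier Q \<Longrightarrow> x \<oplus>\<^bsub>Q\<^esub> y \<in> carrier Q"
    and plus: "\<And>x y. x \<in> carrier Q \<Longrightarrow> y \<in> carrier Q \<Longrightarrow> f (x \<oplus>\<^bsub>Q\<^esub> y) = f x \<oplus>\<^bsub>M\<^esub> f y"
    and closed: "\<And>a x. a \<in> carrier R \<Longrightarrow> x \<in> carrier Q \<Longrightarrow> a \<odot>\<^bsub>Q\<^esub> x \<in> carrier Q"
    and lin: "\<And>a x. a \<in> carrier R \<Longrightarrow> x \<in> carrier Q \<Longrightarrow> f (a \<odot>\<^bsub>Q\<^esub> x) = a \<odot>\<^bsub>M\<^esub> f x"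
  shows "module_iso R M Q"
proof -
  let ?g = "inv_into (carrier Q) f"
  have gx: "?g x \<in> carrier Q" "f (?g x) = x" if "x \<in> carrier M" for x
    using that bij by (simp_all add: bij_betw_def f_inv_into_f inv_into_into)
  have gf: "?g (f x) = x" if "x \<in> carrier Q" for x
    using that bij by (simp add: bij_betw_def)
  have "?g (x \<oplus>\<^bsub>M\<^esub> y) = ?g x \<oplus>\<^bsub>Q\<^esub> ?g y" if "x \<in> carrier M" "y \<in> carrier M" for x y
    using gf[OF plus_closed[OF gx(1)[OF that(1)] gx(1)[OF that(2)]]] plus[OF gx(1)[OF that(1)] gx(1)[OF that(2)]]
      gx(2) that by simp
  then have "?g \<in> iso (add_monoid M) (add_monoid Q)"
    using bij_betw_inv_into[OF bij] gx(1) by (simp add: iso_def hom_def)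
  moreover have "?g (a \<odot>\<^bsub>M\<^esub> x) = a \<odot>\<^bsub>Q\<^esub> ?g x" if a: "a \<in> carrier R" and x: "x \<in> carrier M" for a x
    using gf[OF closed[OF a gx(1)[OF x]]] lin[OF a gx(1)[OF x]] gx(2)[OF x] by simp
  ultimately show ?thesis unfolding module_iso_def by blast
qed

text \<open>The first isomorphism theorem for the coset operations of \<open>quot_module\<close>,
  each of which is reduced to the operation on representatives.\<close>

lemma module_iso_quot:
  assumes F: "module R F" and M: "module R M"
    and g: "g \<in> carrier F \<rightarrow> carrier M" and surj: "g ` carrier F = carrier M"
    and add: "\<And>x y. x \<in> carrier F \<Longrightarrow> y \<in> carrier F \<Longrightarrow> g (x \<oplus>\<^bsub>F\<^esub> y) = g x \<oplus>\<^bsub>M\<^esub> g y"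
    and lin: "\<And>a x. a \<in> carrier R \<Longrightarrow> x \<in> carrier F \<Longrightarrow> g (a \<odot>\<^bsub>F\<^esub> x) = a \<odot>\<^bsub>M\<^esub> g x"
    and N: "N = {x \<in> carrier F. g x = \<zero>\<^bsub>M\<^esub>}"
  shows "module_iso R M (quot_module R F N)"
proof -
  interpret F: module R F by fact
  interpret M: module R M by fact
  interpret g: group_hom "add_monoid F" "add_monoid M" g
    by (intro group_hom.intro group_hom_axioms.intro F.add.is_group M.add.is_group)
      (use g add in \<open>simp add: hom_def\<close>)
  let ?Q = "quot_module R F N"
  have ker: "kernel (add_monoid F) (add_monoid M) g = N" by (auto simp: kernel_def N)
  have nN: "N \<lhd> add_monoid F" using g.normal_kernel ker by simp
  then have sg: "subgroup N (add_monoid F)" by (rule normal_imp_subgroup)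
  interpret as: abelian_subgroup N F
    by (rule abelian_subgroupI3[OF _ F.abelian_group_axioms])
      (use sg in \<open>simp add: additive_subgroup.intro\<close>)
  \<comment> \<open>Since N is the kernel of \<open>g\<close>, the image of a coset is a singleton,
    and \<open>the_elem\<close> returns the value of the induced map.\<close>
  define pf where "pf = (\<lambda>Z. the_elem (g ` Z))"
  have gN: "g n = \<zero>\<^bsub>M\<^esub>" "n \<in> carrier F" if "n \<in> N" for n using that unfolding N by auto
  have mem: "z \<in> carrier F" "g z = g x" if "x \<in> carrier F" "z \<in> N +>\<^bsub>F\<^esub> x" for x z
  proof -
    have "z \<in> (\<Union>h\<in>N. {h \<oplus>\<^bsub>F\<^esub> x})" using that(2) unfolding a_r_coset_def' .
    then obtain n where n: "n \<in> N" "z = n \<oplus>\<^bsub>F\<^esub> x" by blast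
    moreover have "g x \<in> carrier M" using g that by blast
    ultimately show "z \<in> carrier F" "g z = g x" using that gN[of n] add[of n x] by auto
  qed
  have zN: "\<zero>\<^bsub>F\<^esub> \<in> N" using as.zero_closed .
  have self: "x \<in> N +>\<^bsub>F\<^esub> x" if "x \<in> carrier F" for x
    unfolding a_r_coset_def' using zN that by (auto intro!: exI bexI[of _ "\<zero>\<^bsub>F\<^esub>"])
  have psi: "pf (N +>\<^bsub>F\<^esub> x) = g x" if "x \<in> carrier F" for x
  proof -
    have "g ` (N +>\<^bsub>F\<^esub> x) = {g x}" using mem[OF that] self[OF that] by blast
    then show ?thesis unfolding pf_def by simp
  qed
  have coset_eq: "N +>\<^bsub>F\<^esub> y = N +>\<^bsub>F\<^esub> x" if "x \<in> carrier F" "y \<in> N +>\<^bsub>F\<^esub> x" for x y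
    using F.a_repr_independence[OF that(2,1) sg] by simp
  have carQ: "carrier ?Q = {N +>\<^bsub>F\<^esub> x | x. x \<in> carrier F}"
    by (auto simp: quot_module_def A_RCOSETS_defs a_r_coset_def)
  have diff: "z \<in> N +>\<^bsub>F\<^esub> x" if "x \<in> carrier F" "z \<in> carrier F" "g z = g x" for x z
  proof -
    have c: "z \<ominus>\<^bsub>F\<^esub> x \<in> carrier F" "(z \<ominus>\<^bsub>F\<^esub> x) \<oplus>\<^bsub>F\<^esub> x = z"
      using that by (simp_all add: a_minus_def F.a_assoc F.l_neg)
    have "g (z \<ominus>\<^bsub>F\<^esub> x) \<oplus>\<^bsub>M\<^esub> g x = g x" using add[OF c(1) that(1)] c(2) that(3) by simp
    moreover have "g x \<in> carrier M" "g (z \<ominus>\<^bsub>F\<^esub> x) \<in> carrier M" using g that c by blast+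
    ultimately have "g (z \<ominus>\<^bsub>F\<^esub> x) = \<zero>\<^bsub>M\<^esub>"
      using M.add.right_cancel[of "g x" "g (z \<ominus>\<^bsub>F\<^esub> x)" "\<zero>\<^bsub>M\<^esub>"] by simp
    then have "z \<ominus>\<^bsub>F\<^esub> x \<in> N" unfolding N using c by simp
    moreover have "z = (z \<ominus>\<^bsub>F\<^esub> x) \<oplus>\<^bsub>F\<^esub> x" using that by (simp add: a_minus_def F.a_assoc F.l_neg)
    ultimately show ?thesis unfolding a_r_coset_def' by blast
  qed
  have sm: "a \<odot>\<^bsub>?Q\<^esub> (N +>\<^bsub>F\<^esub> x) = N +>\<^bsub>F\<^esub> (a \<odot>\<^bsub>F\<^esub> x)" if a: "a \<in> carrier R" and x: "x \<in> carrier F" for a x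
  proof -
    have "N +>\<^bsub>F\<^esub> (a \<odot>\<^bsub>F\<^esub> y) = N +>\<^bsub>F\<^esub> (a \<odot>\<^bsub>F\<^esub> x)" if "y \<in> N +>\<^bsub>F\<^esub> x" for y
    proof (rule coset_eq)
      show "a \<odot>\<^bsub>F\<^esub> y \<in> N +>\<^bsub>F\<^esub> (a \<odot>\<^bsub>F\<^esub> x)"
        using mem[OF x that] a x lin by (intro diff) auto
    qed (use a x in auto)
    then have "(\<Union>y\<in>N +>\<^bsub>F\<^esub> x. N +>\<^bsub>F\<^esub> (a \<odot>\<^bsub>F\<^esub> y)) = (\<Union>y\<in>N +>\<^bsub>F\<^esub> x. N +>\<^bsub>F\<^esub> (a \<odot>\<^bsub>F\<^esub> x))"
      by (intro SUP_cong refl)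
    also have "\<dots> = N +>\<^bsub>F\<^esub> (a \<odot>\<^bsub>F\<^esub> x)" using self[OF x] by blast
    finally show ?thesis by (simp only: quot_module_def module.simps)
  qed
  have pl: "(N +>\<^bsub>F\<^esub> x) \<oplus>\<^bsub>?Q\<^esub> (N +>\<^bsub>F\<^esub> y) = N +>\<^bsub>F\<^esub> (x \<oplus>\<^bsub>F\<^esub> y)"
    if "x \<in> carrier F" "y \<in> carrier F" for x y
    using as.a_rcos_sum[OF that] by (simp add: quot_module_def)
  have inQ: "N +>\<^bsub>F\<^esub> x \<in> carrier ?Q" if "x \<in> carrier F" for x
    using that unfolding carQ by blast
  show ?thesis
  proof (rule module_isoI_inverse)
    have "inj_on pf (carrier ?Q)"
    proof (rule inj_onI)
      fix Z W assume "Z \<in> carrier ?Q" "W \<in> carrier ?Q" and eq: "pf Z = pf W"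
      then obtain x y where xy: "x \<in> carrier F" "y \<in> carrier F" "Z = N +>\<^bsub>F\<^esub> x" "W = N +>\<^bsub>F\<^esub> y"
        unfolding carQ by blast
      then have "g x = g y" using eq psi by simp
      then show "Z = W" using coset_eq diff xy by metis
    qed
    moreover have "pf ` carrier ?Q = carrier M"
    proof -
      have "pf ` carrier ?Q = (\<lambda>x. pf (N +>\<^bsub>F\<^esub> x)) ` carrier F" unfolding carQ by blast
      also have "\<dots> = g ` carrier F" using psi by (intro image_cong) auto
      finally show ?thesis using surj by simp
    qed
    ultimately show "bij_betw pf (carrier ?Q) (carrier M)" unfolding bij_betw_def by blast
  next
    fix Z W assume "Z \<in> carrier ?Q" "W \<in> carrier ?Q"
    then obtain x y where xy: "x \<in> carrier F" "y \<in> carrier F" "Z = N +>\<^bsub>F\<^esub> x" "W = N +>\<^bsub>F\<^esub> y"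
      unfolding carQ by blast
    then show "Z \<oplus>\<^bsub>?Q\<^esub> W \<in> carrier ?Q" "pf (Z \<oplus>\<^bsub>?Q\<^esub> W) = pf Z \<oplus>\<^bsub>M\<^esub> pf W"
      by (simp_all add: pl inQ psi add)
  next
    fix a Z assume a: "a \<in> carrier R" and "Z \<in> carrier ?Q"
    then obtain x where x: "x \<in> carrier F" "Z = N +>\<^bsub>F\<^esub> x" unfolding carQ by blast
    then show "a \<odot>\<^bsub>?Q\<^esub> Z \<in> carrier ?Q" "pf (a \<odot>\<^bsub>?Q\<^esub> Z) = a \<odot>\<^bsub>M\<^esub> pf Z"
      using a by (simp_all add: sm inQ psi lin)
  qed
qed

lemma free_module_module:
  assumes "cring R" shows "module R (free_module R n)"
proof -
  interpret cring R by fact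
  show ?thesis
  proof (rule moduleI)
    show "abelian_group (free_module R n)"
    proof (rule abelian_groupI)
      fix x assume x: "x \<in> carrier (free_module R n)"
      have "vec n (\<lambda>i. \<ominus>\<^bsub>R\<^esub> (x $ i)) \<in> carrier (free_module R n)"
        "vec n (\<lambda>i. \<ominus>\<^bsub>R\<^esub> (x $ i)) \<oplus>\<^bsub>free_module R n\<^esub> x = \<zero>\<^bsub>free_module R n\<^esub>"
        using x by (auto simp: free_module_def l_neg)
      then show "\<exists>y\<in>carrier (free_module R n). y \<oplus>\<^bsub>free_module R n\<^esub> x = \<zero>\<^bsub>free_module R n\<^esub>"
        by (intro bexI)
    qed (auto simp: free_module_def a_ac intro!: eq_vecI)
  qed (auto simp: free_module_def is_cring l_distr r_distr m_assoc intro!: eq_vecI)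
qed

section \<open>Power series in two and three variables\<close>

definition fps_map :: "('a::zero \<Rightarrow> 'b::zero) \<Rightarrow> 'a fps \<Rightarrow> 'b fps" where
  "fps_map h f = Abs_fps (\<lambda>n. h (fps_nth f n))"

lemma fps_map_nth [simp]: "fps_nth (fps_map h f) n = h (fps_nth f n)"
  by (simp add: fps_map_def)

lemma comm_ring_hom_fps_map:
  assumes "comm_ring_hom h" shows "comm_ring_hom (fps_map h)"
proof -
  interpret comm_ring_hom h by fact
  show ?thesis by unfold_locales (simp_all add: fps_eq_iff fps_mult_nth hom_add hom_mult hom_sum fps_one_nth)
qed

lemma comm_ring_hom_nth_0: "comm_ring_hom (\<lambda>f :: 'a::comm_ring_1 fps. fps_nth f 0)"
  by unfold_locales auto

lemma comm_ring_hom_comp: "comm_ring_hom f \<Longrightarrow> comm_ring_hom g \<Longrightarrow> comm_ring_hom (\<lambda>x. f (g x))"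
proof -
  assume "comm_ring_hom f" and "comm_ring_hom g"
  interpret f: comm_ring_hom f by fact
  interpret g: comm_ring_hom g by fact
  show ?thesis by unfold_locales (simp_all add: f.hom_add g.hom_add f.hom_mult g.hom_mult)
qed

text \<open>The two variables of an iterated series enter asymmetrically. This involution carries
  statements about one of them to the other, and reflections of the coordinate planes need it as
  well.\<close>

definition swap2 :: "'a::comm_ring_1 fps fps \<Rightarrow> 'a fps fps" where
  "swap2 f = Abs_fps (\<lambda>i. Abs_fps (\<lambda>j. fps_nth (fps_nth f j) i))"

lemma swap2_nth [simp]: "fps_nth (fps_nth (swap2 f) i) j = fps_nth (fps_nth f j) i"
  by (simp add: swap2_def)

lemma swap2_swap2 [simp]: "swap2 (swap2 f) = f"
  by (simp add: fps_eq_iff)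

lemma comm_ring_hom_swap2: "comm_ring_hom (swap2 :: 'a::comm_ring_1 fps fps \<Rightarrow> _)"
proof
  fix f g :: "'a fps fps"
  show "swap2 (f * g) = swap2 f * swap2 g"
    unfolding fps_eq_iff swap2_nth
  proof (intro allI)
    fix i j
    have "fps_nth (fps_nth (f * g) j) i
        = (\<Sum>b=0..j. \<Sum>a=0..i. fps_nth (fps_nth f b) a * fps_nth (fps_nth g (j - b)) (i - a))"
      by (simp add: fps_mult_nth fps_sum_nth)
    also have "\<dots> = (\<Sum>a=0..i. \<Sum>b=0..j. fps_nth (fps_nth f b) a * fps_nth (fps_nth g (j - b)) (i - a))"
      by (rule sum.swap)
    also have "\<dots> = fps_nth (fps_nth (swap2 f * swap2 g) i) j"
      by (simp add: fps_mult_nth fps_sum_nth)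
    finally show "fps_nth (fps_nth (f * g) j) i = fps_nth (fps_nth (swap2 f * swap2 g) i) j" .
  qed
qed (auto simp: fps_eq_iff)

text \<open>The inner variable of \<open>'k fps fps\<close> is s, the outer one is t. Setting s to
  zero leaves a series in t and conversely, so \<open>res_s\<close> is the restriction to the t-axis
  and \<open>res_t\<close> the one to the s-axis; \<open>cc\<close> and \<open>cc2\<close> are the
  values at the origin.\<close>

definition sv :: "'k::field fps fps" where "sv = fps_const fps_X"
definition tv :: "'k::field fps fps" where "tv = fps_X"
definition const2 :: "'k::field \<Rightarrow> 'k fps fps" where "const2 c = fps_const (fps_const c)"

definition res_s :: "'k::field fps fps \<Rightarrow> 'k fps" where "res_s = fps_map (\<lambda>f. fps_nth f 0)"
definition res_t :: "'k::field fps fps \<Rightarrow> 'k fps" where "res_t = (\<lambda>f. fps_nth f 0)"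
definition in_s :: "'k::field fps \<Rightarrow> 'k fps fps" where "in_s = (\<lambda>c. fps_const c)"
definition in_t :: "'k::field fps \<Rightarrow> 'k fps fps" where "in_t = fps_map fps_const"
definition cc2 :: "'k::field fps fps \<Rightarrow> 'k" where "cc2 = (\<lambda>f. fps_nth (fps_nth f 0) 0)"
definition cc :: "'k::field fps3 \<Rightarrow> 'k" where "cc = (\<lambda>F. fps_nth (fps_nth (fps_nth F 0) 0) 0)"

interpretation swap2: comm_ring_hom swap2 by (rule comm_ring_hom_swap2)
interpretation res_s: comm_ring_hom res_s
  unfolding res_s_def by (intro comm_ring_hom_fps_map comm_ring_hom_nth_0)
interpretation res_t: comm_ring_hom res_t
  unfolding res_t_def by (rule comm_ring_hom_nth_0)
interpretation cc: comm_ring_hom cc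
  unfolding cc_def
  by (rule comm_ring_hom_comp[OF comm_ring_hom_nth_0 comm_ring_hom_comp[OF comm_ring_hom_nth_0 comm_ring_hom_nth_0]])
interpretation cc2: comm_ring_hom cc2
  unfolding cc2_def by (rule comm_ring_hom_comp[OF comm_ring_hom_nth_0 comm_ring_hom_nth_0])
interpretation in_s: comm_ring_hom in_s
  unfolding in_s_def by unfold_locales auto
interpretation in_t: comm_ring_hom in_t
  unfolding in_t_def by (rule comm_ring_hom_fps_map) (unfold_locales, auto)

lemma swap2_simps [simp]:
  "swap2 sv = tv" "swap2 tv = sv" "swap2 (const2 c) = const2 c"
  "res_s (swap2 f) = res_t f" "res_t (swap2 f) = res_s f" "cc2 (swap2 f) = cc2 f"
  by (auto simp: fps_eq_iff sv_def tv_def const2_def res_s_def res_t_def fps_X_def cc2_def)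

lemma res_simps [simp]:
  "res_s sv = 0" "res_s tv = fps_X" "res_t sv = fps_X" "res_t tv = 0"
  "res_s (const2 c) = fps_const c" "res_t (const2 c) = fps_const c"
  "res_s (in_t a) = a" "res_t (in_s a) = a"
  "res_s (in_s a) = fps_const (fps_nth a 0)" "res_t (in_t a) = fps_const (fps_nth a 0)"
  "fps_nth (res_s f) 0 = cc2 f" "fps_nth (res_t f) 0 = cc2 f"
  by (auto simp: fps_eq_iff sv_def tv_def const2_def res_s_def res_t_def fps_X_def in_s_def in_t_def cc2_def)

lemma cc2_simps [simp]: "cc2 sv = 0" "cc2 tv = 0" "cc2 (const2 c) = c" "cc2 (in_s a) = fps_nth a 0" "cc2 (in_t a) = fps_nth a 0"
  by (auto simp: sv_def tv_def const2_def in_s_def in_t_def cc2_def)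

lemma in_X [simp]: "in_s fps_X = sv" "in_t fps_X = tv"
  by (auto simp: fps_eq_iff in_s_def in_t_def sv_def tv_def fps_X_def)

lemma st_nonzero [simp]: "sv \<noteq> 0" "tv \<noteq> 0"
  using res_simps(2,3) by (metis fps_X_neq_zero res_s.hom_zero res_t.hom_zero)+

lemma tv_dvd_iff: "tv dvd f \<longleftrightarrow> res_t f = 0"
proof
  assume "res_t f = 0"
  then have "f = tv * Abs_fps (\<lambda>n. fps_nth f (Suc n))"
    by (auto simp: fps_eq_iff tv_def res_t_def fps_X_mult_nth)
  then show "tv dvd f" by (rule dvdI)
qed (auto simp: res_t.hom_mult)

lemma sv_dvd_iff: "sv dvd f \<longleftrightarrow> res_s f = 0"
proof
  assume "res_s f = 0"
  then have "tv dvd swap2 f" by (simp add: tv_dvd_iff)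
  then obtain g where "swap2 f = tv * g" by (rule dvdE)
  then have "f = sv * swap2 g" by (metis swap2.hom_mult swap2_simps(2) swap2_swap2)
  then show "sv dvd f" by (rule dvdI)
qed (auto simp: res_s.hom_mult)

lemma st_dvd_iff: "sv * tv dvd f \<longleftrightarrow> res_s f = 0 \<and> res_t f = 0"
proof
  assume *: "res_s f = 0 \<and> res_t f = 0"
  then obtain g where g: "f = sv * g" using sv_dvd_iff by (metis dvdE)
  then have "res_t g = 0" using * by (simp add: res_t.hom_mult)
  then obtain h where "g = tv * h" using tv_dvd_iff by (metis dvdE)
  with g have "f = (sv * tv) * h" by (simp add: mult.assoc)
  then show "sv * tv dvd f" by (rule dvdI)
qed (auto simp: res_t.hom_mult res_s.hom_mult)

lemma fps_unitI:
  fixes f :: "'a::comm_ring_1 fps"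
  assumes "fps_nth f 0 * y = 1" shows "\<exists>g. f * g = 1"
  using fps_right_inverse[OF assms] by blast

lemma cc2_unit: "cc2 f \<noteq> 0 \<Longrightarrow> \<exists>g. f * g = 1"
proof -
  assume "cc2 f \<noteq> 0"
  then have "fps_nth (fps_nth f 0) 0 * inverse (cc2 f) = 1" by (simp add: cc2_def)
  then obtain y where "fps_nth f 0 * y = 1" using fps_unitI by blast
  then show ?thesis by (rule fps_unitI)
qed

lemma cc_unit: "cc F \<noteq> 0 \<Longrightarrow> \<exists>G. F * G = 1"
proof -
  assume "cc F \<noteq> 0"
  then have "cc2 (fps_nth F 0) \<noteq> 0" by (simp add: cc2_def cc_def)
  then obtain y where "fps_nth F 0 * y = 1" using cc2_unit by blast
  then show ?thesis by (rule fps_unitI)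
qed

lemma cc_var_vals [simp]: "cc var_x = 0" "cc var_y = 0" "cc var_z = 0" "cc (const3 c) = c"
  by (auto simp: cc_def var_x_def var_y_def var_z_def const3_def)

section \<open>The three coordinate planes\<close>

text \<open>\<open>\<pi>1\<close>, \<open>\<pi>2\<close>, \<open>\<pi>3\<close> are the restrictions to the planes \<open>u = 0\<close>, \<open>v = 0\<close>, \<open>w = 0\<close>. The coordinates
  \<open>(s, t)\<close> are \<open>(v, w)\<close>, \<open>(w, u)\<close>, \<open>(u, v)\<close>, which makes the configuration cyclically symmetric.\<close>

locale coord =
  p1: comm_ring_hom \<pi>1 + p2: comm_ring_hom \<pi>2 + p3: comm_ring_hom \<pi>3
  for \<pi>1 \<pi>2 \<pi>3 :: "'k::field fps3 \<Rightarrow> 'k fps fps" +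
  fixes u v w :: "'k fps3"
  assumes perm: "{u, v, w} = {var_x, var_y, var_z}"
    and var_vals [simp]: "\<pi>1 u = 0" "\<pi>1 v = sv" "\<pi>1 w = tv"
      "\<pi>2 u = tv" "\<pi>2 v = 0" "\<pi>2 w = sv"
      "\<pi>3 u = sv" "\<pi>3 v = tv" "\<pi>3 w = 0"
    and uvw: "u * v * w = var_x * var_y * var_z"
    and const_vals [simp]: "\<pi>1 (const3 c) = const2 c" "\<pi>2 (const3 c) = const2 c" "\<pi>3 (const3 c) = const2 c"
    and ccs [simp]: "cc2 (\<pi>1 F) = cc F" "cc2 (\<pi>2 F) = cc F" "cc2 (\<pi>3 F) = cc F"
    and glue_w: "res_s (\<pi>1 F) = res_t (\<pi>2 F)"
    and glue_u: "res_s (\<pi>2 F) = res_t (\<pi>3 F)"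
    and glue_v: "res_s (\<pi>3 F) = res_t (\<pi>1 F)"
    and ker_uvw: "\<pi>1 F = 0 \<Longrightarrow> \<pi>2 F = 0 \<Longrightarrow> \<pi>3 F = 0 \<Longrightarrow> u * v * w dvd F"
    and image: "res_s f = res_t g \<Longrightarrow> res_s g = res_t h \<Longrightarrow> res_s h = res_t f \<Longrightarrow>
      \<exists>F. \<pi>1 F = f \<and> \<pi>2 F = g \<and> \<pi>3 F = h"
    and max: "cc F = 0 \<Longrightarrow> \<exists>a b c. F = u * a + v * b + w * c"
begin

text \<open>Interpreting the locale at rotated coordinates transfers every result about the first
  plane, or about the axis of \<open>w\<close>, to the other two.\<close>

lemma coord_rot: "coord \<pi>2 \<pi>3 \<pi>1 v w u"
proof
  show "{v, w, u} = {var_x, var_y, var_z}" unfolding perm[symmetric] by blast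
  show "v * w * u = var_x * var_y * var_z" using uvw by (simp add: mult_ac)
  show "v * w * u dvd F" if "\<pi>2 F = 0" "\<pi>3 F = 0" "\<pi>1 F = 0" for F
    using ker_uvw that by (simp add: mult_ac)
  show "\<exists>F. \<pi>2 F = f \<and> \<pi>3 F = g \<and> \<pi>1 F = h" if "res_s f = res_t g" "res_s g = res_t h" "res_s h = res_t f" for f g h
    using image[of h f g] that by blast
  show "\<exists>a b c. F = v * a + w * b + u * c" if c0: "cc F = 0" for F
  proof -
    obtain a b c where "F = u * a + v * b + w * c" using max[OF c0] by blast
    then have "F = v * b + w * c + u * a" by (simp add: add_ac)
    then show ?thesis by blast
  qed
qed (simp_all add: glue_u glue_v glue_w)

text \<open>Exchanging \<open>v\<close> and \<open>w\<close> reverses the cyclic orientation: the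
  second and third planes trade places, and in each plane s and t have to be exchanged to fit the
  convention again.\<close>

lemma coord_refl: "coord (\<lambda>F. swap2 (\<pi>1 F)) (\<lambda>F. swap2 (\<pi>3 F)) (\<lambda>F. swap2 (\<pi>2 F)) u w v"
proof -
  interpret s1: comm_ring_hom "\<lambda>F. swap2 (\<pi>1 F)"
    by (rule comm_ring_hom_comp[OF comm_ring_hom_swap2]) (rule p1.comm_ring_hom_axioms)
  interpret s2: comm_ring_hom "\<lambda>F. swap2 (\<pi>2 F)"
    by (rule comm_ring_hom_comp[OF comm_ring_hom_swap2]) (rule p2.comm_ring_hom_axioms)
  interpret s3: comm_ring_hom "\<lambda>F. swap2 (\<pi>3 F)"
    by (rule comm_ring_hom_comp[OF comm_ring_hom_swap2]) (rule p3.comm_ring_hom_axioms)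
  have z: "swap2 f = 0 \<longleftrightarrow> f = 0" for f :: "'k fps fps"
    by (metis swap2.hom_zero swap2_swap2)
  show ?thesis
  proof
    show "{u, w, v} = {var_x, var_y, var_z}" unfolding perm[symmetric] by blast
    show "u * w * v = var_x * var_y * var_z" using uvw by (simp add: mult_ac)
    show "u * w * v dvd F" if "swap2 (\<pi>1 F) = 0" "swap2 (\<pi>3 F) = 0" "swap2 (\<pi>2 F) = 0" for F
      using ker_uvw that by (simp add: mult_ac z)
    show "\<exists>F. swap2 (\<pi>1 F) = f \<and> swap2 (\<pi>3 F) = g \<and> swap2 (\<pi>2 F) = h"
      if fgh: "res_s f = res_t g" "res_s g = res_t h" "res_s h = res_t f" for f g h
    proof -
      obtain F where "\<pi>1 F = swap2 f" "\<pi>2 F = swap2 h" "\<pi>3 F = swap2 g"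
        using image[of "swap2 f" "swap2 h" "swap2 g"] fgh[symmetric] by auto
      then show ?thesis by (intro exI[of _ F]) simp
    qed
    show "\<exists>a b c. F = u * a + w * b + v * c" if c0: "cc F = 0" for F
    proof -
      obtain a b c where "F = u * a + v * b + w * c" using max[OF c0] by blast
      then have "F = u * a + w * c + v * b" by (simp add: add_ac)
      then show ?thesis by blast
    qed
  qed (simp_all add: glue_u glue_v glue_w)
qed

end

text \<open>The coefficient of \<open>x^k y^m z^n\<close> is found at position n, then m, then k.
  Setting y to zero leaves x inside and z outside, while the cyclic convention wants s = z inside
  and t = x outside; hence \<open>swap2\<close> in the second map.\<close>

definition pr1 :: "'k::field fps3 \<Rightarrow> 'k fps fps" where "pr1 = fps_map (fps_map (\<lambda>f. fps_nth f 0))"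
definition pr2 :: "'k::field fps3 \<Rightarrow> 'k fps fps" where "pr2 = (\<lambda>F. swap2 (fps_map (\<lambda>f. fps_nth f 0) F))"
definition pr3 :: "'k::field fps3 \<Rightarrow> 'k fps fps" where "pr3 = (\<lambda>F. fps_nth F 0)"

lemma pr_nth:
  "fps_nth (fps_nth (pr1 F) n) m = fps_nth (fps_nth (fps_nth F n) m) 0"
  "fps_nth (fps_nth (pr2 F) k) n = fps_nth (fps_nth (fps_nth F n) 0) k"
  "fps_nth (fps_nth (pr3 F) m) k = fps_nth (fps_nth (fps_nth F 0) m) k"
  by (simp_all add: pr1_def pr2_def pr3_def)

lemma var_mult_nth:
  "fps_nth (fps_nth (fps_nth (var_x * F) n) m) k = (if k = 0 then 0 else fps_nth (fps_nth (fps_nth F n) m) (k - 1))"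
  "fps_nth (fps_nth (fps_nth (var_y * F) n) m) k = (if m = 0 then 0 else fps_nth (fps_nth (fps_nth F n) (m - 1)) k)"
  "fps_nth (fps_nth (fps_nth (var_z * F) n) m) k = (if n = 0 then 0 else fps_nth (fps_nth (fps_nth F (n - 1)) m) k)"
  by (simp_all add: var_x_def var_y_def var_z_def)

lemma fps3_eqI: "(\<And>n m k. fps_nth (fps_nth (fps_nth F n) m) k = fps_nth (fps_nth (fps_nth G n) m) k) \<Longrightarrow> F = G"
  by (simp add: fps_eq_iff)

lemma coord_std: "coord pr1 pr2 pr3 var_x var_y var_z"
proof -
  interpret s1: comm_ring_hom pr1
    unfolding pr1_def by (intro comm_ring_hom_fps_map comm_ring_hom_nth_0)
  interpret s2: comm_ring_hom pr2
    unfolding pr2_def by (rule comm_ring_hom_comp[OF comm_ring_hom_swap2 comm_ring_hom_fps_map[OF comm_ring_hom_nth_0]])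
  interpret s3: comm_ring_hom pr3
    unfolding pr3_def by (rule comm_ring_hom_nth_0)
  show ?thesis
  proof
    show "var_x * var_y * var_z dvd F" if "pr1 F = 0" "pr2 F = 0" "pr3 F = 0" for F :: "'a fps3"
    proof
      have 0: "fps_nth (fps_nth (fps_nth F n) m) 0 = 0" "fps_nth (fps_nth (fps_nth F n) 0) k = 0"
        "fps_nth (fps_nth (fps_nth F 0) m) k = 0" for n m k
        using that pr_nth[of F] by simp_all
      \<comment> \<open>Every monomial of \<open>F\<close> involves all three variables, so the
        quotient by \<open>xyz\<close> shifts all exponents by one.\<close>
      let ?G = "Abs_fps (\<lambda>n. Abs_fps (\<lambda>m. Abs_fps (\<lambda>k. fps_nth (fps_nth (fps_nth F (Suc n)) (Suc m)) (Suc k))))"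
      show "F = var_x * var_y * var_z * ?G"
        by (rule fps3_eqI) (simp add: var_mult_nth mult.assoc 0)
    qed
    show "\<exists>F. pr1 F = f \<and> pr2 F = g \<and> pr3 F = h"
      if g: "res_s f = res_t g" "res_s g = res_t h" "res_s h = res_t f" for f g h :: "'a fps fps"
    proof -
      have e: "fps_nth (fps_nth f n) 0 = fps_nth (fps_nth g 0) n" "fps_nth (fps_nth g n) 0 = fps_nth (fps_nth h 0) n"
        "fps_nth (fps_nth h n) 0 = fps_nth (fps_nth f 0) n" for n
        using g unfolding res_s_def res_t_def fps_eq_iff by auto
      \<comment> \<open>A monomial without x is read off from \<open>f\<close>, otherwise one
        without y from \<open>g\<close>, otherwise one without z from \<open>h\<close>; on the axes
        the choices agree by \<open>e\<close>.\<close>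
      let ?F = "Abs_fps (\<lambda>n. Abs_fps (\<lambda>m. Abs_fps (\<lambda>k.
        if k = 0 then fps_nth (fps_nth f n) m else if m = 0 then fps_nth (fps_nth g k) n
        else if n = 0 then fps_nth (fps_nth h m) k else 0)))"
      have "pr1 ?F = f" by (simp add: fps_eq_iff pr_nth)
      moreover have "pr2 ?F = g" by (simp add: fps_eq_iff pr_nth e(1))
      moreover have "pr3 ?F = h" by (simp add: fps_eq_iff pr_nth e(2) e(3)[symmetric])
      ultimately show ?thesis by blast
    qed
    show "\<exists>a b c. F = var_x * a + var_y * b + var_z * c" if "cc F = 0" for F :: "'a fps3"
    proof -
      \<comment> \<open>Monomials containing z go to \<open>?c\<close>, the remaining ones
        containing y to \<open>?b\<close>, and the pure powers of x to \<open>?a\<close>.\<close>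
      let ?a = "Abs_fps (\<lambda>n. Abs_fps (\<lambda>m. Abs_fps (\<lambda>k. if n = 0 \<and> m = 0 then fps_nth (fps_nth (fps_nth F 0) 0) (Suc k) else 0)))"
      let ?b = "Abs_fps (\<lambda>n. Abs_fps (\<lambda>m. Abs_fps (\<lambda>k. if n = 0 then fps_nth (fps_nth (fps_nth F 0) (Suc m)) k else 0)))"
      let ?c = "Abs_fps (\<lambda>n. Abs_fps (\<lambda>m. Abs_fps (\<lambda>k. fps_nth (fps_nth (fps_nth F (Suc n)) m) k)))"
      have "F = var_x * ?a + var_y * ?b + var_z * ?c"
        using that unfolding cc_def by (intro fps3_eqI) (simp add: var_mult_nth)
      then show ?thesis by blast
    qed
  qed (auto simp: fps_eq_iff pr_nth sv_def tv_def const2_def const3_def var_x_def var_y_def var_z_def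
      cc_def cc2_def res_s_def res_t_def fps_X_def)
qed

section \<open>Principal ideals of \<open>k[[s,t]]\<close>\<close>

lemma fps_dvd_total:
  fixes f g :: "'k::field fps"
  assumes "f \<noteq> 0" "subdegree f \<le> subdegree g" shows "f dvd g"
  using assms by (cases "g = 0") (auto simp: fps_dvd_iff)

lemma t_power_decomp:
  fixes f :: "'k::field fps fps"
  assumes "f \<noteq> 0" obtains g where "f = tv ^ subdegree f * g" "res_t g \<noteq> 0"
proof
  show "f = tv ^ subdegree f * fps_shift (subdegree f) f"
    unfolding tv_def by (metis mult.commute fps_shift_times_fps_X_power subdegree_decompose)
  show "res_t (fps_shift (subdegree f) f) \<noteq> 0"
    using assms by (simp add: res_t_def)
qed

lemma all_t_powers_dvd_imp_0:
  fixes f :: "'k::field fps fps"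
  assumes "\<And>n. tv ^ n dvd f" shows "f = 0"
proof (rule fps_ext)
  fix m
  obtain g where "f = tv ^ Suc m * g" using assms by (rule dvdE)
  then show "fps_nth f m = fps_nth 0 m" unfolding tv_def by (simp add: fps_X_power_mult_nth del: power_Suc)
qed

lemma fps_split_t:
  fixes f :: "'k::field fps fps" obtains f' where "f = in_s (res_t f) + tv * f'"
proof -
  have "tv dvd f - in_s (res_t f)" by (simp add: tv_dvd_iff res_t.hom_minus)
  then obtain f' where "f - in_s (res_t f) = tv * f'" by (rule dvdE)
  then have "f = in_s (res_t f) + tv * f'" by (simp add: algebra_simps)
  then show ?thesis by (rule that)
qed

lemma fps_unit_factor:
  fixes f :: "'k::field fps"
  assumes "f \<noteq> 0" obtains a b where "f = fps_X ^ subdegree f * a" "a * b = 1"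
proof
  show "f = fps_X ^ subdegree f * unit_factor f"
    using assms by (metis fps_unit_factor_def mult.commute subdegree_decompose)
  show "unit_factor f * inverse (unit_factor f) = 1"
    using assms by (intro inverse_mult_eq_1') (simp add: fps_unit_factor_def)
qed

context
  fixes I :: "'k::field fps fps set"
  assumes add: "\<And>a b. a \<in> I \<Longrightarrow> b \<in> I \<Longrightarrow> a + b \<in> I"
    and mult: "\<And>a b. b \<in> I \<Longrightarrow> a * b \<in> I"
    and depth: "\<And>a b. a \<in> I \<Longrightarrow> b \<in> I \<Longrightarrow> sv * a = tv * b \<Longrightarrow> \<exists>c\<in>I. a = tv * c"
begin

private lemma diff: "a \<in> I \<Longrightarrow> b \<in> I \<Longrightarrow> a - b \<in> I"
  using add[of a "(-1) * b"] mult[of b "-1"] by simp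

text \<open>A generator is an element \<open>g\<close> whose restriction to t = 0 has least order.
  The depth condition and \<open>g\<close> together allow division by t inside I, so each f in I is
  \<open>c g + t f'\<close> with c a series in s and f' again in I; iterating produces the quotient
  as a power series in t.\<close>

lemma principal_if_not_t_divisible:
  assumes ex: "\<exists>f\<in>I. res_t f \<noteq> 0" shows "\<exists>n. n \<noteq> 0 \<and> (\<forall>f. f \<in> I \<longleftrightarrow> n dvd f)"
proof -
  define k where "k = (LEAST k. \<exists>f\<in>I. res_t f \<noteq> 0 \<and> subdegree (res_t f) = k)"
  have "\<exists>f\<in>I. res_t f \<noteq> 0 \<and> subdegree (res_t f) = k"
    unfolding k_def by (rule LeastI_ex) (use ex in blast)
  then obtain g where g: "g \<in> I" "res_t g \<noteq> 0" "subdegree (res_t g) = k" by blast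
  have min: "k \<le> subdegree (res_t f)" if "f \<in> I" "res_t f \<noteq> 0" for f
    unfolding k_def by (rule Least_le) (use that in blast)
  obtain \<mu> \<mu>' where mu: "res_t g = fps_X ^ k * \<mu>" "\<mu> * \<mu>' = 1" using fps_unit_factor[OF g(2)] g(3) by metis
  obtain g' where g': "g = in_s (res_t g) + tv * g'" by (rule fps_split_t)
  have div_t: "\<exists>j\<in>I. i = tv * j" if i: "i \<in> I" "res_t i = 0" for i
  proof -
    obtain b where b: "i = tv * b" using i tv_dvd_iff by (metis dvdE)
    \<comment> \<open>Downward induction from n = k: the restriction of \<open>g\<close> is s^k
      times a unit, which puts \<open>s^k i\<close> into tI, and \<open>depth\<close> then removes
      one factor s at a time.\<close>
    have "\<exists>j\<in>I. sv ^ n * i = tv * j" if "n \<le> k" for n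
      using that
    proof (induction n rule: inc_induct)
      case base
      have "in_s (res_t g) = g - tv * g'" using g' by (metis add_diff_cancel_right')
      then have "in_s (res_t g) * i = (g - tv * g') * i" by (rule arg_cong)
      also have "\<dots> = i * g - tv * (g' * i)" by (simp add: algebra_simps)
      also have "i * g = tv * (b * g)" using b by simp
      finally have "in_s (res_t g) * i = tv * (b * g - g' * i)" by (simp add: right_diff_distrib)
      moreover have "in_s (res_t g) = sv ^ k * in_s \<mu>"
        unfolding mu(1) by (simp add: in_s.hom_mult in_s.hom_power)
      ultimately have "in_s \<mu>' * (sv ^ k * in_s \<mu> * i) = tv * (in_s \<mu>' * (b * g - g' * i))" by (simp add: mult_ac)
      moreover have "in_s \<mu>' * in_s \<mu> = 1" by (metis in_s.hom_mult in_s.hom_one mu(2) mult.commute)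
      then have "in_s \<mu>' * (sv ^ k * in_s \<mu> * i) = sv ^ k * i" by (metis mult.assoc mult.commute mult_1)
      moreover have "in_s \<mu>' * (b * g - g' * i) \<in> I" using mult diff g i by blast
      ultimately show ?case by metis
    next
      case (step n)
      then obtain j where "j \<in> I" "sv * (sv ^ n * i) = tv * j" by (auto simp: mult_ac)
      then show ?case using depth[of "sv ^ n * i" j] mult i by blast
    qed
    from this[of 0] show ?thesis by simp
  qed
  have step: "\<exists>c. \<exists>f'\<in>I. f = in_s c * g + tv * f'" if f: "f \<in> I" for f
  proof -
    have "res_t g dvd res_t f" using fps_dvd_total[OF g(2)] min[OF f] g(3) by (cases "res_t f = 0") auto
    then obtain c where c: "res_t f = c * res_t g" by (metis dvdE mult.commute)
    have "f - in_s c * g \<in> I" using diff mult f g by blast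
    moreover have "res_t (f - in_s c * g) = 0" by (simp add: c res_t.hom_minus res_t.hom_mult)
    ultimately obtain f' where "f' \<in> I" "f - in_s c * g = tv * f'" using div_t by blast
    then show ?thesis by (intro exI[of _ c] bexI[of _ f']) (simp_all add: algebra_simps)
  qed
  have "g dvd f" if f: "f \<in> I" for f
  proof -
    \<comment> \<open>\<open>nx\<close> returns the coefficient c(s) and the next remainder f' of
      one division step; iterating it gives the successive remainders \<open>F n\<close> of
      \<open>f\<close>.\<close>
    define nx where "nx = (\<lambda>f. SOME (x :: 'k fps \<times> 'k fps fps). snd x \<in> I \<and> f = in_s (fst x) * g + tv * snd x)"
    have nx: "snd (nx f) \<in> I \<and> f = in_s (fst (nx f)) * g + tv * snd (nx f)" if "f \<in> I" for f
      unfolding nx_def by (rule someI_ex) (use step[OF that] in auto)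
    define F where "F = (\<lambda>n. ((snd \<circ> nx) ^^ n) f)"
    have FI: "F n \<in> I" for n by (induction n) (use f nx in \<open>auto simp: F_def\<close>)
    \<comment> \<open>\<open>C n\<close> is to be the quotient of the n-th remainder by
      \<open>g\<close>: its coefficient of t^i is the one chosen in division step n + i. The
      difference of \<open>f\<close> and \<open>C 0 * g\<close> is then divisible by every power of
      t.\<close>
    define C where "C = (\<lambda>n. Abs_fps (\<lambda>i. fst (nx (F (n + i)))))"
    have C: "C n = in_s (fst (nx (F n))) + tv * C (Suc n)" for n
      by (auto simp: fps_eq_iff C_def in_s_def tv_def fps_X_mult_nth)
    have F: "F n = in_s (fst (nx (F n))) * g + tv * F (Suc n)" for n
      using nx[OF FI[of n]] by (simp add: F_def)
    have eq: "f - C 0 * g = tv ^ n * (F n - C n * g)" for n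
    proof (induction n)
      case (Suc n)
      have "F n - C n * g = tv * (F (Suc n) - C (Suc n) * g)"
        by (subst F, subst C) (simp add: algebra_simps)
      then show ?case using Suc by (simp add: mult_ac)
    qed (simp add: F_def)
    have "f - C 0 * g = 0" by (rule all_t_powers_dvd_imp_0) (use eq in \<open>metis dvd_triv_left\<close>)
    then have "f = g * C 0" by (simp add: mult_ac)
    then show "g dvd f" by (rule dvdI)
  qed
  moreover have "f \<in> I" if "g dvd f" for f using that mult[OF g(1)] by (metis dvdE mult.commute)
  moreover have "g \<noteq> 0" using g(2) by auto
  ultimately show ?thesis by blast
qed

end

text \<open>Dividing by the largest power t^e common to all elements of I reduces to an ideal J with
  an element not divisible by t. The depth condition survives because every element of I is t^e
  times an element of J.\<close>

lemma principal_if_depth_two: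
  fixes I :: "'k::field fps fps set"
  assumes add: "\<And>a b. a \<in> I \<Longrightarrow> b \<in> I \<Longrightarrow> a + b \<in> I"
    and mult: "\<And>a b. b \<in> I \<Longrightarrow> a * b \<in> I"
    and depth: "\<And>a b. a \<in> I \<Longrightarrow> b \<in> I \<Longrightarrow> sv * a = tv * b \<Longrightarrow> \<exists>c\<in>I. a = tv * c"
    and nz: "\<exists>f\<in>I. f \<noteq> 0"
  shows "\<exists>n. n \<noteq> 0 \<and> (\<forall>f. f \<in> I \<longleftrightarrow> n dvd f)"
proof -
  define e where "e = (LEAST k. \<exists>f\<in>I. f \<noteq> 0 \<and> subdegree f = k)"
  have "\<exists>f\<in>I. f \<noteq> 0 \<and> subdegree f = e"
    unfolding e_def by (rule LeastI_ex) (use nz in blast)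
  then obtain g where g: "g \<in> I" "g \<noteq> 0" "subdegree g = e" by blast
  have min: "e \<le> subdegree f" if "f \<in> I" "f \<noteq> 0" for f
    unfolding e_def by (rule Least_le) (use that in blast)
  define J where "J = {f. tv ^ e * f \<in> I}"
  have div: "\<exists>f'\<in>J. f = tv ^ e * f'" if "f \<in> I" for f
  proof (cases "f = 0")
    case True
    then show ?thesis using that by (intro bexI[of _ 0]) (auto simp: J_def)
  next
    case False
    then obtain f' where "f = tv ^ subdegree f * f'" by (rule t_power_decomp)
    then have "f = tv ^ e * (tv ^ (subdegree f - e) * f')"
      using min[OF that False] by (metis le_add_diff_inverse mult.assoc power_add)
    then show ?thesis using that unfolding J_def by (metis mem_Collect_eq)
  qed
  have "\<exists>n. n \<noteq> 0 \<and> (\<forall>f. f \<in> J \<longleftrightarrow> n dvd f)"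
  proof (rule principal_if_not_t_divisible)
    show "a + b \<in> J" if "a \<in> J" "b \<in> J" for a b using that add unfolding J_def by (simp add: distrib_left)
    show "a * b \<in> J" if "b \<in> J" for a b using that mult[of "tv ^ e * b" a] unfolding J_def by (simp add: mult_ac)
    show "\<exists>c\<in>J. a = tv * c" if ab: "a \<in> J" "b \<in> J" "sv * a = tv * b" for a b
    proof -
      have "sv * (tv ^ e * a) = tv * (tv ^ e * b)" using ab(3) by (metis mult.left_commute)
      then obtain c where "c \<in> I" "tv ^ e * a = tv * c" using depth ab unfolding J_def by blast
      moreover then obtain c' where "c' \<in> J" "c = tv ^ e * c'" using div by blast
      ultimately have "tv ^ e * a = tv ^ e * (tv * c')" by (simp add: mult_ac)
      then have "a = tv * c'" by simp
      then show ?thesis using \<open>c' \<in> J\<close> by blast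
    qed
    obtain g' where "g = tv ^ e * g'" "res_t g' \<noteq> 0" using t_power_decomp[OF g(2)] g(3) by metis
    then show "\<exists>f\<in>J. res_t f \<noteq> 0" using g(1) unfolding J_def by blast
  qed
  then obtain n where n: "n \<noteq> 0" "\<And>f. f \<in> J \<longleftrightarrow> n dvd f" by blast
  have "f \<in> I \<longleftrightarrow> tv ^ e * n dvd f" for f
  proof
    assume "f \<in> I"
    then obtain f' where "f' \<in> J" "f = tv ^ e * f'" using div by blast
    then show "tv ^ e * n dvd f" using n(2) by (simp add: mult_dvd_mono)
  next
    assume "tv ^ e * n dvd f"
    then obtain q where "f = tv ^ e * n * q" by (rule dvdE)
    then show "f \<in> I" using n(2)[of "n * q"] unfolding J_def by (simp add: mult.assoc)
  qed
  then show ?thesis using n(1) by (intro exI[of _ "tv ^ e * n"]) simp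
qed

section \<open>Modules of compatible triples\<close>

type_synonym 'k triple = "'k fps fps \<times> 'k fps fps \<times> 'k fps fps"

context coord
begin

definition act :: "'k fps3 \<Rightarrow> 'k triple \<Rightarrow> 'k triple" where
  "act F = (\<lambda>(f, g, h). (\<pi>1 F * f, \<pi>2 F * g, \<pi>3 F * h))"

lemma act_simp [simp]: "act F (f, g, h) = (\<pi>1 F * f, \<pi>2 F * g, \<pi>3 F * h)"
  by (simp add: act_def)

lemma act_add: "act F (l + l') = act F l + act F l'"
  by (cases l; cases l') (simp add: distrib_left)

lemma act_add_left: "act (F + G) l = act F l + act G l"
  by (cases l) (simp add: distrib_right p1.hom_add p2.hom_add p3.hom_add)

lemma act_mult: "act (F * G) l = act F (act G l)"
  by (cases l) (simp add: mult.assoc p1.hom_mult p2.hom_mult p3.hom_mult)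

lemma act_one [simp]: "act 1 l = l" by (cases l) simp

lemma act_zero [simp]: "act F 0 = 0" "act 0 l = 0" by (cases l, simp_all add: zero_prod_def)+

lemma act_uminus: "act (- F) l = - act F l"
  by (cases l) (simp add: p1.hom_uminus p2.hom_uminus p3.hom_uminus)

text \<open>The series \<open>a\<close> in the single variable \<open>w\<close> has these
  restrictions; on the plane w = 0 it is constant.\<close>

lemma lift_w: "\<exists>F. \<pi>1 F = in_t a \<and> \<pi>2 F = in_s a \<and> \<pi>3 F = const2 (fps_nth a 0)"
  by (rule image) simp_all

lemma surj1: "\<exists>F. \<pi>1 F = f"
proof -
  have "\<exists>F. \<pi>1 F = f \<and> \<pi>2 F = in_s (res_s f) \<and> \<pi>3 F = in_t (res_t f)"
    by (rule image) simp_all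
  then show ?thesis by blast
qed

end

definition rot3 :: "('a \<times> 'a \<times> 'a) set \<Rightarrow> ('a \<times> 'a \<times> 'a) set" where
  "rot3 L = {(g, h, f) | f g h. (f, g, h) \<in> L}"

lemma rot3_iff [simp]: "(g, h, f) \<in> rot3 L \<longleftrightarrow> (f, g, h) \<in> L"
  by (simp add: rot3_def)

text \<open>What is retained of the module M. \<open>depth\<close> is a regular pair from the
  maximal ideal; \<open>free_w\<close> records that a single element generates L after localizing at
  the prime of the axis of \<open>w\<close>, the kernel of
  \<open>r \<mapsto> res_s (\<pi>1 r)\<close>. Each axis is seen from the plane in which it is the
  line s = 0.\<close>

locale triple_module = coord \<pi>1 \<pi>2 \<pi>3 u v w
  for \<pi>1 \<pi>2 \<pi>3 :: "'k::field fps3 \<Rightarrow> 'k fps fps" and u v w +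
  fixes L :: "'k triple set"
  assumes L_add: "l \<in> L \<Longrightarrow> l' \<in> L \<Longrightarrow> l + l' \<in> L"
    and L_act: "l \<in> L \<Longrightarrow> act F l \<in> L"
    and depth: "\<exists>a b. cc a = 0 \<and> cc b = 0 \<and> (\<forall>l\<in>L. act a l = 0 \<longrightarrow> l = 0) \<and>
      (\<forall>l\<in>L. \<forall>l'\<in>L. act b l = act a l' \<longrightarrow> (\<exists>l''\<in>L. l = act a l''))"
    and nz1: "\<exists>f g h. (f, g, h) \<in> L \<and> f \<noteq> 0"
    and nz2: "\<exists>f g h. (f, g, h) \<in> L \<and> g \<noteq> 0"
    and nz3: "\<exists>f g h. (f, g, h) \<in> L \<and> h \<noteq> 0"
    and free_w: "\<exists>e\<in>L. \<forall>l\<in>L. \<exists>r r'. res_s (\<pi>1 r) \<noteq> 0 \<and> act r l = act r' e"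
    and free_u: "\<exists>e\<in>L. \<forall>l\<in>L. \<exists>r r'. res_s (\<pi>2 r) \<noteq> 0 \<and> act r l = act r' e"
    and free_v: "\<exists>e\<in>L. \<forall>l\<in>L. \<exists>r r'. res_s (\<pi>3 r) \<noteq> 0 \<and> act r l = act r' e"
begin

text \<open>Permuting the components permutes the hypotheses among themselves; this is what makes it
  enough to treat the first plane and the axis of \<open>w\<close>.\<close>

lemma rot: "triple_module \<pi>2 \<pi>3 \<pi>1 v w u (rot3 L)"
proof -
  interpret r: coord \<pi>2 \<pi>3 \<pi>1 v w u by (rule coord_rot)
  define \<rho> where "\<rho> = (\<lambda>(f, g, h). (g, h, f) :: 'k triple)"
  have ract: "r.act F (\<rho> l) = \<rho> (act F l)" for F l by (cases l) (simp add: \<rho>_def)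
  have radd: "\<rho> l + \<rho> l' = \<rho> (l + l')" for l l' by (cases l; cases l') (simp add: \<rho>_def)
  have inj: "\<rho> l = \<rho> l' \<longleftrightarrow> l = l'" for l l' by (cases l; cases l') (auto simp: \<rho>_def)
  have z: "\<rho> l = 0 \<longleftrightarrow> l = 0" for l by (cases l) (auto simp: \<rho>_def zero_prod_def)
  have R: "rot3 L = \<rho> ` L" by (force simp: rot3_def \<rho>_def image_iff)
  show ?thesis
  proof
    show "\<exists>a b. cc a = 0 \<and> cc b = 0 \<and> (\<forall>l\<in>rot3 L. r.act a l = 0 \<longrightarrow> l = 0) \<and>
      (\<forall>l\<in>rot3 L. \<forall>l'\<in>rot3 L. r.act b l = r.act a l' \<longrightarrow> (\<exists>l''\<in>rot3 L. l = r.act a l''))"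
      using depth unfolding R by (simp add: ract z inj)
    show "l + l' \<in> rot3 L" if "l \<in> rot3 L" "l' \<in> rot3 L" for l l'
      using that L_add unfolding R by (auto simp: radd)
    show "r.act F l \<in> rot3 L" if "l \<in> rot3 L" for F l
      using that L_act unfolding R by (auto simp: ract)
    have ex: "(\<exists>e\<in>rot3 L. \<forall>l\<in>rot3 L. \<exists>r r'. P r \<and> r.act r l = r.act r' e) \<longleftrightarrow>
      (\<exists>e\<in>L. \<forall>l\<in>L. \<exists>r r'. P r \<and> act r l = act r' e)" for P
      unfolding R by (simp add: ract inj)
    show "\<exists>e\<in>rot3 L. \<forall>l\<in>rot3 L. \<exists>r r'. res_s (\<pi>2 r) \<noteq> 0 \<and> r.act r l = r.act r' e" using free_u unfolding ex .
    show "\<exists>e\<in>rot3 L. \<forall>l\<in>rot3 L. \<exists>r r'. res_s (\<pi>3 r) \<noteq> 0 \<and> r.act r l = r.act r' e" using free_v unfolding ex .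
    show "\<exists>e\<in>rot3 L. \<forall>l\<in>rot3 L. \<exists>r r'. res_s (\<pi>1 r) \<noteq> 0 \<and> r.act r l = r.act r' e" using free_w unfolding ex .
    show "\<exists>f g h. (f, g, h) \<in> rot3 L \<and> f \<noteq> 0" using nz2 by (metis rot3_iff)
    show "\<exists>f g h. (f, g, h) \<in> rot3 L \<and> g \<noteq> 0" using nz3 by (metis rot3_iff)
    show "\<exists>f g h. (f, g, h) \<in> rot3 L \<and> h \<noteq> 0" using nz1 by (metis rot3_iff)
  qed
qed

lemma zero_in_L: "0 \<in> L"
proof -
  obtain l where "l \<in> L" using nz1 by blast
  then have "act 0 l \<in> L" by (rule L_act)
  then show ?thesis by simp
qed

lemma L_act1: "(f, 0, 0) \<in> L \<Longrightarrow> (p * f, 0, 0) \<in> L"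
proof -
  assume f: "(f, 0, 0) \<in> L"
  obtain F where "\<pi>1 F = p" using surj1 by blast
  then show ?thesis using L_act[OF f, of F] by simp
qed

text \<open>Multiplication by \<open>v * w\<close> moves an element of L into the first component
  alone without killing a nonzero \<open>f\<close>; there \<open>a\<close> acts only through
  \<open>\<pi>1 a\<close>.\<close>

lemma regular_nonzero1:
  assumes a: "\<forall>l\<in>L. act a l = 0 \<longrightarrow> l = 0" shows "\<pi>1 a \<noteq> 0"
proof
  assume 0: "\<pi>1 a = 0"
  obtain f g h where l: "(f, g, h) \<in> L" "f \<noteq> 0" using nz1 by blast
  have "act (v * w) (f, g, h) \<in> L" by (rule L_act[OF l(1)])
  then have "(sv * tv * f, 0, 0) \<in> L" by (simp add: p1.hom_mult p2.hom_mult p3.hom_mult)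
  then have "(sv * tv * f, 0, 0) = (0 :: 'k triple)" using a 0 by (force simp: zero_prod_def)
  then show False using l(2) by (simp add: zero_prod_def)
qed

lemma regular_nonzero:
  assumes a: "\<forall>l\<in>L. act a l = 0 \<longrightarrow> l = 0" shows "\<pi>1 a \<noteq> 0" "\<pi>2 a \<noteq> 0" "\<pi>3 a \<noteq> 0"
proof -
  interpret r: triple_module \<pi>2 \<pi>3 \<pi>1 v w u "rot3 L" by (rule rot)
  interpret rr: triple_module \<pi>3 \<pi>1 \<pi>2 w u v "rot3 (rot3 L)" by (rule r.rot)
  show "\<pi>1 a \<noteq> 0" by (rule regular_nonzero1[OF a])
  have ra: "\<forall>l\<in>rot3 L. r.act a l = 0 \<longrightarrow> l = 0"
    using a by (auto simp: rot3_def zero_prod_def split: prod.splits)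
  then show "\<pi>2 a \<noteq> 0" by (rule r.regular_nonzero1)
  have "\<forall>l\<in>rot3 (rot3 L). rr.act a l = 0 \<longrightarrow> l = 0"
    using a by (auto simp: rot3_def zero_prod_def split: prod.splits)
  then show "\<pi>3 a \<noteq> 0" by (rule rr.regular_nonzero1)
qed

text \<open>The regular pair of L has to be turned into the depth condition for s and t on the ideal
  I of all f with \<open>(f, 0, 0)\<close> in L. If s f = t f' in I, then every element of the
  maximal ideal maps f into tI; applying the regular pair to the quotients of \<open>a f\<close> and
  \<open>b f\<close> by t shows that f itself lies in tI.\<close>

lemma principal1: "\<exists>n. n \<noteq> 0 \<and> (\<forall>f. (f, 0, 0) \<in> L \<longleftrightarrow> n dvd f)"
proof -
  let ?I = "{f. (f, 0, 0) \<in> L}"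
  have "\<exists>n. n \<noteq> 0 \<and> (\<forall>f. f \<in> ?I \<longleftrightarrow> n dvd f)"
  proof (rule principal_if_depth_two)
    show "a + b \<in> ?I" if "a \<in> ?I" "b \<in> ?I" for a b
      using that L_add[of "(a, 0, 0)" "(b, 0, 0)"] by simp
    show "a * b \<in> ?I" if "b \<in> ?I" for a b using that L_act1 by simp
    show "\<exists>f\<in>?I. f \<noteq> 0"
    proof -
      obtain f g h where l: "(f, g, h) \<in> L" "f \<noteq> 0" using nz1 by blast
      have "act (v * w) (f, g, h) \<in> L" by (rule L_act[OF l(1)])
      then have "sv * tv * f \<in> ?I" by (simp add: p1.hom_mult p2.hom_mult p3.hom_mult)
      then show ?thesis using l(2) by (intro bexI[of _ "sv * tv * f"]) auto
    qed
    show "\<exists>q\<in>?I. f = tv * q" if f: "f \<in> ?I" and f': "f' \<in> ?I" and eq: "sv * f = tv * f'" for f f'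
    proof -
      obtain a b where ab: "cc a = 0" "cc b = 0" "\<forall>l\<in>L. act a l = 0 \<longrightarrow> l = 0"
        "\<forall>l\<in>L. \<forall>l'\<in>L. act b l = act a l' \<longrightarrow> (\<exists>l''\<in>L. l = act a l'')" using depth by blast
      have t_div: "\<exists>m\<in>?I. \<pi>1 c * f = tv * m" if c: "cc c = 0" for c
      proof -
        obtain c1 c2 c3 where "c = u * c1 + v * c2 + w * c3" using max[OF c] by blast
        then have "\<pi>1 c * f = \<pi>1 c2 * (sv * f) + tv * (\<pi>1 c3 * f)"
          by (simp add: p1.hom_add p1.hom_mult algebra_simps)
        also have "\<dots> = tv * (\<pi>1 c2 * f' + \<pi>1 c3 * f)" unfolding eq by (simp add: algebra_simps)
        finally have "\<pi>1 c * f = tv * (\<pi>1 c2 * f' + \<pi>1 c3 * f)" .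
        moreover have "\<pi>1 c2 * f' + \<pi>1 c3 * f \<in> ?I"
          using L_add[OF L_act1 L_act1, of f' f] f f' by simp
        ultimately show ?thesis by blast
      qed
      obtain m1 where m1: "m1 \<in> ?I" "\<pi>1 a * f = tv * m1" using t_div[OF ab(1)] by blast
      obtain m2 where m2: "m2 \<in> ?I" "\<pi>1 b * f = tv * m2" using t_div[OF ab(2)] by blast
      have "tv * (\<pi>1 b * m1) = \<pi>1 b * (\<pi>1 a * f)" using m1(2) by (simp add: mult_ac)
      also have "\<dots> = tv * (\<pi>1 a * m2)" using m2(2) by (simp add: mult_ac)
      finally have "\<pi>1 b * m1 = \<pi>1 a * m2" by simp
      then have "act b (m1, 0, 0) = act a (m2, 0, 0)" by simp
      then obtain q where q: "q \<in> L" "(m1, 0, 0) = act a q" using ab(4) m1(1) m2(1) by blast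
      obtain q1 q2 q3 where "q = (q1, q2, q3)" by (cases q)
      \<comment> \<open>Multiplication by \<open>a\<close> is injective in the second and third
        component, so \<open>q\<close> is concentrated in the first.\<close>
      then have qq: "(q1, 0, 0) \<in> L" "m1 = \<pi>1 a * q1"
        using q regular_nonzero[OF ab(3)] by auto
      then have "\<pi>1 a * f = \<pi>1 a * (tv * q1)" using m1(2) by (simp add: mult_ac)
      then have "f = tv * q1" using regular_nonzero(1)[OF ab(3)] by simp
      then show ?thesis using qq by blast
    qed
  qed
  then show ?thesis by simp
qed

lemma principal:
  "\<exists>n. n \<noteq> 0 \<and> (\<forall>f. (f, 0, 0) \<in> L \<longleftrightarrow> n dvd f)"
  "\<exists>n. n \<noteq> 0 \<and> (\<forall>f. (0, f, 0) \<in> L \<longleftrightarrow> n dvd f)"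
  "\<exists>n. n \<noteq> 0 \<and> (\<forall>f. (0, 0, f) \<in> L \<longleftrightarrow> n dvd f)"
proof -
  interpret r: triple_module \<pi>2 \<pi>3 \<pi>1 v w u "rot3 L" by (rule rot)
  interpret rr: triple_module \<pi>3 \<pi>1 \<pi>2 w u v "rot3 (rot3 L)" by (rule r.rot)
  show "\<exists>n. n \<noteq> 0 \<and> (\<forall>f. (f, 0, 0) \<in> L \<longleftrightarrow> n dvd f)" by (rule principal1)
  show "\<exists>n. n \<noteq> 0 \<and> (\<forall>f. (0, f, 0) \<in> L \<longleftrightarrow> n dvd f)" using r.principal1 by simp
  show "\<exists>n. n \<noteq> 0 \<and> (\<forall>f. (0, 0, f) \<in> L \<longleftrightarrow> n dvd f)" using rr.principal1 by simp
qed

text \<open>Every element of the maximal ideal, in particular each member of the regular pair, then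
  maps \<open>l\<close> into L. From b(al) = a(bl) the pair yields al = al' with l' in L, and
  \<open>a\<close> can be cancelled on the whole product because it is nonzero on each
  plane.\<close>

lemma L_saturated:
  assumes "act u l \<in> L" "act v l \<in> L" "act w l \<in> L" shows "l \<in> L"
proof -
  obtain a b where ab: "cc a = 0" "cc b = 0" "\<forall>l\<in>L. act a l = 0 \<longrightarrow> l = 0"
    "\<forall>l\<in>L. \<forall>l'\<in>L. act b l = act a l' \<longrightarrow> (\<exists>l''\<in>L. l = act a l'')" using depth by blast
  have mem: "act c l \<in> L" if c: "cc c = 0" for c
  proof -
    obtain c1 c2 c3 where "c = c1 * u + c2 * v + c3 * w" using max[OF c] by (metis mult.commute)
    then show ?thesis using assms by (simp add: act_add_left act_mult L_add L_act)
  qed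
  have "act b (act a l) = act a (act b l)" by (metis act_mult mult.commute)
  then obtain l' where l': "l' \<in> L" "act a l = act a l'" using ab(4) mem[OF ab(1)] mem[OF ab(2)] by blast
  then have "l = l'" using regular_nonzero[OF ab(3)] by (cases l; cases l') auto
  then show ?thesis using l' by simp
qed

text \<open>Each of the three products of \<open>l\<close> with a variable satisfies the hypotheses
  with one exponent lowered, so induction on the sum of the exponents reduces to
  \<open>L_saturated\<close>.\<close>

lemma L_saturated_powers:
  "act (u ^ i) l \<in> L \<Longrightarrow> act (v ^ j) l \<in> L \<Longrightarrow> act (w ^ k) l \<in> L \<Longrightarrow> l \<in> L"
proof (induction "i + j + k" arbitrary: i j k l rule: less_induct)
  case less
  have comm: "act (p ^ n) (act q l) = act q (act (p ^ n) l)" for p q n by (metis act_mult mult.commute)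
  show ?case
  proof (cases "i = 0 \<or> j = 0 \<or> k = 0")
    case True
    then show ?thesis using less.prems by auto
  next
    case False
    then obtain i' j' k' where [simp]: "i = Suc i'" "j = Suc j'" "k = Suc k'" by (metis not0_implies_Suc)
    have s: "act (u ^ i') (act u l) \<in> L" "act (v ^ j') (act v l) \<in> L" "act (w ^ k') (act w l) \<in> L"
      using less.prems by (simp_all add: act_mult[symmetric] mult.commute del: act_simp)
    show ?thesis
    proof (rule L_saturated)
      show "act u l \<in> L"
        by (rule less.hyps[of i' j k]) (use s less.prems in \<open>simp_all add: comm L_act del: power_Suc\<close>)
      show "act v l \<in> L"
        by (rule less.hyps[of i j' k]) (use s less.prems in \<open>simp_all add: comm L_act del: power_Suc\<close>)
      show "act w l \<in> L"
        by (rule less.hyps[of i j k']) (use s less.prems in \<open>simp_all add: comm L_act del: power_Suc\<close>)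
    qed
  qed
qed

end

section \<open>Gluing equations along the three axes\<close>

definition glue :: "'k::field fps \<Rightarrow> 'k fps \<Rightarrow> 'k fps \<Rightarrow> 'k fps \<Rightarrow> 'k fps \<Rightarrow> 'k fps \<Rightarrow> 'k triple set" where
  "glue A1 B1 A2 B2 A3 B3 = {(f, g, h).
     A1 * res_s f = B1 * res_t g \<and> A2 * res_s g = B2 * res_t h \<and> A3 * res_s h = B3 * res_t f}"

text \<open>The ideal (st) is the one that A itself has in each plane: a triple
  \<open>(f, 0, 0)\<close> agrees along the axes exactly if f vanishes on both axes of its
  plane.\<close>

locale normal_triple_module = triple_module \<pi>1 \<pi>2 \<pi>3 u v w L
  for \<pi>1 \<pi>2 \<pi>3 :: "'k::field fps3 \<Rightarrow> 'k fps fps" and u v w L +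
  assumes normal1: "(f, 0, 0) \<in> L \<longleftrightarrow> sv * tv dvd f"
    and normal2: "(0, f, 0) \<in> L \<longleftrightarrow> sv * tv dvd f"
    and normal3: "(0, 0, f) \<in> L \<longleftrightarrow> sv * tv dvd f"
begin

lemma normal_rot: "normal_triple_module \<pi>2 \<pi>3 \<pi>1 v w u (rot3 L)"
  by (intro normal_triple_module.intro rot normal_triple_module_axioms.intro)
    (simp_all add: normal1 normal2 normal3)

text \<open>The axis of \<open>w\<close> is s = 0 in the first plane and t = 0 in the second. At its
  prime one element \<open>e\<close> generates L, so on this axis the pair of restrictions of any
  member of L is proportional to that of \<open>e\<close>; this is the equation. Conversely, a
  triple satisfying the equation can be matched with \<open>e\<close> along the axis, up to a power
  of \<open>w\<close>.\<close>

lemma glue_axis_w: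
  "\<exists>f0 g0. f0 \<noteq> 0 \<and> g0 \<noteq> 0 \<and> (\<forall>f g h. (f, g, h) \<in> L \<longrightarrow> g0 * res_s f = f0 * res_t g) \<and>
     (\<forall>f g h. g0 * res_s f = f0 * res_t g \<longrightarrow> (\<exists>k. act (w ^ k) (f, g, h) \<in> L))"
proof -
  obtain e where e: "e \<in> L" "\<And>l. l \<in> L \<Longrightarrow> \<exists>r r'. res_s (\<pi>1 r) \<noteq> 0 \<and> act r l = act r' e"
    using free_w by blast
  obtain fe ge he where e_eq: "e = (fe, ge, he)" by (cases e)
  define f0 g0 where "f0 = res_s fe" and "g0 = res_t ge"
  \<comment> \<open>The normal form puts \<open>(st, 0, 0)\<close> and \<open>(0, st, 0)\<close>
    into L. Up to denominators each is a multiple of \<open>e\<close>, and the multiplier vanishes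
    on the other plane, hence is divisible by the variable that cuts out the axis. Cancelling this
    variable before restricting shows that neither restriction of \<open>e\<close> to the axis is
    zero.\<close>
  obtain r r' where r: "res_s (\<pi>1 r) \<noteq> 0" "act r (sv * tv, 0, 0) = act r' e"
    using e(2)[of "(sv * tv, 0, 0)"] normal1 by auto
  obtain q q' where q: "res_s (\<pi>1 q) \<noteq> 0" "act q (0, sv * tv, 0) = act q' e"
    using e(2)[of "(0, sv * tv, 0)"] normal2 by auto
  have rr: "\<pi>1 r * (sv * tv) = \<pi>1 r' * fe" "\<pi>2 r' * ge = 0" using r(2) by (auto simp: e_eq)
  have qq: "\<pi>2 q * (sv * tv) = \<pi>2 q' * ge" "\<pi>1 q' * fe = 0" using q(2) by (auto simp: e_eq)
  have "\<pi>1 r \<noteq> 0" "\<pi>2 q \<noteq> 0" using r(1) q(1) glue_w[of q] by auto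
  then have ne: "fe \<noteq> 0" "ge \<noteq> 0" using rr(1) qq(1) by auto
  have "\<pi>2 r' = 0" using rr(2) ne by simp
  then have "res_s (\<pi>1 r') = 0" using glue_w[of r'] by simp
  then obtain \<rho> where \<rho>: "\<pi>1 r' = sv * \<rho>" using sv_dvd_iff by (metis dvdE)
  have "sv * (\<pi>1 r * tv) = sv * (\<rho> * fe)" using rr(1) \<rho> by (simp add: mult_ac)
  then have "res_s (\<pi>1 r * tv) = res_s (\<rho> * fe)" by simp
  then have f0: "f0 \<noteq> 0" using r(1) unfolding f0_def by (auto simp: res_s.hom_mult)
  have "\<pi>1 q' = 0" using qq(2) ne by simp
  then have "res_t (\<pi>2 q') = 0" using glue_w[of q'] by simp
  then obtain \<sigma> where \<sigma>: "\<pi>2 q' = tv * \<sigma>" using tv_dvd_iff by (metis dvdE)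
  have "tv * (\<pi>2 q * sv) = tv * (\<sigma> * ge)" using qq(1) \<sigma> by (simp add: mult_ac)
  then have "res_t (\<pi>2 q * sv) = res_t (\<sigma> * ge)" by simp
  then have g0: "g0 \<noteq> 0" using q(1) glue_w[of q] unfolding g0_def by (auto simp: res_t.hom_mult)
  have "g0 * res_s f = f0 * res_t g" if l: "(f, g, h) \<in> L" for f g h
  proof -
    obtain p p' where p: "res_s (\<pi>1 p) \<noteq> 0" "act p (f, g, h) = act p' e" using e(2)[OF l] by blast
    have "res_s (\<pi>1 p) * res_s f = res_s (\<pi>1 p') * f0" "res_t (\<pi>2 p) * res_t g = res_t (\<pi>2 p') * g0"
      using p(2) unfolding e_eq f0_def g0_def by (simp_all add: res_s.hom_mult[symmetric] res_t.hom_mult[symmetric])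
    then have "res_s (\<pi>1 p) * (g0 * res_s f) = res_s (\<pi>1 p) * (f0 * res_t g)"
      unfolding glue_w[symmetric] by (metis mult.left_commute mult.commute)
    then show ?thesis using p(1) by simp
  qed
  moreover have "\<exists>k. act (w ^ k) (f, g, h) \<in> L" if fg: "g0 * res_s f = f0 * res_t g" for f g h
  proof -
    \<comment> \<open>With F and G lifting \<open>f0\<close> and \<open>res_s f\<close> as series in
      \<open>w\<close>, the difference of F(f, g, h) and G e vanishes on the axis in the first two
      planes. The extra factor \<open>w\<close> turns these differences into multiples of st and
      kills the third component.\<close>
    obtain F where F: "\<pi>1 F = in_t f0" "\<pi>2 F = in_s f0" using lift_w by blast
    obtain G where G: "\<pi>1 G = in_t (res_s f)" "\<pi>2 G = in_s (res_s f)" using lift_w by blast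
    have "sv dvd in_t f0 * f - in_t (res_s f) * fe"
      unfolding sv_dvd_iff by (simp add: res_s.hom_minus res_s.hom_mult f0_def)
    then obtain p where p: "in_t f0 * f = in_t (res_s f) * fe + sv * p" by (metis dvdE diff_eq_eq add.commute)
    have "tv dvd in_s f0 * g - in_s (res_s f) * ge"
      unfolding tv_dvd_iff using fg by (simp add: res_t.hom_minus res_t.hom_mult g0_def mult.commute)
    then obtain q where q: "in_s f0 * g = in_s (res_s f) * ge + tv * q" by (metis dvdE diff_eq_eq add.commute)
    have "act (w * F) (f, g, h) = act (w * G) e + ((sv * tv * p, 0, 0) + (0, sv * tv * q, 0))"
    proof -
      have "tv * (in_t f0 * f) = tv * (in_t (res_s f) * fe) + sv * tv * p" unfolding p by (simp add: algebra_simps)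
      moreover have "sv * (in_s f0 * g) = sv * (in_s (res_s f) * ge) + sv * tv * q" unfolding q by (simp add: algebra_simps)
      ultimately show ?thesis
        by (simp add: e_eq p1.hom_mult p2.hom_mult p3.hom_mult F G mult.assoc)
    qed
    also have "\<dots> \<in> L" by (intro L_add L_act e(1)) (simp_all add: normal1 normal2)
    finally have wF: "act (w * F) (f, g, h) \<in> L" .
    \<comment> \<open>On the first two planes F is a power of \<open>w\<close> times a unit; a lift
      \<open>H\<close> of the inverse unit leaves a pure power, and the third component is zero on
      both sides.\<close>
    obtain a b where ab: "f0 = fps_X ^ subdegree f0 * a" "a * b = 1" using fps_unit_factor[OF f0] by metis
    define j where "j = subdegree f0"
    obtain H where H: "\<pi>1 H = in_t b" "\<pi>2 H = in_s b" using lift_w by blast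
    have "in_t f0 * in_t b = tv ^ j" "in_s f0 * in_s b = sv ^ j"
    proof -
      have "f0 * b = fps_X ^ j" using ab unfolding j_def by (metis mult.assoc mult.right_neutral)
      then show "in_t f0 * in_t b = tv ^ j" "in_s f0 * in_s b = sv ^ j"
        by (simp_all add: in_s.hom_mult[symmetric] in_t.hom_mult[symmetric] in_s.hom_power in_t.hom_power)
    qed
    then have "act (H * (w * F)) (f, g, h) = act (w ^ Suc j) (f, g, h)"
      by (simp add: p1.hom_mult p2.hom_mult p3.hom_mult p1.hom_power p2.hom_power p3.hom_power F H mult_ac)
    moreover have "act (H * (w * F)) (f, g, h) \<in> L" using L_act[OF wF] by (simp only: act_mult)
    ultimately show ?thesis by metis
  qed
  ultimately show ?thesis using f0 g0 by blast
qed

text \<open>Each equation by itself ensures that some power of its axis variable multiplies the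
  triple into L. With all three equations such powers of \<open>u\<close>, \<open>v\<close> and
  \<open>w\<close> are available, and saturation returns the triple itself to L.\<close>

theorem eq_glue:
  "\<exists>A1 B1 A2 B2 A3 B3. A1 \<noteq> 0 \<and> B1 \<noteq> 0 \<and> A2 \<noteq> 0 \<and> B2 \<noteq> 0 \<and> A3 \<noteq> 0 \<and> B3 \<noteq> 0 \<and> L = glue A1 B1 A2 B2 A3 B3"
proof -
  interpret r: normal_triple_module \<pi>2 \<pi>3 \<pi>1 v w u "rot3 L" by (rule normal_rot)
  interpret rr: normal_triple_module \<pi>3 \<pi>1 \<pi>2 w u v "rot3 (rot3 L)" by (rule r.normal_rot)
  obtain A1 B1 where 1: "A1 \<noteq> 0" "B1 \<noteq> 0" "\<And>f g h. (f, g, h) \<in> L \<Longrightarrow> A1 * res_s f = B1 * res_t g"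
    "\<And>f g h. A1 * res_s f = B1 * res_t g \<Longrightarrow> \<exists>k. act (w ^ k) (f, g, h) \<in> L"
    using glue_axis_w by metis
  obtain A2 B2 where 2: "A2 \<noteq> 0" "B2 \<noteq> 0" "\<And>f g h. (f, g, h) \<in> L \<Longrightarrow> A2 * res_s g = B2 * res_t h"
    "\<And>f g h. A2 * res_s g = B2 * res_t h \<Longrightarrow> \<exists>k. act (u ^ k) (f, g, h) \<in> L"
    using r.glue_axis_w unfolding r.act_simp rot3_iff act_simp by metis
  obtain A3 B3 where 3: "A3 \<noteq> 0" "B3 \<noteq> 0" "\<And>f g h. (f, g, h) \<in> L \<Longrightarrow> A3 * res_s h = B3 * res_t f"
    "\<And>f g h. A3 * res_s h = B3 * res_t f \<Longrightarrow> \<exists>k. act (v ^ k) (f, g, h) \<in> L"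
    using rr.glue_axis_w unfolding rr.act_simp rot3_iff act_simp by metis
  have "L = glue A1 B1 A2 B2 A3 B3"
  proof (rule Set.set_eqI)
    fix l :: "'k triple" obtain f g h where l: "l = (f, g, h)" by (cases l)
    show "l \<in> L \<longleftrightarrow> l \<in> glue A1 B1 A2 B2 A3 B3"
    proof
      assume "l \<in> glue A1 B1 A2 B2 A3 B3"
      then have *: "A1 * res_s f = B1 * res_t g" "A2 * res_s g = B2 * res_t h" "A3 * res_s h = B3 * res_t f"
        unfolding l glue_def by auto
      obtain i j k where "act (u ^ i) l \<in> L" "act (v ^ j) l \<in> L" "act (w ^ k) l \<in> L"
        using 1(4)[OF *(1)] 2(4)[OF *(2)] 3(4)[OF *(3)] unfolding l by blast
      then show "l \<in> L" by (rule L_saturated_powers)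
    qed (use 1(3) 2(3) 3(3) in \<open>auto simp: l glue_def\<close>)
  qed
  then show ?thesis using 1 2 3 by blast
qed

end

section \<open>Rescaling to the normal form\<close>

context coord
begin

definition triple_iso :: "('k triple \<Rightarrow> 'k triple) \<Rightarrow> 'k triple set \<Rightarrow> 'k triple set \<Rightarrow> bool" where
  "triple_iso \<sigma> L L' \<longleftrightarrow> bij_betw \<sigma> L L' \<and> (\<forall>l\<in>L. \<forall>l'\<in>L. \<sigma> (l + l') = \<sigma> l + \<sigma> l') \<and>
     (\<forall>l\<in>L. \<forall>F. \<sigma> (act F l) = act F (\<sigma> l))"

end

context triple_module
begin

text \<open>Depth and freeness along the axes only concern the abstract module and carry over along
  an isomorphism. That every component occurs depends on the embedding and has to be
  supplied.\<close>

lemma image_triple_module: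
  assumes iso: "triple_iso \<sigma> L L'"
    and nz: "\<exists>f g h. (f, g, h) \<in> L' \<and> f \<noteq> 0" "\<exists>f g h. (f, g, h) \<in> L' \<and> g \<noteq> 0" "\<exists>f g h. (f, g, h) \<in> L' \<and> h \<noteq> 0"
  shows "triple_module \<pi>1 \<pi>2 \<pi>3 u v w L'"
proof -
  have L': "L' = \<sigma> ` L" and inj: "inj_on \<sigma> L" using iso unfolding triple_iso_def bij_betw_def by auto
  have add: "\<sigma> (l + l') = \<sigma> l + \<sigma> l'" if "l \<in> L" "l' \<in> L" for l l' using iso that unfolding triple_iso_def by blast
  have eqv: "act F (\<sigma> l) = \<sigma> (act F l)" if "l \<in> L" for l F using iso that unfolding triple_iso_def by simp
  have z: "\<sigma> 0 = 0" using eqv[OF zero_in_L, of 0] by simp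
  have eq: "\<sigma> l = \<sigma> l' \<longleftrightarrow> l = l'" if "l \<in> L" "l' \<in> L" for l l' using inj that by (auto dest: inj_onD)
  have eq0: "\<sigma> l = 0 \<longleftrightarrow> l = 0" if "l \<in> L" for l using eq[OF that zero_in_L] z by simp
  have ex: "(\<exists>e\<in>L'. \<forall>l\<in>L'. \<exists>r r'. P r \<and> act r l = act r' e) \<longleftrightarrow>
      (\<exists>e\<in>L. \<forall>l\<in>L. \<exists>r r'. P r \<and> act r l = act r' e)" for P
    unfolding L' by (simp add: eqv eq L_act)
  show ?thesis
  proof
    show "l + l' \<in> L'" if "l \<in> L'" "l' \<in> L'" for l l'
      using that L_add unfolding L' by (auto simp: add[symmetric])
    show "act F l \<in> L'" if "l \<in> L'" for F l
      using that L_act unfolding L' by (auto simp: eqv)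
    show "\<exists>a b. cc a = 0 \<and> cc b = 0 \<and> (\<forall>l\<in>L'. act a l = 0 \<longrightarrow> l = 0) \<and>
      (\<forall>l\<in>L'. \<forall>l'\<in>L'. act b l = act a l' \<longrightarrow> (\<exists>l''\<in>L'. l = act a l''))"
      using depth unfolding L' by (simp add: eqv eq eq0 L_act)
    show "\<exists>e\<in>L'. \<forall>l\<in>L'. \<exists>r r'. res_s (\<pi>1 r) \<noteq> 0 \<and> act r l = act r' e" using free_w unfolding ex .
    show "\<exists>e\<in>L'. \<forall>l\<in>L'. \<exists>r r'. res_s (\<pi>2 r) \<noteq> 0 \<and> act r l = act r' e" using free_u unfolding ex .
    show "\<exists>e\<in>L'. \<forall>l\<in>L'. \<exists>r r'. res_s (\<pi>3 r) \<noteq> 0 \<and> act r l = act r' e" using free_v unfolding ex .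
  qed (use nz in auto)
qed

text \<open>The components are multiplied by st/n1, st/n2, st/n3, where n1, n2, n3 generate the
  component ideals. No fractions arise: \<open>v * w\<close> maps a triple of L to
  \<open>(st f, 0, 0)\<close>, so n1 divides st f, and cyclically.\<close>

theorem ex_normal:
  "\<exists>\<sigma> L'. triple_iso \<sigma> L L' \<and> normal_triple_module \<pi>1 \<pi>2 \<pi>3 u v w L'"
proof -
  obtain n1 where n1: "n1 \<noteq> 0" "\<And>f. (f, 0, 0) \<in> L \<longleftrightarrow> n1 dvd f" using principal(1) by blast
  obtain n2 where n2: "n2 \<noteq> 0" "\<And>f. (0, f, 0) \<in> L \<longleftrightarrow> n2 dvd f" using principal(2) by blast
  obtain n3 where n3: "n3 \<noteq> 0" "\<And>f. (0, 0, f) \<in> L \<longleftrightarrow> n3 dvd f" using principal(3) by blast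
  \<comment> \<open>\<open>q n f\<close> is the quotient of st f by n. It is determined when n is
    nonzero and divides st f, which is the case for all members of L, and arbitrary
    otherwise.\<close>
  define q where "q = (\<lambda>n f. SOME f'. n * f' = sv * tv * (f :: 'k fps fps))"
  have q: "n * q n f = sv * tv * f" if "n dvd sv * tv * f" for n f
    unfolding q_def by (rule someI_ex) (use that in \<open>metis dvdE\<close>)
  define \<sigma> where "\<sigma> = (\<lambda>(f, g, h). (q n1 f, q n2 g, q n3 h))"
  have dv: "n1 dvd sv * tv * f" "n2 dvd sv * tv * g" "n3 dvd sv * tv * h" if "(f, g, h) \<in> L" for f g h
    using L_act[OF that, of "v * w"] L_act[OF that, of "w * u"] L_act[OF that, of "u * v"]
    unfolding n1(2)[symmetric] n2(2)[symmetric] n3(2)[symmetric]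
    by (simp_all add: p1.hom_mult p2.hom_mult p3.hom_mult)
  have spec: "\<sigma> (f, g, h) = (f', g', h') \<longleftrightarrow> n1 * f' = sv * tv * f \<and> n2 * g' = sv * tv * g \<and> n3 * h' = sv * tv * h"
    if l: "(f, g, h) \<in> L" for f g h f' g' h'
  proof -
    have "n1 * f' = sv * tv * f \<longleftrightarrow> f' = q n1 f" using q[OF dv(1)[OF l]] n1(1) by (metis mult_cancel_left)
    moreover have "n2 * g' = sv * tv * g \<longleftrightarrow> g' = q n2 g" using q[OF dv(2)[OF l]] n2(1) by (metis mult_cancel_left)
    moreover have "n3 * h' = sv * tv * h \<longleftrightarrow> h' = q n3 h" using q[OF dv(3)[OF l]] n3(1) by (metis mult_cancel_left)
    ultimately show ?thesis unfolding \<sigma>_def by auto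
  qed
  have val: "\<exists>f' g' h'. \<sigma> (f, g, h) = (f', g', h') \<and> n1 * f' = sv * tv * f \<and> n2 * g' = sv * tv * g \<and> n3 * h' = sv * tv * h"
    if l: "(f, g, h) \<in> L" for f g h
    using spec[OF l] by (metis prod_cases3)
  define L' where "L' = \<sigma> ` L"
  have iso: "triple_iso \<sigma> L L'"
    unfolding triple_iso_def bij_betw_def
  proof (intro conjI ballI allI)
    show "inj_on \<sigma> L"
    proof (rule inj_onI)
      fix l l' assume l: "l \<in> L" "l' \<in> L" "\<sigma> l = \<sigma> l'"
      obtain f g h where 1: "l = (f, g, h)" by (cases l)
      obtain a b c where 2: "l' = (a, b, c)" by (cases l')
      have "sv * tv * f = sv * tv * a" "sv * tv * g = sv * tv * b" "sv * tv * h = sv * tv * c"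
        using val[of f g h] val[of a b c] l unfolding 1 2 by auto
      then show "l = l'" unfolding 1 2 by (simp add: mult.assoc)
    qed
    fix l assume l: "l \<in> L"
    obtain f g h where 1: "l = (f, g, h)" by (cases l)
    obtain f' g' h' where vl: "\<sigma> l = (f', g', h')" "n1 * f' = sv * tv * f" "n2 * g' = sv * tv * g" "n3 * h' = sv * tv * h"
      using val[of f g h] l unfolding 1 by blast
    { fix l' assume l': "l' \<in> L"
      obtain a b c where 2: "l' = (a, b, c)" by (cases l')
      obtain a' b' c' where wl: "\<sigma> l' = (a', b', c')" "n1 * a' = sv * tv * a" "n2 * b' = sv * tv * b" "n3 * c' = sv * tv * c"
        using val[of a b c] l' unfolding 2 by blast
      have "\<sigma> (l + l') = (f' + a', g' + b', h' + c')"
        using L_add[OF l l'] vl(2-) wl(2-) unfolding 1 2 add_Pair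
        by (subst spec) (simp_all add: distrib_left)
      then show "\<sigma> (l + l') = \<sigma> l + \<sigma> l'" by (simp add: vl(1) wl(1)) }
    fix F
    have "\<sigma> (act F l) = (\<pi>1 F * f', \<pi>2 F * g', \<pi>3 F * h')"
      using L_act[OF l, of F] vl(2-) unfolding 1 act_simp
      by (subst spec) (simp_all add: mult.left_commute)
    then show "\<sigma> (act F l) = act F (\<sigma> l)" by (simp add: vl(1))
  qed (simp add: L'_def)
  have nz1': "\<exists>f g h. (f, g, h) \<in> L' \<and> f \<noteq> 0"
  proof -
    obtain f g h where l: "(f, g, h) \<in> L" "f \<noteq> 0" using nz1 by blast
    obtain f' g' h' where l': "\<sigma> (f, g, h) = (f', g', h')" "n1 * f' = sv * tv * f" using val[OF l(1)] by blast
    then have "f' \<noteq> 0" using l(2) n1(1) by auto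
    moreover have "(f', g', h') \<in> L'" unfolding L'_def using l(1) l'(1) by (metis imageI)
    ultimately show ?thesis by blast
  qed
  have nz2': "\<exists>f g h. (f, g, h) \<in> L' \<and> g \<noteq> 0"
  proof -
    obtain f g h where l: "(f, g, h) \<in> L" "g \<noteq> 0" using nz2 by blast
    obtain f' g' h' where l': "\<sigma> (f, g, h) = (f', g', h')" "n2 * g' = sv * tv * g" using val[OF l(1)] by blast
    then have "g' \<noteq> 0" using l(2) n1(1) by auto
    moreover have "(f', g', h') \<in> L'" unfolding L'_def using l(1) l'(1) by (metis imageI)
    ultimately show ?thesis by blast
  qed
  have nz3': "\<exists>f g h. (f, g, h) \<in> L' \<and> h \<noteq> 0"
  proof -
    obtain f g h where l: "(f, g, h) \<in> L" "h \<noteq> 0" using nz3 by blast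
    obtain f' g' h' where l': "\<sigma> (f, g, h) = (f', g', h')" "n3 * h' = sv * tv * h" using val[OF l(1)] by blast
    then have "h' \<noteq> 0" using l(2) n1(1) by auto
    moreover have "(f', g', h') \<in> L'" unfolding L'_def using l(1) l'(1) by (metis imageI)
    ultimately show ?thesis by blast
  qed
  interpret L': triple_module \<pi>1 \<pi>2 \<pi>3 u v w L'
    by (rule image_triple_module[OF iso nz1' nz2' nz3'])
  have pre: "\<exists>f g h. (f, g, h) \<in> L \<and> n1 * f' = sv * tv * f \<and> n2 * g' = sv * tv * g \<and> n3 * h' = sv * tv * h"
    if l': "(f', g', h') \<in> L'" for f' g' h'
  proof -
    obtain l where l: "l \<in> L" "(f', g', h') = \<sigma> l" using l' unfolding L'_def by blast
    obtain f g h where "l = (f, g, h)" by (cases l)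
    then show ?thesis using l spec by metis
  qed
  have cancel: "sv * tv dvd f" if "n * f = sv * tv * (n * r)" "n \<noteq> 0" for n f r :: "'k fps fps"
    using that by (metis dvd_triv_left mult.left_commute mult_cancel_left)
  show ?thesis
  proof (intro exI conjI)
    show "normal_triple_module \<pi>1 \<pi>2 \<pi>3 u v w L'"
    proof
      fix f
      show "(f, 0, 0) \<in> L' \<longleftrightarrow> sv * tv dvd f"
      proof
        assume "(f, 0, 0) \<in> L'"
        then obtain a b c where abc: "(a, b, c) \<in> L" "n1 * f = sv * tv * a" "n2 * 0 = sv * tv * b" "n3 * 0 = sv * tv * c"
          using pre by blast
        then have "(a, 0, 0) \<in> L" by simp
        then show "sv * tv dvd f" using n1 abc(2) cancel by (metis dvdE)
      next
        assume "sv * tv dvd f"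
        then obtain r where r: "f = sv * tv * r" by (rule dvdE)
        have l: "(n1 * r, 0, 0) \<in> L" using n1 by simp
        then have "\<sigma> (n1 * r, 0, 0) = (f, 0, 0)" by (subst spec) (simp_all add: r mult_ac)
        then show "(f, 0, 0) \<in> L'" unfolding L'_def using l by (metis imageI)
      qed
      show "(0, f, 0) \<in> L' \<longleftrightarrow> sv * tv dvd f"
      proof
        assume "(0, f, 0) \<in> L'"
        then obtain a b c where abc: "(a, b, c) \<in> L" "n1 * 0 = sv * tv * a" "n2 * f = sv * tv * b" "n3 * 0 = sv * tv * c"
          using pre by blast
        then have "(0, b, 0) \<in> L" by simp
        then show "sv * tv dvd f" using n2 abc(3) cancel by (metis dvdE)
      next
        assume "sv * tv dvd f"
        then obtain r where r: "f = sv * tv * r" by (rule dvdE)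
        have l: "(0, n2 * r, 0) \<in> L" using n2 by simp
        then have "\<sigma> (0, n2 * r, 0) = (0, f, 0)" by (subst spec) (simp_all add: r mult_ac)
        then show "(0, f, 0) \<in> L'" unfolding L'_def using l by (metis imageI)
      qed
      show "(0, 0, f) \<in> L' \<longleftrightarrow> sv * tv dvd f"
      proof
        assume "(0, 0, f) \<in> L'"
        then obtain a b c where abc: "(a, b, c) \<in> L" "n1 * 0 = sv * tv * a" "n2 * 0 = sv * tv * b" "n3 * f = sv * tv * c"
          using pre by blast
        then have "(0, 0, c) \<in> L" by simp
        then show "sv * tv dvd f" using n3 abc(4) cancel by (metis dvdE)
      next
        assume "sv * tv dvd f"
        then obtain r where r: "f = sv * tv * r" by (rule dvdE)
        have l: "(0, 0, n3 * r) \<in> L" using n3 by simp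
        then have "\<sigma> (0, 0, n3 * r) = (0, 0, f)" by (subst spec) (simp_all add: r mult_ac)
        then show "(0, 0, f) \<in> L'" unfolding L'_def using l by (metis imageI)
      qed
    qed
  qed (rule iso)
qed

end

section \<open>Absorbing units into the components\<close>

context coord
begin

lemma glue_scale:
  assumes "U * U' = 1" "V * V' = 1" "W * W' = 1"
  shows "triple_iso (\<lambda>(f, g, h). (U * f, V * g, W * h)) (glue A1 B1 A2 B2 A3 B3)
    (glue (A1 * res_s U') (B1 * res_t V') (A2 * res_s V') (B2 * res_t W') (A3 * res_s W') (B3 * res_t U'))"
proof -
  have c: "U' * (U * f) = f" "V' * (V * f) = f" "W' * (W * f) = f"
    "U * (U' * f) = f" "V * (V' * f) = f" "W * (W' * f) = f" for f
    using assms by (metis mult.assoc mult.commute mult_1)+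
  have rU: "res_s U' * (res_s U * a) = a" "res_t U' * (res_t U * a) = a" for a
    using assms(1) by (metis mult.assoc mult.commute mult_1 res_s.hom_mult res_s.hom_one res_t.hom_mult res_t.hom_one)+
  have rV: "res_s V' * (res_s V * a) = a" "res_t V' * (res_t V * a) = a" for a
    using assms(2) by (metis mult.assoc mult.commute mult_1 res_s.hom_mult res_s.hom_one res_t.hom_mult res_t.hom_one)+
  have rW: "res_s W' * (res_s W * a) = a" "res_t W' * (res_t W * a) = a" for a
    using assms(3) by (metis mult.assoc mult.commute mult_1 res_s.hom_mult res_s.hom_one res_t.hom_mult res_t.hom_one)+
  show ?thesis
    unfolding triple_iso_def
  proof (intro conjI ballI allI)
    show "bij_betw (\<lambda>(f, g, h). (U * f, V * g, W * h)) (glue A1 B1 A2 B2 A3 B3)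
      (glue (A1 * res_s U') (B1 * res_t V') (A2 * res_s V') (B2 * res_t W') (A3 * res_s W') (B3 * res_t U'))"
      by (rule bij_betw_byWitness[where f' = "\<lambda>(f, g, h). (U' * f, V' * g, W' * h)"])
        (auto simp: c glue_def res_s.hom_mult res_t.hom_mult rU rV rW mult.assoc)
  qed (auto simp: distrib_left mult.left_commute split: prod.splits)
qed

end

text \<open>Subtraction of natural numbers is truncated, so at least one exponent on the right is
  zero. A gluing exponent of either sign is thus encoded by a pair of natural numbers.\<close>

lemma fps_X_power_cancel:
  fixes a b :: "'k::field fps"
  shows "fps_X ^ i * a = fps_X ^ j * b \<longleftrightarrow> fps_X ^ (i - j) * a = fps_X ^ (j - i) * b"
proof (cases "i \<le> j")
  case True
  then have "fps_X ^ j = fps_X ^ i * (fps_X ^ (j - i) :: 'k fps)" by (metis le_add_diff_inverse power_add)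
  then have "fps_X ^ j * b = fps_X ^ i * (fps_X ^ (j - i) * b)" by (simp only: mult.assoc)
  moreover have "fps_X ^ i \<noteq> (0 :: 'k fps)" by (rule power_not_zero) simp
  ultimately show ?thesis using True by (simp only: mult_cancel_left diff_is_0_eq' power_0 mult_1) simp
next
  case False
  then have "fps_X ^ i = fps_X ^ j * (fps_X ^ (i - j) :: 'k fps)" by (metis le_add_diff_inverse nat_le_linear power_add)
  then have "fps_X ^ i * a = fps_X ^ j * (fps_X ^ (i - j) * a)" by (simp only: mult.assoc)
  moreover have "fps_X ^ j \<noteq> (0 :: 'k fps)" by (rule power_not_zero) simp
  ultimately show ?thesis using False by (simp only: mult_cancel_left) simp
qed

context coord
begin

text \<open>Units in the gluing data are absorbed by rescaling the three components; only the product of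
  their three values at the origin survives.\<close>

lemma glue_normalize:
  assumes nz: "A1 \<noteq> 0" "B1 \<noteq> 0" "A2 \<noteq> 0" "B2 \<noteq> 0" "A3 \<noteq> 0" "B3 \<noteq> 0"
  shows "\<exists>\<sigma> c. c \<noteq> 0 \<and> triple_iso \<sigma> (glue A1 B1 A2 B2 A3 B3)
    (glue (fps_X ^ (subdegree A1 - subdegree B1)) (fps_X ^ (subdegree B1 - subdegree A1))
          (fps_X ^ (subdegree A2 - subdegree B2)) (fps_X ^ (subdegree B2 - subdegree A2))
          (fps_X ^ (subdegree A3 - subdegree B3)) (fps_const c * fps_X ^ (subdegree B3 - subdegree A3)))"
proof -
  have fac: "\<exists>\<alpha> \<beta> \<rho> k. \<alpha> * \<rho> = \<beta> * fps_const k \<and> A = fps_X ^ subdegree A * \<alpha> \<and> B = fps_X ^ subdegree B * \<beta> \<and>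
      \<beta> \<noteq> 0 \<and> k \<noteq> 0 \<and> fps_nth \<rho> 0 = 1" if AB: "A \<noteq> 0" "B \<noteq> 0" for A B :: "'k fps"
  proof -
    obtain \<alpha> \<alpha>' where a: "A = fps_X ^ subdegree A * \<alpha>" "\<alpha> * \<alpha>' = 1" using fps_unit_factor[OF AB(1)] by metis
    obtain \<beta> \<beta>' where b: "B = fps_X ^ subdegree B * \<beta>" "\<beta> * \<beta>' = 1" using fps_unit_factor[OF AB(2)] by metis
    have nth: "fps_nth \<alpha> 0 * fps_nth \<alpha>' 0 = 1" "fps_nth \<beta> 0 * fps_nth \<beta>' 0 = 1"
      using a(2) b(2) by (metis fps_mult_nth_0 fps_one_nth)+
    \<comment> \<open>\<open>k\<close> is the quotient of the constant terms of the units
      \<open>\<alpha>\<close> and \<open>\<beta>\<close>; with this factor the correcting series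
      \<open>\<rho>\<close> has constant term 1.\<close>
    define k where "k = inverse (fps_nth \<alpha>' 0 * fps_nth \<beta> 0)"
    have k: "k \<noteq> 0" unfolding k_def using nth by auto
    show ?thesis
    proof (intro exI conjI)
      show "\<alpha> * (\<alpha>' * \<beta> * fps_const k) = \<beta> * fps_const k" using a(2) by (metis mult.assoc mult_1)
      show "fps_nth (\<alpha>' * \<beta> * fps_const k) 0 = 1" unfolding k_def using nth by (auto simp: field_simps)
      show "\<beta> \<noteq> 0" using b AB by auto
    qed (use a b k in auto)
  qed
  obtain \<alpha>1 \<beta>1 \<rho>1 k1 where 1: "\<alpha>1 * \<rho>1 = \<beta>1 * fps_const k1" "A1 = fps_X ^ subdegree A1 * \<alpha>1" "B1 = fps_X ^ subdegree B1 * \<beta>1"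
    "\<beta>1 \<noteq> 0" "k1 \<noteq> 0" "fps_nth \<rho>1 0 = 1" using fac[OF nz(1,2)] by blast
  obtain \<alpha>2 \<beta>2 \<rho>2 k2 where 2: "\<alpha>2 * \<rho>2 = \<beta>2 * fps_const k2" "A2 = fps_X ^ subdegree A2 * \<alpha>2" "B2 = fps_X ^ subdegree B2 * \<beta>2"
    "\<beta>2 \<noteq> 0" "k2 \<noteq> 0" "fps_nth \<rho>2 0 = 1" using fac[OF nz(3,4)] by blast
  obtain \<alpha>3 \<beta>3 \<rho>3 k3 where 3: "\<alpha>3 * \<rho>3 = \<beta>3 * fps_const k3" "A3 = fps_X ^ subdegree A3 * \<alpha>3" "B3 = fps_X ^ subdegree B3 * \<beta>3"
    "\<beta>3 \<noteq> 0" "k3 \<noteq> 0" "fps_nth \<rho>3 0 = 1" using fac[OF nz(5,6)] by blast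
  \<comment> \<open>\<open>in_t \<rho>\<close> restricts to \<open>\<rho>\<close> on s = 0 and to
    the constant 1 on t = 0, so correcting one axis leaves the other axis of the same plane
    untouched. The scalars \<open>k1\<close> and \<open>k1 * k2\<close> compensate in the second and
    third component for what the previous axes have produced.\<close>
  define U' V' W' where "U' = in_t \<rho>1" and "V' = in_t \<rho>2 * const2 k1" and "W' = in_t \<rho>3 * const2 (k1 * k2)"
  obtain U where U: "U * U' = 1" using cc2_unit[of U'] 1 unfolding U'_def by (auto simp: mult.commute)
  obtain V where V: "V * V' = 1" using cc2_unit[of V'] 1 2 unfolding V'_def by (auto simp: mult.commute cc2.hom_mult)
  obtain W where W: "W * W' = 1" using cc2_unit[of W'] 1 2 3 unfolding W'_def by (auto simp: mult.commute cc2.hom_mult)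
  \<comment> \<open>The product of the scalars collected around the cycle of planes, moved to the
    right-hand side of the last equation.\<close>
  define c where "c = inverse (k1 * k2 * k3)"
  have c: "c \<noteq> 0" "c * (k1 * (k2 * k3)) = 1" unfolding c_def using 1(5) 2(5) 3(5) by (auto simp: field_simps)
  let ?X = "fps_X :: 'k fps"
  have e1: "A1 * res_s U' * a = B1 * res_t V' * b \<longleftrightarrow> ?X ^ (subdegree A1 - subdegree B1) * a = ?X ^ (subdegree B1 - subdegree A1) * b" for a b
  proof -
    have "A1 * res_s U' * a = ?X ^ subdegree A1 * (\<alpha>1 * \<rho>1) * a" by (subst 1(2)) (simp add: U'_def mult_ac)
    also have "\<dots> = \<beta>1 * fps_const k1 * (?X ^ subdegree A1 * a)" by (simp add: 1(1) mult_ac)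
    finally have l: "A1 * res_s U' * a = \<beta>1 * fps_const k1 * (?X ^ subdegree A1 * a)" .
    have r: "B1 * res_t V' * b = \<beta>1 * fps_const k1 * (?X ^ subdegree B1 * b)"
      by (subst 1(3)) (simp add: V'_def res_t.hom_mult 2(6) mult_ac)
    show ?thesis unfolding l r using 1(4,5) by (simp add: fps_X_power_cancel[symmetric])
  qed
  have e2: "A2 * res_s V' * a = B2 * res_t W' * b \<longleftrightarrow> ?X ^ (subdegree A2 - subdegree B2) * a = ?X ^ (subdegree B2 - subdegree A2) * b" for a b
  proof -
    have "A2 * res_s V' * a = ?X ^ subdegree A2 * (\<alpha>2 * \<rho>2) * fps_const k1 * a" by (subst 2(2)) (simp add: V'_def res_s.hom_mult mult_ac)
    also have "\<dots> = \<beta>2 * fps_const (k1 * k2) * (?X ^ subdegree A2 * a)"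
      by (simp add: 2(1) mult_ac flip: fps_const_mult)
    finally have l: "A2 * res_s V' * a = \<beta>2 * fps_const (k1 * k2) * (?X ^ subdegree A2 * a)" .
    have r: "B2 * res_t W' * b = \<beta>2 * fps_const (k1 * k2) * (?X ^ subdegree B2 * b)"
      by (subst 2(3)) (simp add: W'_def res_t.hom_mult 3(6) mult_ac)
    show ?thesis unfolding l r using 1(5) 2(4,5) by (simp add: fps_X_power_cancel[symmetric])
  qed
  have e3: "A3 * res_s W' * a = B3 * res_t U' * b \<longleftrightarrow>
      ?X ^ (subdegree A3 - subdegree B3) * a = fps_const c * ?X ^ (subdegree B3 - subdegree A3) * b" for a b
  proof -
    have "A3 * res_s W' * a = ?X ^ subdegree A3 * (\<alpha>3 * \<rho>3) * fps_const (k1 * k2) * a" by (subst 3(2)) (simp add: W'_def res_s.hom_mult mult_ac)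
    also have "\<dots> = \<beta>3 * fps_const (k1 * k2 * k3) * (?X ^ subdegree A3 * a)"
      by (simp add: 3(1) mult_ac flip: fps_const_mult)
    finally have l: "A3 * res_s W' * a = \<beta>3 * fps_const (k1 * k2 * k3) * (?X ^ subdegree A3 * a)" .
    have "k1 * k2 * k3 * c = 1" using c(2) by (simp only: mult_ac)
    then have "fps_const (k1 * k2 * k3) * fps_const c = 1" by (simp only: fps_const_mult fps_const_1_eq_1)
    then have "fps_const (k1 * k2 * k3) * (fps_const c * b) = b" by (metis mult.assoc mult_1)
    then have r: "B3 * res_t U' * b = \<beta>3 * fps_const (k1 * k2 * k3) * (?X ^ subdegree B3 * (fps_const c * b))"
      by (subst 3(3)) (simp add: U'_def 1(6) mult.assoc mult.left_commute)
    have "A3 * res_s W' * a = B3 * res_t U' * b \<longleftrightarrow> ?X ^ subdegree A3 * a = ?X ^ subdegree B3 * (fps_const c * b)"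
      unfolding l r using 1(5) 2(5) 3(4,5) by simp
    also have "\<dots> \<longleftrightarrow> ?X ^ (subdegree A3 - subdegree B3) * a = ?X ^ (subdegree B3 - subdegree A3) * (fps_const c * b)"
      by (rule fps_X_power_cancel)
    finally show ?thesis by (simp only: mult_ac)
  qed
  have eq: "glue (A1 * res_s U') (B1 * res_t V') (A2 * res_s V') (B2 * res_t W') (A3 * res_s W') (B3 * res_t U')
    = glue (?X ^ (subdegree A1 - subdegree B1)) (?X ^ (subdegree B1 - subdegree A1))
          (?X ^ (subdegree A2 - subdegree B2)) (?X ^ (subdegree B2 - subdegree A2))
          (?X ^ (subdegree A3 - subdegree B3)) (fps_const c * ?X ^ (subdegree B3 - subdegree A3))"
    unfolding glue_def e1 e2 e3 ..
  show ?thesis using glue_scale[OF U V W, of A1 B1 A2 B2 A3 B3] c(1) unfolding eq by blast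
qed

end

section \<open>Presentations of the gluing modules\<close>

lemma sum_lt_2: "(\<Sum>k<(2::nat). f k) = f 0 + (f 1 :: 'a::comm_monoid_add)"
  by (simp add: numeral_2_eq_2)

lemma sum_lt_3: "(\<Sum>k<(3::nat). f k) = f 0 + f 1 + (f 2 :: 'a::comm_monoid_add)"
  by (simp add: numeral_3_eq_3 numeral_2_eq_2)

lemma all_lt_2: "(\<forall>i<2. P i) \<longleftrightarrow> P 0 \<and> P (1::nat)"
  by (auto simp: numeral_2_eq_2 less_Suc_eq)

lemma all_lt_3: "(\<forall>i<3. P i) \<longleftrightarrow> P 0 \<and> P 1 \<and> P (2::nat)"
  by (auto simp: numeral_3_eq_3 numeral_2_eq_2 less_Suc_eq)

lemma mat2_index [simp]:
  "mat_of_rows_list 2 [[a, b], [c, d]] $$ (0, 0) = a" "mat_of_rows_list 2 [[a, b], [c, d]] $$ (0, Suc 0) = b"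
  "mat_of_rows_list 2 [[a, b], [c, d]] $$ (Suc 0, 0) = c" "mat_of_rows_list 2 [[a, b], [c, d]] $$ (Suc 0, Suc 0) = d"
  by (simp_all add: mat_of_rows_list_def)

lemma mat3_index [simp]:
  "mat_of_rows_list 3 [[a, b, c], [d, e, f], [g, h, i]] $$ (0, 0) = a"
  "mat_of_rows_list 3 [[a, b, c], [d, e, f], [g, h, i]] $$ (0, Suc 0) = b"
  "mat_of_rows_list 3 [[a, b, c], [d, e, f], [g, h, i]] $$ (0, 2) = c"
  "mat_of_rows_list 3 [[a, b, c], [d, e, f], [g, h, i]] $$ (Suc 0, 0) = d"
  "mat_of_rows_list 3 [[a, b, c], [d, e, f], [g, h, i]] $$ (Suc 0, Suc 0) = e"
  "mat_of_rows_list 3 [[a, b, c], [d, e, f], [g, h, i]] $$ (Suc 0, 2) = f"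
  "mat_of_rows_list 3 [[a, b, c], [d, e, f], [g, h, i]] $$ (2, 0) = g"
  "mat_of_rows_list 3 [[a, b, c], [d, e, f], [g, h, i]] $$ (2, Suc 0) = h"
  "mat_of_rows_list 3 [[a, b, c], [d, e, f], [g, h, i]] $$ (2, 2) = i"
  by (simp_all add: mat_of_rows_list_def)

lemma transpose_mat2:
  "transpose_mat (mat_of_rows_list 2 [[a, b], [c, d]]) = mat_of_rows_list 2 [[a, c], [b, d]]"
  by (rule eq_matI) (auto simp: mat_of_rows_list_def less_Suc_eq numeral_2_eq_2)

lemma transpose_mat3:
  "transpose_mat (mat_of_rows_list 3 [[a, b, c], [d, e, f], [g, h, i]])
    = mat_of_rows_list 3 [[a, d, g], [b, e, h], [c, f, i]]"
  by (rule eq_matI) (auto simp: mat_of_rows_list_def less_Suc_eq numeral_3_eq_3)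

lemma xyz_nonzero: "var_x * var_y * var_z \<noteq> (0 :: 'k::field fps3)"
  by (simp add: var_x_def var_y_def var_z_def)

context coord
begin

definition comb :: "nat \<Rightarrow> (nat \<Rightarrow> 'k fps3) \<Rightarrow> (nat \<Rightarrow> 'k triple) \<Rightarrow> 'k triple" where
  "comb n r e = (\<Sum>i<n. act (r i) (e i))"

text \<open>Relations are taken modulo \<open>xyz\<close>, with coefficients in the power series
  ring. The clause on constant terms is what will make \<open>n\<close> the minimal number of
  generators.\<close>

definition presents :: "nat \<Rightarrow> 'k fps3 mat \<Rightarrow> 'k triple set \<Rightarrow> bool" where
  "presents n \<theta> L \<longleftrightarrow> dim_row \<theta> = n \<and> dim_col \<theta> = n \<and> (\<forall>i<n. \<forall>j<n. cc (\<theta> $$ (i, j)) = 0) \<and>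
     (\<exists>e. (\<forall>i<n. e i \<in> L) \<and> (\<forall>l\<in>L. \<exists>r. l = comb n r e) \<and>
        (\<forall>j<n. comb n (\<lambda>i. \<theta> $$ (i, j)) e = 0) \<and>
        (\<forall>r. comb n r e = 0 \<longrightarrow>
           (\<exists>q. \<forall>i<n. var_x * var_y * var_z dvd r i - (\<Sum>j<n. \<theta> $$ (i, j) * q j))))"

text \<open>The relations are generated by the columns of \<open>\<theta>\<close> as soon as every relation is killed by the
  adjugate of \<open>\<theta>\<close> modulo each of \<open>u\<close>, \<open>v\<close>, \<open>w\<close>.\<close>

lemma presentsI:
  fixes \<theta> :: "'k fps3 mat"
  assumes dim: "dim_row \<theta> = n" "dim_col \<theta> = n" and cc0: "\<And>i j. i < n \<Longrightarrow> j < n \<Longrightarrow> cc (\<theta> $$ (i, j)) = 0"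
    and e: "\<And>i. i < n \<Longrightarrow> e i \<in> L" and gen: "\<And>l. l \<in> L \<Longrightarrow> \<exists>r. l = comb n r e"
    and rel: "\<And>j. j < n \<Longrightarrow> comb n (\<lambda>i. \<theta> $$ (i, j)) e = 0"
    and \<delta>: "cc \<delta> \<noteq> 0"
    and adj: "\<And>i j. i < n \<Longrightarrow> j < n \<Longrightarrow> (\<Sum>k<n. \<theta> $$ (i, k) * adj k j) = (if i = j then \<delta> * (u * v * w) else 0)"
    and ker: "\<And>r k. comb n r e = 0 \<Longrightarrow> k < n \<Longrightarrow>
      \<pi>1 (\<Sum>j<n. adj k j * r j) = 0 \<and> \<pi>2 (\<Sum>j<n. adj k j * r j) = 0 \<and> \<pi>3 (\<Sum>j<n. adj k j * r j) = 0"
  shows "presents n \<theta> L"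
proof -
  obtain \<delta>' where \<delta>': "\<delta> * \<delta>' = 1" using cc_unit[OF \<delta>] by blast
  have nz: "u * v * w \<noteq> 0" using uvw xyz_nonzero by metis
  have "\<exists>q. \<forall>i<n. var_x * var_y * var_z dvd r i - (\<Sum>j<n. \<theta> $$ (i, j) * q j)" if r: "comb n r e = 0" for r
  proof -
    have "\<exists>p. \<forall>k<n. (\<Sum>j<n. adj k j * r j) = u * v * w * p k"
      using ker_uvw ker[OF r] unfolding dvd_def by (intro choice) blast
    then obtain p where p: "\<And>k. k < n \<Longrightarrow> (\<Sum>j<n. adj k j * r j) = u * v * w * p k" by blast
    \<comment> \<open>The adjugate applied to \<open>r\<close> is \<open>u * v * w\<close> times
      \<open>p\<close>. Applying \<open>\<theta>\<close> gives \<open>\<delta>\<close> times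
      \<open>u * v * w\<close> times \<open>r\<close>, and \<open>u * v * w\<close> cancels because
      power series form a domain. Hence \<open>r\<close> is the image of \<open>\<delta>' p\<close>
      even before passing to the quotient.\<close>
    have "r i - (\<Sum>k<n. \<theta> $$ (i, k) * (\<delta>' * p k)) = 0" if i: "i < n" for i
    proof -
      have "u * v * w * (\<Sum>k<n. \<theta> $$ (i, k) * (\<delta>' * p k)) = (\<Sum>k<n. \<delta>' * (\<theta> $$ (i, k) * (u * v * w * p k)))"
        by (simp add: sum_distrib_left mult_ac)
      also have "\<dots> = (\<Sum>k<n. \<Sum>j<n. \<delta>' * (\<theta> $$ (i, k) * adj k j * r j))"
      proof (intro sum.cong refl)
        fix k assume "k \<in> {..<n}"
        then have "u * v * w * p k = (\<Sum>j<n. adj k j * r j)" using p by simp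
        then show "\<delta>' * (\<theta> $$ (i, k) * (u * v * w * p k)) = (\<Sum>j<n. \<delta>' * (\<theta> $$ (i, k) * adj k j * r j))"
          by (simp add: sum_distrib_left mult.assoc)
      qed
      also have "\<dots> = (\<Sum>j<n. \<Sum>k<n. \<delta>' * (\<theta> $$ (i, k) * adj k j * r j))" by (rule sum.swap)
      also have "\<dots> = (\<Sum>j<n. \<delta>' * ((\<Sum>k<n. \<theta> $$ (i, k) * adj k j) * r j))"
        by (simp add: sum_distrib_left sum_distrib_right mult_ac)
      also have "\<dots> = (\<Sum>j<n. if j = i then \<delta>' * (\<delta> * (u * v * w)) * r j else 0)"
        using i by (intro sum.cong refl) (simp add: adj)
      also have "\<dots> = \<delta>' * (\<delta> * (u * v * w)) * r i" using i by simp
      also have "\<dots> = (\<delta> * \<delta>') * (u * v * w * r i)" by (simp only: mult_ac)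
      also have "\<dots> = u * v * w * r i" by (simp add: \<delta>')
      finally show ?thesis using nz by simp
    qed
    then show ?thesis by (intro exI[of _ "\<lambda>k. \<delta>' * p k"]) simp
  qed
  then show ?thesis unfolding presents_def using dim cc0 e gen rel by (intro conjI exI[of _ e]) simp_all
qed

lemma presents2I:
  assumes E: "E1 \<in> L" "E2 \<in> L" and gen: "\<And>l. l \<in> L \<Longrightarrow> \<exists>r1 r2. l = act r1 E1 + act r2 E2"
    and rel: "act a E1 + act c E2 = 0" "act b E1 + act d E2 = 0"
    and cc0: "cc a = 0" "cc b = 0" "cc c = 0" "cc d = 0"
    and \<delta>: "cc \<delta> \<noteq> 0" and det: "a * d - b * c = \<delta> * (u * v * w)"
    and ker: "\<And>r1 r2. act r1 E1 + act r2 E2 = 0 \<Longrightarrow>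
      \<pi>1 (d * r1 - b * r2) = 0 \<and> \<pi>2 (d * r1 - b * r2) = 0 \<and> \<pi>3 (d * r1 - b * r2) = 0 \<and>
      \<pi>1 (a * r2 - c * r1) = 0 \<and> \<pi>2 (a * r2 - c * r1) = 0 \<and> \<pi>3 (a * r2 - c * r1) = 0"
  shows "presents 2 (mat_of_rows_list 2 [[a, b], [c, d]]) L"
proof -
  define e where "e = (\<lambda>i::nat. if i = 0 then E1 else E2)"
  define adj where "adj = (\<lambda>(i::nat) (j::nat). if i = 0 then (if j = 0 then d else - b) else (if j = 0 then - c else a))"
  let ?T = "mat_of_rows_list 2 [[a, b], [c, d]]"
  have comb: "comb 2 r e = act (r 0) E1 + act (r 1) E2" for r by (simp add: comb_def sum_lt_2 e_def)
  have "(\<forall>i<2. \<forall>j<2. cc (?T $$ (i, j)) = 0)" using cc0 by (simp add: all_lt_2)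
  moreover have "\<forall>i<2. e i \<in> L" using E by (simp add: all_lt_2 e_def)
  moreover have "\<forall>j<2. comb 2 (\<lambda>i. ?T $$ (i, j)) e = 0" using rel by (simp add: all_lt_2 comb)
  moreover have "\<forall>i<2. \<forall>j<2. (\<Sum>k<2. ?T $$ (i, k) * adj k j) = (if i = j then \<delta> * (u * v * w) else 0)"
    using det by (simp add: all_lt_2 sum_lt_2 adj_def mult_ac)
  moreover have "\<exists>r. l = comb 2 r e" if l: "l \<in> L" for l
  proof -
    obtain r1 r2 where "l = act r1 E1 + act r2 E2" using gen[OF l] by blast
    then show ?thesis by (intro exI[of _ "\<lambda>i. if i = 0 then r1 else r2"]) (simp add: comb)
  qed
  moreover have "\<forall>k<2. \<pi>1 (\<Sum>j<2. adj k j * r j) = 0 \<and> \<pi>2 (\<Sum>j<2. adj k j * r j) = 0 \<and> \<pi>3 (\<Sum>j<2. adj k j * r j) = 0"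
    if r: "comb 2 r e = 0" for r
    using ker[of "r 0" "r 1"] r by (simp add: all_lt_2 sum_lt_2 adj_def comb)
  ultimately show ?thesis
    by (intro presentsI[where e = e and adj = adj, OF _ _ _ _ _ _ \<delta>]) (simp_all add: mat_of_rows_list_def)
qed

text \<open>The three lines are the rows of the adjugate of the matrix with rows (a, b, c), (d, e,
  f), (g, h, i), applied to the column of the r's. The restriction is a parameter because each plane
  needs an argument of its own.\<close>

definition adjugate_kills where
  "adjugate_kills \<pi> a b c d e f g h i r1 r2 r3 \<longleftrightarrow>
     \<pi> ((e * i - f * h) * r1 + (c * h - b * i) * r2 + (b * f - c * e) * r3) = 0 \<and>
     \<pi> ((f * g - d * i) * r1 + (a * i - c * g) * r2 + (c * d - a * f) * r3) = 0 \<and>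
     \<pi> ((d * h - e * g) * r1 + (b * g - a * h) * r2 + (a * e - b * d) * r3) = 0"
  for \<pi> :: "'k fps3 \<Rightarrow> 'k fps fps"

lemma presents3I:
  assumes E: "E1 \<in> L" "E2 \<in> L" "E3 \<in> L"
    and gen: "\<And>l. l \<in> L \<Longrightarrow> \<exists>r1 r2 r3. l = act r1 E1 + act r2 E2 + act r3 E3"
    and rel: "act a E1 + act d E2 + act g E3 = 0" "act b E1 + act e E2 + act h E3 = 0"
      "act c E1 + act f E2 + act i E3 = 0"
    and cc0: "cc a = 0" "cc b = 0" "cc c = 0" "cc d = 0" "cc e = 0" "cc f = 0" "cc g = 0" "cc h = 0" "cc i = 0"
    and \<delta>: "cc \<delta> \<noteq> 0"
    and det: "a * (e * i - f * h) - b * (d * i - f * g) + c * (d * h - e * g) = \<delta> * (u * v * w)"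
    and ker: "\<And>r1 r2 r3. act r1 E1 + act r2 E2 + act r3 E3 = 0 \<Longrightarrow>
      \<forall>\<pi> \<in> {\<pi>1, \<pi>2, \<pi>3}. adjugate_kills \<pi> a b c d e f g h i r1 r2 r3"
  shows "presents 3 (mat_of_rows_list 3 [[a, b, c], [d, e, f], [g, h, i]]) L"
proof -
  define E where "E = (\<lambda>i::nat. if i = 0 then E1 else if i = 1 then E2 else E3)"
  define adj where "adj = (\<lambda>(k::nat) (j::nat).
    if k = 0 then (if j = 0 then e * i - f * h else if j = 1 then c * h - b * i else b * f - c * e)
    else if k = 1 then (if j = 0 then f * g - d * i else if j = 1 then a * i - c * g else c * d - a * f)
    else (if j = 0 then d * h - e * g else if j = 1 then b * g - a * h else a * e - b * d))"
  let ?T = "mat_of_rows_list 3 [[a, b, c], [d, e, f], [g, h, i]]"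
  have comb: "comb 3 r E = act (r 0) E1 + act (r 1) E2 + act (r 2) E3" for r by (simp add: comb_def sum_lt_3 E_def)
  have 1: "(\<forall>i<3. \<forall>j<3. cc (?T $$ (i, j)) = 0)" using cc0 by (simp add: all_lt_3)
  have 2: "\<forall>i<3. E i \<in> L" using assms(1-3) by (simp add: all_lt_3 E_def)
  have 3: "\<forall>j<3. comb 3 (\<lambda>i. ?T $$ (i, j)) E = 0" using rel by (simp add: all_lt_3 comb)
  have 4: "\<forall>i<3. \<forall>j<3. (\<Sum>k<3. ?T $$ (i, k) * adj k j) = (if i = j then \<delta> * (u * v * w) else 0)"
    unfolding det[symmetric] by (simp add: all_lt_3 sum_lt_3 adj_def algebra_simps)
  have 5: "\<exists>r. l = comb 3 r E" if l: "l \<in> L" for l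
  proof -
    obtain r1 r2 r3 where "l = act r1 E1 + act r2 E2 + act r3 E3" using gen[OF l] by blast
    then show ?thesis by (intro exI[of _ "\<lambda>i. if i = 0 then r1 else if i = 1 then r2 else r3"]) (simp add: comb)
  qed
  have 6: "\<forall>k<3. \<pi>1 (\<Sum>j<3. adj k j * r j) = 0 \<and> \<pi>2 (\<Sum>j<3. adj k j * r j) = 0 \<and> \<pi>3 (\<Sum>j<3. adj k j * r j) = 0"
    if r: "comb 3 r E = 0" for r
    using ker[of "r 0" "r 1" "r 2"] r by (simp add: adjugate_kills_def all_lt_3 sum_lt_3 adj_def comb)
  show ?thesis
    by (rule presentsI[where e = E and adj = adj, OF _ _ _ _ _ _ \<delta>])
      (use 1 2 3 4 5 6 in \<open>simp_all add: mat_of_rows_list_def\<close>)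
qed

lemma span2_closed:
  assumes "\<exists>r1 r2. l = act r1 E1 + act r2 E2" "\<exists>r1 r2. l' = act r1 E1 + act r2 E2"
  shows "\<exists>r1 r2. l + act F l' = act r1 E1 + act r2 E2"
proof -
  obtain r1 r2 s1 s2 where "l = act r1 E1 + act r2 E2" "l' = act s1 E1 + act s2 E2" using assms by blast
  then have "l + act F l' = act (r1 + F * s1) E1 + act (r2 + F * s2) E2"
    by (simp add: act_add act_add_left act_mult)
  then show ?thesis by blast
qed

lemma span3_closed:
  assumes "\<exists>r1 r2 r3. l = act r1 E1 + act r2 E2 + act r3 E3" "\<exists>r1 r2 r3. l' = act r1 E1 + act r2 E2 + act r3 E3"
  shows "\<exists>r1 r2 r3. l + act F l' = act r1 E1 + act r2 E2 + act r3 E3"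
proof -
  obtain r1 r2 r3 s1 s2 s3 where "l = act r1 E1 + act r2 E2 + act r3 E3" "l' = act s1 E1 + act s2 E2 + act s3 E3"
    using assms by blast
  then have "l + act F l' = act (r1 + F * s1) E1 + act (r2 + F * s2) E2 + act (r3 + F * s3) E3"
    by (simp add: act_add act_add_left act_mult)
  then show ?thesis by blast
qed

definition same_boundary :: "'k triple \<Rightarrow> 'k triple \<Rightarrow> bool" where
  "same_boundary = (\<lambda>(f, g, h) (f', g', h'). res_s f = res_s f' \<and> res_t f = res_t f' \<and>
     res_s g = res_s g' \<and> res_t g = res_t g' \<and> res_s h = res_s h' \<and> res_t h = res_t h')"

text \<open>Triples with equal restrictions to all axes differ by multiples of st in each component.
  To generate a gluing module it therefore suffices to obtain the three triples with a single entry
  st and, for each member, one combination with its boundary values.\<close>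

lemma generation:
  assumes closed: "\<And>l l' F. l \<in> S \<Longrightarrow> l' \<in> S \<Longrightarrow> l + act F l' \<in> S"
    and st: "(sv * tv, 0, 0) \<in> S" "(0, sv * tv, 0) \<in> S" "(0, 0, sv * tv) \<in> S"
    and l0: "l0 \<in> S" and bd: "same_boundary l l0"
  shows "l \<in> S"
proof -
  interpret r: coord \<pi>2 \<pi>3 \<pi>1 v w u by (rule coord_rot)
  interpret rr: coord \<pi>3 \<pi>1 \<pi>2 w u v by (rule r.coord_rot)
  obtain f g h where l: "l = (f, g, h)" by (cases l)
  obtain f' g' h' where l0': "l0 = (f', g', h')" by (cases l0)
  have "sv * tv dvd f - f'" "sv * tv dvd g - g'" "sv * tv dvd h - h'"
    using bd unfolding l l0' same_boundary_def st_dvd_iff by (simp_all add: res_s.hom_minus res_t.hom_minus)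
  then obtain a b c where "f - f' = sv * tv * a" "g - g' = sv * tv * b" "h - h' = sv * tv * c"
    by (elim dvdE)
  moreover obtain F where "\<pi>1 F = a" using surj1 by blast
  moreover obtain G where "\<pi>2 G = b" using r.surj1 by blast
  moreover obtain H where "\<pi>3 H = c" using rr.surj1 by blast
  ultimately have "l = l0 + act F (sv * tv, 0, 0) + act G (0, sv * tv, 0) + act H (0, 0, sv * tv)"
    unfolding l l0' by (simp add: mult_ac add.commute diff_eq_eq)
  then show ?thesis using closed[OF closed[OF closed[OF l0 st(1)] st(2)] st(3), of F G H] by simp
qed

lemma lift_u: "\<exists>F. \<pi>2 F = in_t a \<and> \<pi>3 F = in_s a \<and> \<pi>1 F = const2 (fps_nth a 0)"
proof -
  interpret r: coord \<pi>2 \<pi>3 \<pi>1 v w u by (rule coord_rot)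
  show ?thesis by (rule r.lift_w)
qed

lemma lift_v: "\<exists>F. \<pi>3 F = in_t a \<and> \<pi>1 F = in_s a \<and> \<pi>2 F = const2 (fps_nth a 0)"
proof -
  interpret r: coord \<pi>2 \<pi>3 \<pi>1 v w u by (rule coord_rot)
  show ?thesis by (rule r.lift_u)
qed

text \<open>Adding the lifts of the three axis series counts the common constant term three times,
  so it is subtracted twice.\<close>

lemma lift_boundary:
  assumes "fps_nth a 0 = k" "fps_nth b 0 = k" "fps_nth c 0 = k"
  obtains F where "res_s (\<pi>1 F) = a" "res_t (\<pi>2 F) = a" "res_s (\<pi>2 F) = b" "res_t (\<pi>3 F) = b"
    "res_s (\<pi>3 F) = c" "res_t (\<pi>1 F) = c"
proof -
  obtain p where p: "\<pi>1 p = in_t a" "\<pi>2 p = in_s a" "\<pi>3 p = const2 k" using lift_w assms(1) by blast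
  obtain q where q: "\<pi>2 q = in_t b" "\<pi>3 q = in_s b" "\<pi>1 q = const2 k" using lift_u assms(2) by blast
  obtain r where r: "\<pi>3 r = in_t c" "\<pi>1 r = in_s c" "\<pi>2 r = const2 k" using lift_v assms(3) by blast
  define F where "F = (p - const3 k) + (q - const3 k) + r"
  have "\<pi>1 F = in_t a - const2 k + in_s c" "\<pi>2 F = in_s a - const2 k + in_t b" "\<pi>3 F = in_s b - const2 k + in_t c"
    unfolding F_def p1.hom_add p2.hom_add p3.hom_add p1.hom_minus p2.hom_minus p3.hom_minus p q r const_vals
    by (simp_all only: diff_self add_0_right add_0_left)  (simp_all only: algebra_simps)
  then show ?thesis
    by (intro that[of F]) (simp_all only: res_s.hom_add res_s.hom_minus res_t.hom_add res_t.hom_minus res_simps assms, simp_all)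
qed

end

section \<open>Presentations for the individual sign patterns\<close>

lemma fps_X_dvdE:
  fixes a :: "'k::field fps" assumes "fps_nth a 0 = 0" obtains b where "a = fps_X * b"
proof -
  have "a = fps_X * fps_shift 1 a" using assms by (simp add: fps_eq_iff fps_X_mult_nth)
  then show ?thesis by (rule that)
qed

lemma const_inverse:
  fixes c :: "'k::field" assumes "c \<noteq> 0"
  shows "const2 c * const2 (inverse c) = 1" "fps_const c * fps_const (inverse c) = 1"
    "const3 c * const3 (inverse c) = 1"
  using assms by (simp_all add: const2_def const3_def)

lemma fps_X_pow_nth_0: "fps_nth (fps_X ^ n * a) 0 = (if n = 0 then fps_nth a 0 else (0 :: 'k::field))"
  by (cases n) (simp_all add: mult.assoc)

context coord
begin

lemmas hom_simps = p1.hom_add p1.hom_mult p1.hom_minus p1.hom_uminus p1.hom_power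
  p2.hom_add p2.hom_mult p2.hom_minus p2.hom_uminus p2.hom_power
  p3.hom_add p3.hom_mult p3.hom_minus p3.hom_uminus p3.hom_power
  res_s.hom_add res_s.hom_mult res_s.hom_minus res_s.hom_uminus res_s.hom_power
  res_t.hom_add res_t.hom_mult res_t.hom_minus res_t.hom_uminus res_t.hom_power
  cc.hom_add cc.hom_mult cc.hom_minus cc.hom_uminus cc.hom_power

lemma cc_var [simp]: "cc u = 0" "cc v = 0" "cc w = 0"
  using ccs(1)[of u] ccs(1)[of v] ccs(1)[of w] by simp_all

text \<open>Gluing exponents q, -p, 0: \<open>f\<close> and \<open>h\<close> determine the values of
  \<open>g\<close> on both axes and agree with each other up to the scalar. Every member therefore
  has the boundary values of a multiple of \<open>E2\<close>, whose outer components are units;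
  \<open>E1\<close> supplies the multiples of st in the second plane.\<close>

lemma presents_theta3:
  assumes c: "c \<noteq> 0" and p: "p \<ge> 1" and q: "q \<ge> 1"
  shows "presents 2 (theta3 v u w (p, q) (inverse c)) (glue (fps_X ^ q) 1 1 (fps_X ^ p) 1 (fps_const c))"
proof -
  define M where "M = const2 (inverse c)"
  define E1 E2 :: "'k triple" where "E1 = (0, - (sv * tv), 0)"
    and "E2 = (M, M * sv ^ q + tv ^ p, 1)"
  let ?L = "glue (fps_X ^ q) 1 1 (fps_X ^ p) 1 (fps_const c)"
  have cM: "const2 c * M = 1" "M * const2 c = 1" unfolding M_def using const_inverse[OF c] by (simp_all add: mult.commute)
  have "M * (sv * (tv * const2 c)) = (M * const2 c) * (sv * tv)" by (simp only: mult_ac)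
  then have cst: "M * (sv * (tv * const2 c)) = sv * tv" using cM by simp
  have rM: "res_s M = fps_const (inverse c)" "res_t M = fps_const (inverse c)" unfolding M_def by simp_all
  have cm: "fps_const c * fps_const (inverse c) = 1" "fps_const (inverse c) * fps_const c = 1"
    using const_inverse[OF c] by (simp_all add: mult.commute)
  have z: "(0::'k fps) ^ p = 0" "(0::'k fps) ^ q = 0" "(0::'k fps fps) ^ p = 0" "(0::'k fps fps) ^ q = 0"
    "(0::'k) ^ p = 0" "(0::'k) ^ q = 0" using p q by auto
  have th: "theta3 v u w (p, q) (inverse c) = mat_of_rows_list 2 [[v, u ^ p + const3 (inverse c) * w ^ q], [0, u * w]]"
    unfolding theta3_def theta1_def by (simp add: transpose_mat2)
  show ?thesis
    unfolding th
  proof (rule presents2I[where ?E1.0 = E1 and ?E2.0 = E2 and \<delta> = 1])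
    show "E1 \<in> ?L" unfolding E1_def glue_def by (simp add: hom_simps)
    show "E2 \<in> ?L" unfolding E2_def glue_def by (simp add: hom_simps rM z cm c mult.commute)
    show "\<exists>r1 r2. l = act r1 E1 + act r2 E2" if l: "l \<in> ?L" for l
    proof -
      obtain f g h where l': "l = (f, g, h)" by (cases l)
      have eq: "fps_X ^ q * res_s f = res_t g" "res_s g = fps_X ^ p * res_t h" "res_s h = fps_const c * res_t f"
        using l unfolding l' glue_def by simp_all
      have k: "cc2 h = c * cc2 f" using arg_cong[OF eq(3), of "\<lambda>a. fps_nth a 0"] by simp
      \<comment> \<open>The factor \<open>c\<close> makes up for the entry \<open>M\<close>, the
        inverse of \<open>c\<close>, in \<open>E2\<close>; by \<open>k\<close> the three prescribed
        series agree at the origin, as the lift requires.\<close>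
      obtain P where P: "res_s (\<pi>1 P) = fps_const c * res_s f" "res_t (\<pi>2 P) = fps_const c * res_s f"
        "res_s (\<pi>2 P) = res_t h" "res_t (\<pi>3 P) = res_t h" "res_s (\<pi>3 P) = res_s h" "res_t (\<pi>1 P) = res_s h"
        by (rule lift_boundary[of "fps_const c * res_s f" "cc2 h" "res_t h" "res_s h"]) (simp_all add: k)
      define S where "S = {l. \<exists>r1 r2. l = act r1 E1 + act r2 E2}"
      have S: "act r1 E1 + act r2 E2 \<in> S" for r1 r2 unfolding S_def by blast
      have "l \<in> S"
      proof (rule generation)
        show "l + act F l' \<in> S" if "l \<in> S" "l' \<in> S" for l l' F
          using that span2_closed unfolding S_def by blast
        show "(sv * tv, 0, 0) \<in> S"
          using S[of 0 "const3 c * v * w"] by (simp add: E1_def E2_def hom_simps mult_ac cst)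
        show "(0, sv * tv, 0) \<in> S"
          using S[of "-1" 0] by (simp add: E1_def E2_def hom_simps)
        show "(0, 0, sv * tv) \<in> S"
          using S[of 0 "u * v"] by (simp add: E1_def E2_def hom_simps)
        show "act 0 E1 + act P E2 \<in> S" by (rule S)
        have "fps_const c * (a * (fps_const (inverse c) * b)) = (fps_const c * fps_const (inverse c)) * (a * b)" for a b
          by (simp only: mult_ac)
        then have ca: "fps_const c * (a * (fps_const (inverse c) * b)) = a * b" for a b unfolding cm by simp
        have "res_t g = res_s f * fps_X ^ q" using eq(1) by (simp add: mult.commute)
        then show "same_boundary l (act 0 E1 + act P E2)"
          unfolding l' E2_def same_boundary_def
          using c by (simp add: hom_simps P rM z eq(2,3) ca mult_ac)
      qed
      then show ?thesis unfolding S_def by blast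
    qed
    show "act v E1 + act 0 E2 = 0" unfolding E1_def E2_def by (simp add: hom_simps zero_prod_def)
    show "act (u ^ p + const3 (inverse c) * w ^ q) E1 + act (u * w) E2 = 0"
      unfolding E1_def E2_def by (simp add: hom_simps zero_prod_def M_def algebra_simps)
    show "v * (u * w) - (u ^ p + const3 (inverse c) * w ^ q) * 0 = 1 * (u * v * w)" by (simp add: mult_ac)
    fix r1 r2 assume "act r1 E1 + act r2 E2 = 0"
    then have 0: "M * \<pi>1 r2 = 0" "(M * sv ^ q + tv ^ p) * \<pi>2 r2 = sv * tv * \<pi>2 r1" "\<pi>3 r2 = 0"
      unfolding E1_def E2_def by (simp_all add: zero_prod_def mult_ac)
    have "\<pi>1 r2 = 0" using 0(1) cM by auto
    then show "\<pi>1 (u * w * r1 - (u ^ p + const3 (inverse c) * w ^ q) * r2) = 0 \<and>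
      \<pi>2 (u * w * r1 - (u ^ p + const3 (inverse c) * w ^ q) * r2) = 0 \<and>
      \<pi>3 (u * w * r1 - (u ^ p + const3 (inverse c) * w ^ q) * r2) = 0 \<and>
      \<pi>1 (v * r2 - 0 * r1) = 0 \<and> \<pi>2 (v * r2 - 0 * r1) = 0 \<and> \<pi>3 (v * r2 - 0 * r1) = 0"
      using 0(2,3) by (simp add: hom_simps M_def algebra_simps)
  qed (simp_all add: hom_simps z)
qed

text \<open>Gluing exponents -q, p, 0: \<open>g\<close> determines the values of \<open>f\<close>
  and \<open>h\<close> on the axes they share with it, and \<open>E1\<close> realizes them. What
  remains is one series on the axis of \<open>v\<close>, zero at the origin, and \<open>E2\<close>
  accounts for it.\<close>

lemma presents_theta1:
  assumes c: "c \<noteq> 0" and p: "p \<ge> 1" and q: "q \<ge> 1"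
  shows "presents 2 (theta1 v u w (p, q) c) (glue 1 (fps_X ^ q) (fps_X ^ p) 1 1 (fps_const c))"
proof -
  define M where "M = const2 (inverse c)"
  define E1 E2 :: "'k triple" where "E1 = (- (tv ^ q), - 1, - (sv ^ p))"
    and "E2 = (M * sv, 0, tv)"
  let ?L = "glue 1 (fps_X ^ q) (fps_X ^ p) 1 1 (fps_const c)"
  have cM: "const2 c * M = 1" "M * const2 c = 1" unfolding M_def using const_inverse[OF c] by (simp_all add: mult.commute)
  have "M * (sv * (tv * const2 c)) = (M * const2 c) * (sv * tv)" by (simp only: mult_ac)
  then have cst: "M * (sv * (tv * const2 c)) = sv * tv" using cM by simp
  have rM: "res_s M = fps_const (inverse c)" "res_t M = fps_const (inverse c)" unfolding M_def by simp_all
  have cm: "fps_const c * fps_const (inverse c) = 1" "fps_const (inverse c) * fps_const c = 1"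
    using const_inverse[OF c] by (simp_all add: mult.commute)
  have cm': "fps_const (inverse c) * (fps_const c * a) = a" "fps_const c * (fps_const (inverse c) * a) = a" for a
    using cm by (metis mult.assoc mult_1)+
  have cM': "const2 c * (M * a) = a" "M * (const2 c * a) = a" for a
    using cM by (metis mult.assoc mult_1)+
  have z: "(0::'k fps) ^ p = 0" "(0::'k fps) ^ q = 0" "(0::'k fps fps) ^ p = 0" "(0::'k fps fps) ^ q = 0"
    "(0::'k) ^ p = 0" "(0::'k) ^ q = 0" using p q by auto
  have th: "theta1 v u w (p, q) c = mat_of_rows_list 2 [[v, 0], [u ^ p + const3 c * w ^ q, u * w]]"
    unfolding theta1_def by simp
  show ?thesis
    unfolding th
  proof (rule presents2I[where ?E1.0 = E1 and ?E2.0 = E2 and \<delta> = 1])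
    show "E1 \<in> ?L" unfolding E1_def glue_def by (simp add: hom_simps z)
    show "E2 \<in> ?L" unfolding E2_def glue_def by (simp add: hom_simps rM z cm cm' c mult.commute)
    show "\<exists>r1 r2. l = act r1 E1 + act r2 E2" if l: "l \<in> ?L" for l
    proof -
      obtain f g h where l': "l = (f, g, h)" by (cases l)
      have eq: "res_s f = fps_X ^ q * res_t g" "res_t h = fps_X ^ p * res_s g" "res_s h = fps_const c * res_t f"
        using l unfolding l' glue_def by simp_all
      have tf: "res_t f = fps_const (inverse c) * res_s h" using cm'(1)[of "res_t f"] eq(3) by simp
      have "cc2 h = 0" using arg_cong[OF eq(2), of "\<lambda>a. fps_nth a 0"] p by (simp add: fps_X_pow_nth_0)
      then obtain \<psi> where psi: "res_s h = fps_X * \<psi>" using fps_X_dvdE[of "res_s h"] by auto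
      \<comment> \<open>On the axis of \<open>v\<close> both outer components of \<open>E1\<close>
        vanish, so any series with the right constant term may be prescribed there; the constant one
        is taken.\<close>
      obtain P where P: "res_s (\<pi>1 P) = - res_t g" "res_t (\<pi>2 P) = - res_t g"
        "res_s (\<pi>2 P) = - res_s g" "res_t (\<pi>3 P) = - res_s g"
        by (rule lift_boundary[of "- res_t g" "- cc2 g" "- res_s g" "- fps_const (cc2 g)"]) simp_all
      obtain Q where Q: "\<pi>3 Q = in_t \<psi>" "\<pi>1 Q = in_s \<psi>" using lift_v by blast
      define S where "S = {l. \<exists>r1 r2. l = act r1 E1 + act r2 E2}"
      have S: "act r1 E1 + act r2 E2 \<in> S" for r1 r2 unfolding S_def by blast
      have "l \<in> S"
      proof (rule generation)
        show "l + act F l' \<in> S" if "l \<in> S" "l' \<in> S" for l l' F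
          using that span2_closed unfolding S_def by blast
        show "(sv * tv, 0, 0) \<in> S"
          using S[of 0 "const3 c * w"] by (simp add: E1_def E2_def hom_simps mult_ac cst)
        show "(0, sv * tv, 0) \<in> S"
          using S[of "- (u * w)" 0] by (simp add: E1_def E2_def hom_simps mult_ac)
        show "(0, 0, sv * tv) \<in> S"
          using S[of 0 "u"] by (simp add: E1_def E2_def hom_simps)
        show "act P E1 + act Q E2 \<in> S" by (rule S)
        show "same_boundary l (act P E1 + act Q E2)"
          unfolding l' E1_def E2_def same_boundary_def
          by (simp add: hom_simps P Q rM z eq(1,2) tf psi mult_ac)
      qed
      then show ?thesis unfolding S_def by blast
    qed
    show "act v E1 + act (u ^ p + const3 c * w ^ q) E2 = 0"
      unfolding E1_def E2_def by (simp add: hom_simps zero_prod_def z algebra_simps cM)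
    show "act 0 E1 + act (u * w) E2 = 0"
      unfolding E1_def E2_def by (simp add: hom_simps zero_prod_def)
    show "v * (u * w) - 0 * (u ^ p + const3 c * w ^ q) = 1 * (u * v * w)" by (simp add: mult_ac)
    fix r1 r2 assume "act r1 E1 + act r2 E2 = 0"
    then have 0: "M * sv * \<pi>1 r2 = tv ^ q * \<pi>1 r1" "\<pi>2 r1 = 0" "tv * \<pi>3 r2 = sv ^ p * \<pi>3 r1"
      unfolding E1_def E2_def by (simp_all add: zero_prod_def mult_ac)
    have 1: "sv * \<pi>1 r2 = const2 c * (tv ^ q * \<pi>1 r1)" unfolding 0(1)[symmetric] by (simp add: mult.assoc cM')
    show "\<pi>1 (u * w * r1 - 0 * r2) = 0 \<and> \<pi>2 (u * w * r1 - 0 * r2) = 0 \<and> \<pi>3 (u * w * r1 - 0 * r2) = 0 \<and>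
      \<pi>1 (v * r2 - (u ^ p + const3 c * w ^ q) * r1) = 0 \<and> \<pi>2 (v * r2 - (u ^ p + const3 c * w ^ q) * r1) = 0 \<and>
      \<pi>3 (v * r2 - (u ^ p + const3 c * w ^ q) * r1) = 0"
      using 0(2,3) 1 by (simp add: hom_simps z mult.assoc)
  qed (simp_all add: hom_simps z)
qed

end

lemma scale_eq: "a * x = b * y \<Longrightarrow> a * c * x = b * c * (y :: 'a::comm_semiring_0)"
  by (metis mult.assoc mult.commute)

context coord
begin

lemma const2_minus [simp]: "const2 (- c) = - const2 c"
  by (simp add: const2_def flip: fps_const_neg)

lemma const_cancel:
  assumes "c \<noteq> 0"
  shows "const2 c * (const2 (inverse c) * a) = a" "const2 (inverse c) * (const2 c * a) = a"
    "fps_const c * (fps_const (inverse c) * b) = b" "fps_const (inverse c) * (fps_const c * b) = b"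
  using const_inverse[OF assms] const_inverse[of "inverse c"] assms
  by (simp_all only: mult.assoc[symmetric] mult_1 inverse_inverse_eq nonzero_imp_inverse_nonzero simp_thms inverse_nonzero_iff_nonzero)

text \<open>The generators of the module with gluing exponents of signs \<open>+, -, +\<close>; the third one is
  redundant for \<open>k = 1\<close>.\<close>

lemma generation_mixed:
  assumes c: "c \<noteq> 0" and a: "a \<ge> 1" and k: "k \<ge> 1" and b: "b \<ge> 1"
    and E: "E1 = (const2 (inverse c) * sv ^ b, tv ^ k, 1)" "E2 = (tv, sv ^ (a + 1), 0)" "E3 = (0, sv * tv, 0)"
    and L: "L = glue (fps_X ^ a) 1 1 (fps_X ^ k) (fps_X ^ b) (fps_const c)"
  shows "E1 \<in> L" "E2 \<in> L" "E3 \<in> L"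
    and "\<And>l. l \<in> L \<Longrightarrow> \<exists>r1 r2 r3. l = act r1 E1 + act r2 E2 + act r3 E3"
proof -
  have z: "(0::'k fps) ^ a = 0" "(0::'k fps) ^ b = 0" "(0::'k fps) ^ k = 0" using a b k by auto
  show "E1 \<in> L" "E2 \<in> L" "E3 \<in> L"
    unfolding E L glue_def using c by (simp_all add: hom_simps z const_cancel mult_ac)
  fix l assume l: "l \<in> L"
  obtain f g h where l': "l = (f, g, h)" by (cases l)
  have eq: "res_t g = fps_X ^ a * res_s f" "res_s g = fps_X ^ k * res_t h" "fps_X ^ b * res_s h = fps_const c * res_t f"
    using l unfolding l' L glue_def by simp_all
  have tf: "res_t f = fps_const (inverse c) * (fps_X ^ b * res_s h)" unfolding eq(3) by (simp add: const_cancel c)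
  \<comment> \<open>Here \<open>b \<ge> 1\<close> matters: \<open>f\<close> vanishes at the origin,
    so on the axis of \<open>w\<close> it is a multiple of the first entry of
    \<open>E2\<close>.\<close>
  have "c * cc2 f = 0" using arg_cong[OF eq(3), of "\<lambda>a. fps_nth a 0"] b by (simp add: fps_X_pow_nth_0)
  then obtain \<phi> where phi: "res_s f = fps_X * \<phi>" using fps_X_dvdE[of "res_s f"] c by auto
  obtain P where P: "res_s (\<pi>2 P) = res_t h" "res_t (\<pi>3 P) = res_t h" "res_s (\<pi>3 P) = res_s h" "res_t (\<pi>1 P) = res_s h"
    by (rule lift_boundary[of "fps_const (cc2 h)" "cc2 h" "res_t h" "res_s h"]) simp_all
  obtain Q where Q: "\<pi>1 Q = in_t \<phi>" "\<pi>2 Q = in_s \<phi>" using lift_w by blast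
  define S where "S = {l. \<exists>r1 r2 r3. l = act r1 E1 + act r2 E2 + act r3 E3}"
  have S: "act r1 E1 + act r2 E2 + act r3 E3 \<in> S" for r1 r2 r3 unfolding S_def by blast
  have "l \<in> S"
  proof (rule generation)
    show "l + act F l' \<in> S" if "l \<in> S" "l' \<in> S" for l l' F
      using that span3_closed unfolding S_def by blast
    show "(sv * tv, 0, 0) \<in> S"
      using S[of 0 v 0] by (simp add: E hom_simps)
    show "(0, sv * tv, 0) \<in> S"
      using S[of 0 0 1] by (simp add: E hom_simps)
    show "(0, 0, sv * tv) \<in> S"
      using S[of "u * v" 0 0] by (simp add: E hom_simps)
    show "act P E1 + act Q E2 + act 0 E3 \<in> S" by (rule S)
    show "same_boundary l (act P E1 + act Q E2 + act 0 E3)"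
      unfolding l' E same_boundary_def
      by (simp add: hom_simps P Q z eq(1,2) tf phi mult_ac)
  qed
  then show "\<exists>r1 r2 r3. l = act r1 E1 + act r2 E2 + act r3 E3" unfolding S_def by blast
qed

text \<open>The middle gluing exponent is \<open>k + 1\<close> while the matrix has
  \<open>u ^ k\<close>: in the second plane \<open>w\<close> times the entry with
  \<open>tv ^ (k + 1)\<close> is cancelled by \<open>u ^ k\<close> times the entry
  \<open>sv * tv\<close> of the third generator. With \<open>k \<ge> 1\<close> all matrix entries
  lie in the maximal ideal.\<close>

lemma presents_theta7:
  assumes c: "c \<noteq> 0" and a: "a \<ge> 1" and k: "k \<ge> 1" and b: "b \<ge> 1"
  shows "presents 3 (theta7 w u v (a, k, b) (- c)) (glue (fps_X ^ a) 1 1 (fps_X ^ (k + 1)) (fps_X ^ b) (fps_const c))"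
proof -
  define M where "M = const2 (inverse c)"
  define e1 e2 e3 :: "'k triple" where "e1 = (M * sv ^ b, tv ^ (k + 1), 1)" and "e2 = (tv, sv ^ (a + 1), 0)"
    and "e3 = (0, sv * tv, 0)"
  let ?L = "glue (fps_X ^ a) 1 1 (fps_X ^ (k + 1)) (fps_X ^ b) (fps_const c)"
  have k1: "k + 1 \<ge> 1" by simp
  note g = generation_mixed[OF c a k1 b e1_def[unfolded M_def] e2_def e3_def refl]
  have z: "(0::'k fps fps) ^ a = 0" "(0::'k fps fps) ^ k = 0" "(0::'k fps fps) ^ b = 0" "(0::'k) ^ a = 0" "(0::'k) ^ k = 0" "(0::'k) ^ b = 0"
    using a k b by auto
  have cM: "const2 c * (M * x) = x" "M * (const2 c * x) = x" for x unfolding M_def using const_cancel[OF c] by simp_all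
  have cM1: "const2 c * M = 1" unfolding M_def using const_inverse[OF c] by simp
  have th: "theta7 w u v (a, k, b) (- c) = mat_of_rows_list 3 [[w, 0, 0], [v ^ b, u, 0], [const3 (- c) * u ^ k, w ^ a, v]]"
    unfolding theta7_def theta5_def by (simp add: transpose_mat3)
  \<comment> \<open>The scalars \<open>- c\<close> and \<open>- 1\<close> are chosen so that the
    relations become exactly the columns of the matrix.\<close>
  define E1 where "E1 = act (const3 (- c)) e1"
  define E3 where "E3 = act (- 1) e3"
  have E1: "E1 = (- (sv ^ b), - (const2 c * tv ^ (k + 1)), - const2 c)"
    unfolding E1_def e1_def by (simp add: cM)
  have E3: "E3 = (0, - (sv * tv), 0)" unfolding E3_def e3_def by (simp add: hom_simps)
  show ?thesis
    unfolding th
  proof (rule presents3I[where ?E1.0 = E1 and ?E2.0 = e2 and ?E3.0 = E3 and \<delta> = 1])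
    show "E1 \<in> ?L" using g(1) c unfolding E1 glue_def e1_def
      by (simp add: hom_simps z M_def mult.commute)
    show "e2 \<in> ?L" by (rule g(2))
    show "E3 \<in> ?L" using g(3) unfolding E3 e3_def glue_def by (simp add: hom_simps)
    show "\<exists>r1 r2 r3. l = act r1 E1 + act r2 e2 + act r3 E3" if l: "l \<in> ?L" for l
    proof -
      obtain r1 r2 r3 where "l = act r1 e1 + act r2 e2 + act r3 e3" using g(4)[OF l] by blast
      moreover have "const3 (- inverse c) * const3 (- c) = 1" using c by (simp add: const3_def)
      then have "e1 = act (const3 (- inverse c)) E1" unfolding E1_def by (simp only: act_mult[symmetric] act_one)
      moreover have "e3 = act (- 1) E3" unfolding E3_def by (simp only: act_mult[symmetric]) simp
      ultimately show ?thesis by (metis act_mult)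
    qed
    show "act w E1 + act (v ^ b) e2 + act (const3 (- c) * u ^ k) E3 = 0"
      unfolding E1 e2_def E3 using b k by (simp add: hom_simps zero_prod_def z mult_ac)
    show "act 0 E1 + act u e2 + act (w ^ a) E3 = 0"
      unfolding E1 e2_def E3 by (simp add: hom_simps zero_prod_def z mult_ac)
    show "act 0 E1 + act 0 e2 + act v E3 = 0"
      unfolding E1 e2_def E3 by (simp add: hom_simps zero_prod_def)
    show "w * (u * v - 0 * w ^ a) - 0 * (v ^ b * v - 0 * (const3 (- c) * u ^ k)) +
        0 * (v ^ b * w ^ a - u * (const3 (- c) * u ^ k)) = 1 * (u * v * w)" by (simp add: mult_ac)
    fix r1 r2 r3 assume "act r1 E1 + act r2 e2 + act r3 E3 = 0"
    then have 0: "tv * \<pi>1 r2 = sv ^ b * \<pi>1 r1" "const2 c * \<pi>3 r1 = 0"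
      "sv ^ (a + 1) * \<pi>2 r2 = const2 c * tv ^ (k + 1) * \<pi>2 r1 + sv * tv * \<pi>2 r3"
      unfolding E1 e2_def E3 by (simp_all add: zero_prod_def mult_ac diff_eq_eq eq_diff_eq add_eq_0_iff)
    have 1: "\<pi>3 r1 = 0" using 0(2) cM1 by auto
    let ?K = "\<lambda>\<pi>. adjugate_kills \<pi> w 0 0 (v ^ b) u 0 (const3 (- c) * u ^ k) (w ^ a) v r1 r2 r3"
    have "?K \<pi>1"
    proof -
      \<comment> \<open>The relation in the first plane, multiplied by s and by t^a, gives the
        products that occur in the rows of the adjugate there.\<close>
      have "sv ^ b * sv * \<pi>1 r1 = tv * sv * \<pi>1 r2" "sv ^ b * tv ^ a * \<pi>1 r1 = tv * tv ^ a * \<pi>1 r2"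
        by (rule scale_eq[OF 0(1)[symmetric]])+
      then show ?thesis unfolding adjugate_kills_def by (simp add: hom_simps z algebra_simps)
    qed
    moreover have "?K \<pi>2" unfolding adjugate_kills_def using 0(3) by (simp add: hom_simps z algebra_simps)
    moreover have "?K \<pi>3" unfolding adjugate_kills_def by (simp add: hom_simps z 1)
    ultimately show "\<forall>\<pi>\<in>{\<pi>1, \<pi>2, \<pi>3}. ?K \<pi>" by blast
  qed (simp_all add: hom_simps z)
qed

text \<open>For middle exponent 1 the third generator is redundant: \<open>e3\<close> equals
  \<open>w\<close> times \<open>e1\<close> minus \<open>v ^ b\<close> times \<open>e2\<close>
  divided by \<open>c\<close>. The determinant of the remaining two-by-two matrix is
  \<open>c\<close> times \<open>u * v * w\<close>, so \<open>\<delta>\<close> is the constant series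
  \<open>c\<close>.\<close>

lemma presents_theta2:
  assumes c: "c \<noteq> 0" and a: "a \<ge> 1" and b: "b \<ge> 1"
  shows "presents 2 (theta2 u w v (a, b) c) (glue (fps_X ^ a) 1 1 (fps_X ^ 1) (fps_X ^ b) (fps_const c))"
proof -
  define M where "M = const2 (inverse c)"
  define e1 e2 e3 :: "'k triple" where "e1 = (M * sv ^ b, tv ^ 1, 1)" and "e2 = (tv, sv ^ (a + 1), 0)"
    and "e3 = (0, sv * tv, 0)"
  let ?L = "glue (fps_X ^ a) 1 1 (fps_X ^ 1) (fps_X ^ b) (fps_const c)"
  note g = generation_mixed[OF c a order_refl b e1_def[unfolded M_def] e2_def e3_def refl]
  have z: "(0::'k fps fps) ^ a = 0" "(0::'k fps fps) ^ b = 0" "(0::'k) ^ a = 0" "(0::'k) ^ b = 0"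
    using a b by auto
  have cM: "const2 c * (M * x) = x" "M * (const2 c * x) = x" for x unfolding M_def using const_cancel[OF c] by simp_all
  have cM1: "const2 c * M = 1" unfolding M_def using const_inverse[OF c] by simp
  have th: "theta2 u w v (a, b) c = mat_of_rows_list 2 [[const3 c * u + w ^ a * v ^ b, v ^ (b + 1)], [w ^ (a + 1), w * v]]"
    unfolding theta2_def by simp
  define E2 where "E2 = act (const3 (- c)) e1"
  have E2: "E2 = (- (sv ^ b), - (const2 c * tv), - const2 c)"
    unfolding E2_def e1_def by (simp add: cM)
  show ?thesis
    unfolding th
  proof (rule presents2I[where ?E1.0 = e2 and ?E2.0 = E2 and \<delta> = "const3 c"])
    show "E2 \<in> ?L" using g(1) c unfolding E2 glue_def e1_def
      by (simp add: hom_simps z M_def mult.commute)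
    show "e2 \<in> ?L" by (rule g(2))
    show "\<exists>r1 r2. l = act r1 e2 + act r2 E2" if l: "l \<in> ?L" for l
    proof -
      obtain r1 r2 r3 where l': "l = act r1 e1 + act r2 e2 + act r3 e3" using g(4)[OF l] by blast
      have "const3 (- inverse c) * const3 (- c) = 1" using c by (simp add: const3_def)
      then have e1: "e1 = act (const3 (- inverse c)) E2" unfolding E2_def by (simp only: act_mult[symmetric] act_one)
      have e3: "e3 = act w e1 + act (- (const3 (inverse c) * v ^ b)) e2"
        unfolding e1_def e2_def e3_def by (simp add: hom_simps z M_def mult_ac)
      have "l = act (r2 + r3 * - (const3 (inverse c) * v ^ b)) e2 + act ((r1 + r3 * w) * const3 (- inverse c)) E2"
        unfolding l' e3 act_add_left act_add act_mult e1[symmetric] by (simp add: add_ac)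
      then show ?thesis by blast
    qed
    show "act (const3 c * u + w ^ a * v ^ b) e2 + act (w ^ (a + 1)) E2 = 0"
      unfolding E2 e2_def by (simp add: hom_simps zero_prod_def z mult_ac)
    show "act (v ^ (b + 1)) e2 + act (w * v) E2 = 0"
      unfolding E2 e2_def by (simp add: hom_simps zero_prod_def z mult_ac)
    show "(const3 c * u + w ^ a * v ^ b) * (w * v) - v ^ (b + 1) * w ^ (a + 1) = const3 c * (u * v * w)"
      by (simp add: algebra_simps)
    fix r1 r2 assume "act r1 e2 + act r2 E2 = 0"
    then have 0: "tv * \<pi>1 r1 = sv ^ b * \<pi>1 r2" "const2 c * \<pi>3 r2 = 0"
      "sv ^ (a + 1) * \<pi>2 r1 = const2 c * tv * \<pi>2 r2"
      unfolding E2 e2_def by (simp_all add: zero_prod_def mult_ac)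
    have 1: "\<pi>3 r2 = 0" using 0(2) cM1 by auto
    have 2: "tv * sv * \<pi>1 r1 = sv ^ b * sv * \<pi>1 r2" "tv * tv ^ a * \<pi>1 r1 = sv ^ b * tv ^ a * \<pi>1 r2"
      by (rule scale_eq[OF 0(1)])+
    show "\<pi>1 (w * v * r1 - v ^ (b + 1) * r2) = 0 \<and> \<pi>2 (w * v * r1 - v ^ (b + 1) * r2) = 0 \<and> \<pi>3 (w * v * r1 - v ^ (b + 1) * r2) = 0 \<and>
      \<pi>1 ((const3 c * u + w ^ a * v ^ b) * r2 - w ^ (a + 1) * r1) = 0 \<and>
      \<pi>2 ((const3 c * u + w ^ a * v ^ b) * r2 - w ^ (a + 1) * r1) = 0 \<and>
      \<pi>3 ((const3 c * u + w ^ a * v ^ b) * r2 - w ^ (a + 1) * r1) = 0"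
      using 0(3) 2 1 by (simp add: hom_simps z mult_ac)
  qed (use c in \<open>simp_all add: hom_simps z\<close>)
qed

text \<open>With no negative exponent every member vanishes at the origin, apart from the regular
  case. Each generator is supported on two planes and carries the values on their common axis. These
  values are multiples of the axis variable, which raises each gluing exponent by one in the matrix,
  so exponent zero is allowed here.\<close>

lemma presents_theta4:
  assumes c: "c \<noteq> 0" and nreg: "a \<noteq> 0 \<or> k \<noteq> 0 \<or> b \<noteq> 0 \<or> c \<noteq> 1"
  shows "presents 3 (theta4 u w v (k + 1, a + 1, b + 1) (- inverse c)) (glue (fps_X ^ a) 1 (fps_X ^ k) 1 (fps_X ^ b) (fps_const c))"
proof -
  define M where "M = const2 (inverse c)"
  define E1 E2 E3 :: "'k triple" where "E1 = (tv, sv ^ (a + 1), 0)" and "E2 = (- (sv ^ (b + 1)), 0, - (const2 c * tv))"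
    and "E3 = (0, const2 c * tv, const2 c * sv ^ (k + 1))"
  let ?L = "glue (fps_X ^ a) 1 (fps_X ^ k) 1 (fps_X ^ b) (fps_const c)"
  have cM: "const2 c * (M * x) = x" "M * (const2 c * x) = x" for x unfolding M_def using const_cancel[OF c] by simp_all
  have cM1: "const2 c * M = 1" "M * const2 c = 1" unfolding M_def using const_inverse[OF c] by (simp_all add: mult.commute)
  have rM: "res_s M = fps_const (inverse c)" "res_t M = fps_const (inverse c)" unfolding M_def by simp_all
  have neg: "const2 (inverse c) = M" by (simp add: M_def)
  let ?n = "const3 (- inverse c)"
  have th: "theta4 u w v (k + 1, a + 1, b + 1) x = mat_of_rows_list 3 [[u, v ^ (b + 1), 0], [0, w, u ^ (k + 1)], [const3 x * w ^ (a + 1), 0, v]]" for x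
    unfolding theta4_def by simp
  \<comment> \<open>The determinant is \<open>u * v * w\<close> times this factor. Its constant term
    is 1, except that it is \<open>1 - 1 / c\<close> if all three exponents are zero; the excluded
    regular case is exactly the one in which it is not a unit.\<close>
  define \<delta> where "\<delta> = 1 + ?n * u ^ k * v ^ b * w ^ a"
  have cc\<delta>: "cc \<delta> \<noteq> 0"
    unfolding \<delta>_def using nreg c by (auto simp: hom_simps power_0_left inverse_eq_1_iff eq_neg_iff_add_eq_0)
  show ?thesis
    unfolding th
  proof (rule presents3I[where ?E1.0 = E1 and ?E2.0 = E2 and ?E3.0 = E3, OF _ _ _ _ _ _ _ _ _ _ _ _ _ _ _ _ cc\<delta>])
    show "E1 \<in> ?L" unfolding E1_def glue_def by (simp add: hom_simps)
    show "E2 \<in> ?L" unfolding E2_def glue_def by (simp add: hom_simps mult_ac)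
    show "E3 \<in> ?L" unfolding E3_def glue_def by (simp add: hom_simps mult_ac)
    show "\<exists>r1 r2 r3. l = act r1 E1 + act r2 E2 + act r3 E3" if l: "l \<in> ?L" for l
    proof -
      obtain f g h where l': "l = (f, g, h)" by (cases l)
      have eq: "fps_X ^ a * res_s f = res_t g" "fps_X ^ k * res_s g = res_t h" "fps_X ^ b * res_s h = fps_const c * res_t f"
        using l unfolding l' glue_def by simp_all
      \<comment> \<open>Followed once around the cycle, the value of \<open>f\<close> at the origin
        returns divided by \<open>c\<close> if all exponents are zero, and as zero otherwise. In
        both cases it must vanish.\<close>
      have nth: "cc2 g = (if a = 0 then cc2 f else 0)" "cc2 h = (if k = 0 then cc2 g else 0)"
        "c * cc2 f = (if b = 0 then cc2 h else 0)"
        using arg_cong[OF eq(1), of "\<lambda>a. fps_nth a 0"] arg_cong[OF eq(2), of "\<lambda>a. fps_nth a 0"]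
          arg_cong[OF eq(3), of "\<lambda>a. fps_nth a 0"] by (auto simp: fps_X_pow_nth_0 split: if_splits)
      have "cc2 f = 0"
      proof (cases "a = 0 \<and> k = 0 \<and> b = 0")
        case True
        then have "(c - 1) * cc2 f = 0" using nth by (simp add: algebra_simps)
        then show ?thesis using nreg True by simp
      next
        case False
        then show ?thesis using nth c by (auto split: if_splits)
      qed
      then have zero: "cc2 f = 0" "cc2 g = 0" "cc2 h = 0" using nth by (simp_all split: if_splits)
      obtain \<phi> where phi: "res_s f = fps_X * \<phi>" using fps_X_dvdE[of "res_s f"] zero by auto
      obtain \<chi> where chi: "res_s g = fps_X * \<chi>" using fps_X_dvdE[of "res_s g"] zero by auto
      obtain \<psi> where psi: "res_s h = fps_X * \<psi>" using fps_X_dvdE[of "res_s h"] zero by auto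
      have tf: "res_t f = fps_const (inverse c) * (fps_X ^ b * res_s h)" unfolding eq(3) by (simp add: const_cancel c)
      \<comment> \<open>The quotient of each axis value by its variable is lifted from the axis; up
        to a scalar it is the coefficient of the generator that belongs to this axis.\<close>
      obtain P where P: "\<pi>1 P = in_t \<phi>" "\<pi>2 P = in_s \<phi>" using lift_w by blast
      obtain Q where Q: "\<pi>3 Q = in_t \<psi>" "\<pi>1 Q = in_s \<psi>" using lift_v by blast
      obtain R where R: "\<pi>2 R = in_t \<chi>" "\<pi>3 R = in_s \<chi>" using lift_u by blast
      define S where "S = {l. \<exists>r1 r2 r3. l = act r1 E1 + act r2 E2 + act r3 E3}"
      have S: "act r1 E1 + act r2 E2 + act r3 E3 \<in> S" for r1 r2 r3 unfolding S_def by blast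
      have "l \<in> S"
      proof (rule generation)
        show "l + act F l' \<in> S" if "l \<in> S" "l' \<in> S" for l l' F
          using that span3_closed unfolding S_def by blast
        show "(sv * tv, 0, 0) \<in> S"
          using S[of v 0 0] by (simp add: E1_def E2_def E3_def hom_simps)
        show "(0, sv * tv, 0) \<in> S"
          using S[of 0 0 "const3 (inverse c) * w"] cM(2)
          by (simp add: E1_def E2_def E3_def hom_simps mult.assoc neg mult.left_commute[of sv])
        show "(0, 0, sv * tv) \<in> S"
          using S[of 0 "?n * u" 0] cM(2)
          by (simp add: E1_def E2_def E3_def hom_simps neg mult.assoc mult.left_commute[of sv])
        show "act P E1 + act (?n * Q) E2 + act (const3 (inverse c) * R) E3 \<in> S" by (rule S)
        have cMx: "M * (x * (const2 c * y)) = x * y" for x y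
          by (subst mult.left_commute) (simp add: cM)
        have l0: "act P E1 + act (?n * Q) E2 + act (const3 (inverse c) * R) E3 =
          (in_t \<phi> * tv + M * (in_s \<psi> * sv ^ (b + 1)), in_s \<phi> * sv ^ (a + 1) + in_t \<chi> * tv,
            in_t \<psi> * tv + in_s \<chi> * sv ^ (k + 1))"
          unfolding E1_def E2_def E3_def by (simp add: P Q R p1.hom_mult p2.hom_mult p3.hom_mult neg mult.assoc cMx)
        show "same_boundary l (act P E1 + act (?n * Q) E2 + act (const3 (inverse c) * R) E3)"
          unfolding l' l0 same_boundary_def
          by (simp add: hom_simps rM tf phi chi psi eq(1,2)[symmetric] mult_ac)
      qed
      then show ?thesis unfolding S_def by blast
    qed
    show "act u E1 + act 0 E2 + act (?n * w ^ (a + 1)) E3 = 0"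
      unfolding E1_def E2_def E3_def by (simp add: hom_simps zero_prod_def neg mult.assoc mult.left_commute[of _ "const2 c"] cM)
    show "act (v ^ (b + 1)) E1 + act w E2 + act 0 E3 = 0"
      unfolding E1_def E2_def E3_def by (simp add: hom_simps zero_prod_def mult_ac)
    show "act 0 E1 + act (u ^ (k + 1)) E2 + act v E3 = 0"
      unfolding E1_def E2_def E3_def by (simp add: hom_simps zero_prod_def mult_ac)
    show "u * (w * v - u ^ (k + 1) * 0) - v ^ (b + 1) * (0 * v - u ^ (k + 1) * (?n * w ^ (a + 1))) +
        0 * (0 * 0 - w * (?n * w ^ (a + 1))) = \<delta> * (u * v * w)"
      unfolding \<delta>_def by (simp add: algebra_simps)
    fix r1 r2 r3 assume "act r1 E1 + act r2 E2 + act r3 E3 = 0"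
    then have "tv * \<pi>1 r1 = sv ^ (b + 1) * \<pi>1 r2" "const2 c * (sv ^ (k + 1) * \<pi>3 r3) = const2 c * (tv * \<pi>3 r2)"
      "sv ^ (a + 1) * \<pi>2 r1 = - const2 c * (tv * \<pi>2 r3)"
      unfolding E1_def E2_def E3_def by (simp_all add: zero_prod_def mult_ac add_eq_0_iff)
    moreover have "const2 c \<noteq> 0" using cM1 by auto
    moreover have "tv * \<pi>2 r3 = - M * (- const2 c * (tv * \<pi>2 r3))" by (simp add: cM)
    ultimately have 0: "tv * \<pi>1 r1 = sv ^ (b + 1) * \<pi>1 r2" "tv * \<pi>3 r2 = sv ^ (k + 1) * \<pi>3 r3"
      "tv * \<pi>2 r3 = - M * sv ^ (a + 1) * \<pi>2 r1"
      by (simp_all only: mult_cancel_left mult.assoc, simp_all)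
    let ?K = "\<lambda>\<pi>. adjugate_kills \<pi> u (v ^ (b + 1)) 0 0 w (u ^ (k + 1)) (?n * w ^ (a + 1)) 0 v r1 r2 r3"
    have "?K \<pi>1"
    proof -
      have "tv * sv * \<pi>1 r1 = sv ^ (b + 1) * sv * \<pi>1 r2" "tv * (M * tv ^ (a + 1)) * \<pi>1 r1 = sv ^ (b + 1) * (M * tv ^ (a + 1)) * \<pi>1 r2"
        by (rule scale_eq[OF 0(1)])+
      then show ?thesis unfolding adjugate_kills_def by (simp add: hom_simps neg algebra_simps)
    qed
    moreover have "?K \<pi>2"
    proof -
      have "tv * sv * \<pi>2 r3 = - M * sv ^ (a + 1) * sv * \<pi>2 r1" "tv * tv ^ (k + 1) * \<pi>2 r3 = - M * sv ^ (a + 1) * tv ^ (k + 1) * \<pi>2 r1"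
        by (rule scale_eq[OF 0(3)])+
      then show ?thesis unfolding adjugate_kills_def by (simp add: hom_simps neg algebra_simps)
    qed
    moreover have "?K \<pi>3"
    proof -
      have "tv * tv ^ (b + 1) * \<pi>3 r2 = sv ^ (k + 1) * tv ^ (b + 1) * \<pi>3 r3" "tv * sv * \<pi>3 r2 = sv ^ (k + 1) * sv * \<pi>3 r3"
        by (rule scale_eq[OF 0(2)])+
      then show ?thesis unfolding adjugate_kills_def by (simp add: hom_simps neg algebra_simps)
    qed
    ultimately show "\<forall>\<pi>\<in>{\<pi>1, \<pi>2, \<pi>3}. ?K \<pi>" by blast
  qed (simp_all add: hom_simps)
qed

end

section \<open>The ring \<open>k[[x,y,z]]/(xyz)\<close>\<close>

lemma ring_of_type_algebra_simps [simp]: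
  "carrier ring_of_type_algebra = UNIV" "x \<otimes>\<^bsub>ring_of_type_algebra\<^esub> y = x * y"
  "x \<oplus>\<^bsub>ring_of_type_algebra\<^esub> y = x + y" "\<zero>\<^bsub>ring_of_type_algebra\<^esub> = 0" "\<one>\<^bsub>ring_of_type_algebra\<^esub> = 1"
  by (simp_all add: ring_of_type_algebra_def)

lemma xyz_ideal_iff: "f \<in> xyz_ideal \<longleftrightarrow> var_x * var_y * var_z dvd f"
proof -
  interpret cring "ring_of_type_algebra :: 'a fps3 ring" by (rule cring_from_type_algebra)
  have "xyz_ideal = PIdl\<^bsub>ring_of_type_algebra\<^esub> (var_x * var_y * var_z :: 'a fps3)"
    unfolding xyz_ideal_def by (rule cgenideal_eq_genideal[symmetric]) simp
  then show ?thesis by (auto simp: cgenideal_def dvd_def mult.commute)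
qed

lemma ideal_xyz: "ideal (xyz_ideal :: 'k::field fps3 set) ring_of_type_algebra"
proof -
  interpret cring "ring_of_type_algebra :: 'k fps3 ring" by (rule cring_from_type_algebra)
  show ?thesis unfolding xyz_ideal_def by (rule genideal_ideal) simp
qed

lemma cring_xyz: "cring (xyz_ring :: 'k::field fps3 set ring)"
  unfolding xyz_ring_def by (rule ideal.quotient_is_cring[OF ideal_xyz cring_from_type_algebra])

lemma xyz_class_hom: "xyz_class \<in> Ring.ring_hom ring_of_type_algebra xyz_ring"
  unfolding xyz_class_def xyz_ring_def by (rule ideal.rcos_ring_hom[OF ideal_xyz])

lemma xyz_class_simps:
  fixes f g :: "'k::field fps3"
  shows
  "xyz_class f \<in> carrier xyz_ring"
  "xyz_class f \<oplus>\<^bsub>xyz_ring\<^esub> xyz_class g = xyz_class (f + g)"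
  "xyz_class f \<otimes>\<^bsub>xyz_ring\<^esub> xyz_class g = xyz_class (f * g)"
  "\<one>\<^bsub>xyz_ring\<^esub> = xyz_class (1 :: 'k fps3)"
  using Ring.ring_hom_closed[OF xyz_class_hom, of f] Ring.ring_hom_add[OF xyz_class_hom, of f g]
    Ring.ring_hom_mult[OF xyz_class_hom, of f g]
    Ring.ring_hom_one[OF xyz_class_hom[where 'a = 'k]]
  by simp_all

lemma carrier_xyz: "carrier xyz_ring = range xyz_class"
  unfolding xyz_ring_def xyz_class_def by (auto simp: FactRing_def A_RCOSETS_def')

lemma xyz_classE: assumes "r \<in> carrier xyz_ring" obtains F where "r = xyz_class F"
  using assms unfolding carrier_xyz by blast

lemma xyz_class_zero: "\<zero>\<^bsub>xyz_ring\<^esub> = xyz_class (0 :: 'k::field fps3)"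
proof -
  interpret R: cring "xyz_ring :: 'k fps3 set ring" by (rule cring_xyz)
  have "xyz_class (0 :: 'k fps3) \<oplus>\<^bsub>xyz_ring\<^esub> xyz_class 0 = \<zero>\<^bsub>xyz_ring\<^esub> \<oplus>\<^bsub>xyz_ring\<^esub> xyz_class 0"
    by (simp add: xyz_class_simps)
  then have "xyz_class (0 :: 'k fps3) = \<zero>\<^bsub>xyz_ring\<^esub>"
    using R.add.right_cancel[of "xyz_class (0 :: 'k fps3)" "xyz_class (0 :: 'k fps3)" "\<zero>\<^bsub>xyz_ring\<^esub>"]
    by (simp add: xyz_class_simps(1))
  then show ?thesis by (rule sym)
qed

lemma xyz_class_eq_iff: "xyz_class f = xyz_class g \<longleftrightarrow> var_x * var_y * var_z dvd f - g"
proof -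
  interpret I: ideal xyz_ideal "ring_of_type_algebra :: 'a fps3 ring" by (rule ideal_xyz)
  have coset: "xyz_class f = {h + f | h. h \<in> xyz_ideal}" for f :: "'a fps3"
    unfolding xyz_class_def a_r_coset_def' by auto
  show ?thesis
  proof
    assume eq: "xyz_class f = xyz_class g"
    have "0 + f \<in> xyz_class f" unfolding coset by (intro CollectI exI[of _ 0]) (simp add: xyz_ideal_iff)
    then have "f \<in> xyz_class g" using eq by simp
    then show "var_x * var_y * var_z dvd f - g" unfolding coset by (auto simp flip: xyz_ideal_iff)
  next
    assume *: "var_x * var_y * var_z dvd f - g"
    have "h + f \<in> xyz_class g" if "h \<in> xyz_ideal" for h
      unfolding coset using * that by (intro CollectI exI[of _ "h + (f - g)"]) (simp add: xyz_ideal_iff)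
    moreover have "h + g \<in> xyz_class f" if "h \<in> xyz_ideal" for h
      unfolding coset using * that by (intro CollectI exI[of _ "h - (f - g)"]) (simp add: xyz_ideal_iff)
    ultimately show "xyz_class f = xyz_class g" unfolding coset by blast
  qed
qed

subsection \<open>Prime ideals\<close>

text \<open>Prime ideals of the quotient are handled through their preimages, plain sets of power
  series that contain \<open>xyz\<close>; this keeps coset arithmetic out of the arguments about
  primes.\<close>

definition ideal_set :: "'a::comm_ring_1 set \<Rightarrow> bool" where
  "ideal_set J \<longleftrightarrow> 0 \<in> J \<and> (\<forall>a\<in>J. \<forall>b\<in>J. a + b \<in> J) \<and> (\<forall>a. \<forall>b\<in>J. a * b \<in> J)"

definition prime_set :: "'a::comm_ring_1 set \<Rightarrow> bool" where
  "prime_set J \<longleftrightarrow> ideal_set J \<and> 1 \<notin> J \<and> (\<forall>a b. a * b \<in> J \<longrightarrow> a \<in> J \<or> b \<in> J)"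

lemma ideal_set_diff: "ideal_set J \<Longrightarrow> a \<in> J \<Longrightarrow> b \<in> J \<Longrightarrow> a - b \<in> J"
  unfolding ideal_set_def by (metis add_uminus_conv_diff mult_minus1)

lemma prime_set_kernel:
  fixes h :: "'a::comm_ring_1 \<Rightarrow> 'b::idom"
  assumes "comm_ring_hom h" shows "prime_set {f. h f = 0}"
proof -
  interpret comm_ring_hom h by fact
  show ?thesis unfolding prime_set_def ideal_set_def by (auto simp: hom_add hom_mult)
qed

text \<open>An ideal that is maximal among those containing I and missing all powers of
  \<open>a\<close> is prime. Applied to an annihilator, this will produce a power of
  \<open>a\<close> that kills a given element of M.\<close>

lemma ex_prime_set:
  fixes I :: "'a::comm_ring_1 set"
  assumes I: "ideal_set I" and a: "\<And>n. a ^ n \<notin> I"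
  shows "\<exists>J. prime_set J \<and> I \<subseteq> J \<and> a \<notin> J"
proof -
  define \<A> where "\<A> = {J. ideal_set J \<and> I \<subseteq> J \<and> (\<forall>n. a ^ n \<notin> J)}"
  have "\<exists>J\<in>\<A>. \<forall>K\<in>\<A>. J \<subseteq> K \<longrightarrow> K = J"
  proof (rule subset_Zorn_nonempty)
    show "\<A> \<noteq> {}" using I a unfolding \<A>_def by blast
    fix \<C> assume C: "\<C> \<noteq> {}" "subset.chain \<A> \<C>"
    have sub: "\<C> \<subseteq> \<A>" and lin: "\<And>J K. J \<in> \<C> \<Longrightarrow> K \<in> \<C> \<Longrightarrow> J \<subseteq> K \<or> K \<subseteq> J"
      using C(2) unfolding subset.chain_def by auto
    have id: "ideal_set J" "I \<subseteq> J" "\<And>n. a ^ n \<notin> J" if "J \<in> \<C>" for J using that sub unfolding \<A>_def by auto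
    have "ideal_set (\<Union>\<C>)"
      unfolding ideal_set_def
    proof (intro conjI ballI allI)
      show "0 \<in> \<Union>\<C>" using C(1) id(1) unfolding ideal_set_def by blast
      show "b * c \<in> \<Union>\<C>" if "c \<in> \<Union>\<C>" for b c using that id(1) unfolding ideal_set_def by blast
      fix b c assume "b \<in> \<Union>\<C>" "c \<in> \<Union>\<C>"
      then obtain J K where JK: "J \<in> \<C>" "K \<in> \<C>" "b \<in> J" "c \<in> K" by blast
      then obtain T where T: "T \<in> \<C>" "b \<in> T" "c \<in> T" using lin by blast
      then show "b + c \<in> \<Union>\<C>" using id(1)[OF T(1)] unfolding ideal_set_def by blast
    qed
    moreover have "I \<subseteq> \<Union>\<C>" using C(1) id(2) by blast
    moreover have "\<forall>n. a ^ n \<notin> \<Union>\<C>" using id(3) by blast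
    ultimately show "\<Union>\<C> \<in> \<A>" unfolding \<A>_def by blast
  qed
  then obtain J where J: "J \<in> \<A>" and max: "\<And>K. K \<in> \<A> \<Longrightarrow> J \<subseteq> K \<Longrightarrow> K = J" by blast
  have Ji: "ideal_set J" "I \<subseteq> J" "\<And>n. a ^ n \<notin> J" using J unfolding \<A>_def by auto
  have J0: "0 \<in> J" and Jadd: "\<And>b c. b \<in> J \<Longrightarrow> c \<in> J \<Longrightarrow> b + c \<in> J" and Jmult: "\<And>b c. c \<in> J \<Longrightarrow> b * c \<in> J"
    using Ji(1) unfolding ideal_set_def by auto
  \<comment> \<open>Maximality of J: adjoining any \<open>b\<close> outside J brings in a power of
    \<open>a\<close>. For a product in J with neither factor in J, multiplying the two resulting
    expressions would put a power of \<open>a\<close> into J.\<close>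
  have pow: "\<exists>n c j. j \<in> J \<and> a ^ n = j + c * b" if b: "b \<notin> J" for b
  proof -
    define K where "K = {j + c * b | j c. j \<in> J}"
    have "ideal_set K"
      unfolding ideal_set_def
    proof (intro conjI ballI allI)
      show "0 \<in> K" unfolding K_def using J0 by (intro CollectI exI[of _ 0]) simp
    next
      fix p q assume "p \<in> K" "q \<in> K"
      then obtain j c j' c' where "p = j + c * b" "q = j' + c' * b" "j \<in> J" "j' \<in> J" unfolding K_def by blast
      then show "p + q \<in> K" unfolding K_def
        by (intro CollectI exI[of _ "j + j'"] exI[of _ "c + c'"]) (simp add: algebra_simps Jadd)
    next
      fix p q assume "q \<in> K"
      then obtain j c where "q = j + c * b" "j \<in> J" unfolding K_def by blast
      then show "p * q \<in> K" unfolding K_def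
        by (intro CollectI exI[of _ "p * j"] exI[of _ "p * c"]) (simp add: distrib_left mult.assoc Jmult)
    qed
    moreover have JK: "J \<subseteq> K"
    proof
      fix j assume "j \<in> J"
      then show "j \<in> K" unfolding K_def by (intro CollectI exI[of _ j] exI[of _ 0]) simp
    qed
    moreover have "b \<in> K" unfolding K_def using J0 by (intro CollectI exI[of _ 0] exI[of _ 1]) simp
    then have "K \<noteq> J" using b by blast
    ultimately have "K \<notin> \<A>" using max by blast
    then obtain n where "a ^ n \<in> K" using \<open>ideal_set K\<close> JK Ji(2) unfolding \<A>_def by blast
    then show ?thesis unfolding K_def by blast
  qed
  have "b \<in> J \<or> c \<in> J" if bc: "b * c \<in> J" for b c
  proof (rule ccontr)
    assume "\<not> (b \<in> J \<or> c \<in> J)"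
    then have bJ: "b \<notin> J" and cJ: "c \<notin> J" by auto
    obtain n p j where 1: "j \<in> J" "a ^ n = j + p * b" using pow[OF bJ] by (elim exE conjE) (rule that)
    obtain m q i where 2: "i \<in> J" "a ^ m = i + q * c" using pow[OF cJ] by (elim exE conjE) (rule that)
    have "a ^ (n + m) = (j + p * b) * (i + q * c)" unfolding power_add 1 2 ..
    also have "\<dots> = (j + p * b) * i + (q * c) * j + (p * q) * (b * c)" by (simp add: algebra_simps)
    also have "\<dots> \<in> J" by (intro Jadd Jmult bc 1(1) 2(1))
    finally show False using Ji(3) by simp
  qed
  then have "prime_set J" unfolding prime_set_def using Ji(1) Ji(3)[of 0] by simp
  then show ?thesis using Ji(2) Ji(3)[of 1] by (intro exI[of _ J]) simp
qed

text \<open>A set J containing \<open>xyz\<close> and closed under these operations is a union of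
  classes, so passing to classes loses nothing.\<close>

lemma class_image_mem_iff:
  assumes J: "ideal_set J" and xyz: "var_x * var_y * var_z \<in> J"
  shows "xyz_class f \<in> xyz_class ` J \<longleftrightarrow> f \<in> J"
proof
  assume "xyz_class f \<in> xyz_class ` J"
  then obtain g where g: "xyz_class f = xyz_class g" "g \<in> J" by (rule imageE)
  then have "var_x * var_y * var_z dvd f - g" by (simp only: xyz_class_eq_iff)
  then obtain h where "f - g = var_x * var_y * var_z * h" by (rule dvdE)
  then have "f = h * (var_x * var_y * var_z) + g" by (simp add: diff_eq_eq mult.commute)
  moreover have "h * (var_x * var_y * var_z) \<in> J" using J xyz unfolding ideal_set_def by simp
  ultimately show "f \<in> J" using J g(2) unfolding ideal_set_def by simp
qed simp

lemma ideal_class_image: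
  fixes J :: "'k::field fps3 set"
  assumes J: "ideal_set J" shows "ideal (xyz_class ` J) xyz_ring"
proof -
  interpret cring "xyz_ring :: 'k fps3 set ring" by (rule cring_xyz)
  show ?thesis
  proof (rule idealI)
    show "subgroup (xyz_class ` J) (add_monoid xyz_ring)"
    proof
      show "xyz_class ` J \<subseteq> carrier (add_monoid xyz_ring)" by (auto simp: xyz_class_simps)
      show "x \<otimes>\<^bsub>add_monoid xyz_ring\<^esub> y \<in> xyz_class ` J" if "x \<in> xyz_class ` J" "y \<in> xyz_class ` J" for x y
        using that J unfolding ideal_set_def by (auto simp: xyz_class_simps)
      show "\<one>\<^bsub>add_monoid xyz_ring\<^esub> \<in> xyz_class ` J" using J unfolding ideal_set_def by (simp add: xyz_class_zero)
      show "inv\<^bsub>add_monoid xyz_ring\<^esub> x \<in> xyz_class ` J" if x: "x \<in> xyz_class ` J" for x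
      proof -
        obtain f where f: "x = xyz_class f" "f \<in> J" using x by (rule imageE)
        have "- f \<in> J" using ideal_set_diff[OF J, of 0 f] f J unfolding ideal_set_def by simp
        moreover have "inv\<^bsub>add_monoid xyz_ring\<^esub> x = xyz_class (- f)"
          unfolding f a_inv_def[symmetric]
          by (rule minus_equality) (simp_all add: xyz_class_simps xyz_class_zero)
        ultimately show ?thesis by simp
      qed
    qed
    fix a x :: "'k fps3 set" assume ax: "a \<in> xyz_class ` J" "x \<in> carrier xyz_ring"
    obtain f where f: "a = xyz_class f" "f \<in> J" using ax(1) by (rule imageE)
    obtain g where g: "x = xyz_class g" using ax(2) by (rule xyz_classE)
    have "g * f \<in> J" using J f(2) unfolding ideal_set_def by simp
    then show "x \<otimes>\<^bsub>xyz_ring\<^esub> a \<in> xyz_class ` J" "a \<otimes>\<^bsub>xyz_ring\<^esub> x \<in> xyz_class ` J"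
      unfolding f g xyz_class_simps by (simp_all add: mult.commute)
  qed (rule ring_axioms)
qed

lemma primeideal_class_image:
  fixes J :: "'k::field fps3 set"
  assumes J: "prime_set J" and xyz: "var_x * var_y * var_z \<in> J"
  shows "primeideal (xyz_class ` J) xyz_ring"
proof (rule primeidealI)
  have Ji: "ideal_set J" using J unfolding prime_set_def by simp
  note iff = class_image_mem_iff[OF Ji xyz]
  show "ideal (xyz_class ` J) xyz_ring" by (rule ideal_class_image[OF Ji])
  have "xyz_class 1 \<notin> xyz_class ` J" using J unfolding prime_set_def iff by simp
  then show "carrier xyz_ring \<noteq> xyz_class ` J" using xyz_class_simps(1)[of 1] by auto
  fix a b :: "'k fps3 set"
  assume ab: "a \<in> carrier xyz_ring" "b \<in> carrier xyz_ring" "a \<otimes>\<^bsub>xyz_ring\<^esub> b \<in> xyz_class ` J"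
  obtain f g where fg: "a = xyz_class f" "b = xyz_class g"
    using ab(1,2) by (elim xyz_classE)
  have "f * g \<in> J" using ab(3) unfolding fg xyz_class_simps iff .
  then show "a \<in> xyz_class ` J \<or> b \<in> xyz_class ` J" using J unfolding prime_set_def fg iff by simp
qed (rule cring_xyz)

definition max_set :: "'k::field fps3 set" where "max_set = {f. cc f = 0}"

lemma prime_max_set: "prime_set max_set"
  unfolding max_set_def by (rule prime_set_kernel) (rule cc.comm_ring_hom_axioms)

lemma xyz_in_max_set: "var_x * var_y * var_z \<in> max_set"
  unfolding max_set_def by (simp add: cc.hom_mult)

text \<open>The ring is local: a class with nonzero constant term is a unit, so it lies in no proper
  ideal.\<close>

lemma proper_ideal_subset_max:
  assumes J: "ideal J xyz_ring" "J \<noteq> carrier xyz_ring" shows "J \<subseteq> xyz_class ` max_set"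
proof
  interpret ideal J xyz_ring by fact
  fix x assume x: "x \<in> J"
  then obtain f where f: "x = xyz_class f" using xyz_classE[OF Icarr[OF x]] by blast
  have "cc f = 0"
  proof (rule ccontr)
    assume "cc f \<noteq> 0"
    then obtain g where "f * g = 1" using cc_unit by blast
    then have "\<one>\<^bsub>xyz_ring\<^esub> = x \<otimes>\<^bsub>xyz_ring\<^esub> xyz_class g" unfolding f xyz_class_simps by simp
    then have "\<one>\<^bsub>xyz_ring\<^esub> \<in> J" using I_r_closed[OF x xyz_class_simps(1)] by simp
    then show False using one_imp_carrier J(2) by blast
  qed
  then show "x \<in> xyz_class ` max_set" unfolding f max_set_def by blast
qed

lemma maximalideal_iff: "maximalideal J xyz_ring \<longleftrightarrow> J = xyz_class ` max_set"
proof
  let ?m = "xyz_class ` max_set"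
  have p: "primeideal ?m xyz_ring" by (rule primeideal_class_image[OF prime_max_set xyz_in_max_set])
  then have i: "ideal ?m xyz_ring" and ne: "carrier xyz_ring \<noteq> ?m"
    by (rule primeideal.axioms(1), rule primeideal.I_notcarr)
  { assume "maximalideal J xyz_ring"
    then interpret maximalideal J xyz_ring .
    have 1: "J \<subseteq> ?m" by (rule proper_ideal_subset_max[OF is_ideal]) (use I_notcarr in simp)
    have 2: "?m \<subseteq> carrier xyz_ring" by (auto simp: xyz_class_simps)
    show "J = ?m" using I_maximal[OF i 1 2] ne by metis }
  assume J: "J = ?m"
  show "maximalideal J xyz_ring"
    unfolding J
  proof (rule maximalidealI[OF i ne])
    fix K assume "ideal K xyz_ring" "?m \<subseteq> K" "K \<subseteq> carrier xyz_ring"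
    then show "K = ?m \<or> K = carrier xyz_ring" using proper_ideal_subset_max[of K] by (metis subset_antisym)
  qed
qed

lemma max_ideal_xyz: "max_ideal xyz_ring = xyz_class ` max_set"
  unfolding max_ideal_def maximalideal_iff by simp

lemma krull_dim_xyz: "krull_dim (xyz_ring :: 'k::field fps3 set ring) \<ge> 2"
proof -
  interpret coord pr1 pr2 pr3 var_x var_y "var_z :: 'k fps3" by (rule coord_std)
  \<comment> \<open>The chain of the ideals (z), (y, z) and (x, y, z). By the equality of depth and
    dimension it yields a regular sequence of length two.\<close>
  define J where "J = (\<lambda>i::nat. if i = 0 then {f :: 'k fps3. pr3 f = 0} else if i = 1 then {f. res_t (pr3 f) = 0} else max_set)"
  have prime: "prime_set (J i)" for i
    unfolding J_def using prime_max_set[where 'a = 'k] prime_set_kernel[OF p3.comm_ring_hom_axioms]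
      prime_set_kernel[OF comm_ring_hom_comp[OF res_t.comm_ring_hom_axioms p3.comm_ring_hom_axioms]] by simp
  have xyz: "var_x * var_y * var_z \<in> J i" for i
    unfolding J_def using xyz_in_max_set[where 'a = 'k] by (simp add: p3.hom_mult)
  have sub: "J i \<subset> J (Suc i)" if "i < 2" for i
  proof -
    have "J 0 \<subseteq> J 1" unfolding J_def by auto
    moreover have "cc f = 0" if "res_t (pr3 f) = 0" for f :: "'k fps3"
      using arg_cong[OF that, of "\<lambda>a. fps_nth a 0"] by simp
    then have "J 1 \<subseteq> J 2" unfolding J_def max_set_def by auto
    moreover have "var_y \<in> J 1" "var_y \<notin> J 0" "var_x \<in> J 2" "var_x \<notin> J 1" unfolding J_def max_set_def by simp_all
    ultimately have "J 0 \<subset> J 1" "J 1 \<subset> J 2" by blast+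
    moreover have "i = 0 \<or> i = 1" using that by auto
    ultimately show ?thesis by (auto simp: numeral_2_eq_2)
  qed
  have ideal: "ideal_set (J i)" for i using prime unfolding prime_set_def by blast
  have "xyz_class ` J i \<subset> xyz_class ` J (Suc i)" if i: "i < 2" for i
  proof -
    have "xyz_class ` J i \<subseteq> xyz_class ` J (Suc i)" using sub[OF i] by blast
    moreover obtain f where "f \<in> J (Suc i)" "f \<notin> J i" using sub[OF i] by blast
    then have "xyz_class f \<in> xyz_class ` J (Suc i)" "xyz_class f \<notin> xyz_class ` J i"
      unfolding class_image_mem_iff[OF ideal xyz] by simp_all
    ultimately show ?thesis by blast
  qed
  moreover have "primeideal (xyz_class ` J i) xyz_ring" for i by (rule primeideal_class_image[OF prime xyz])
  ultimately have "enat 2 \<le> krull_dim (xyz_ring :: 'k fps3 set ring)"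
    unfolding krull_dim_def by (intro Sup_upper CollectI exI[of _ 2] conjI exI[of _ "\<lambda>i. xyz_class ` J i"]) auto
  then show ?thesis by (simp add: numeral_eq_enat)
qed

section \<open>From modules to triples\<close>

locale xyz_module = module xyz_ring M for M :: "('k::field fps3 set, 'm) module"
begin

text \<open>Power series act on M through their classes, so that later computations take place with
  series instead of cosets.\<close>

definition sm :: "'k fps3 \<Rightarrow> 'm \<Rightarrow> 'm" where "sm F m = xyz_class F \<odot>\<^bsub>M\<^esub> m"

lemma sm_closed [simp]: "m \<in> carrier M \<Longrightarrow> sm F m \<in> carrier M"
  unfolding sm_def by (simp add: xyz_class_simps)

lemma sm_add: "m \<in> carrier M \<Longrightarrow> n \<in> carrier M \<Longrightarrow> sm F (m \<oplus>\<^bsub>M\<^esub> n) = sm F m \<oplus>\<^bsub>M\<^esub> sm F n"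
  unfolding sm_def by (simp add: smult_r_distr xyz_class_simps)

lemma sm_add_left: "m \<in> carrier M \<Longrightarrow> sm (F + G) m = sm F m \<oplus>\<^bsub>M\<^esub> sm G m"
  unfolding sm_def by (simp add: smult_l_distr xyz_class_simps flip: xyz_class_simps(2))

lemma sm_mult: "m \<in> carrier M \<Longrightarrow> sm (F * G) m = sm F (sm G m)"
  unfolding sm_def by (simp add: smult_assoc1 xyz_class_simps flip: xyz_class_simps(3))

lemma sm_one: "m \<in> carrier M \<Longrightarrow> sm 1 m = m"
  unfolding sm_def by (simp flip: xyz_class_simps(4))

lemma sm_xyz: "m \<in> carrier M \<Longrightarrow> var_x * var_y * var_z dvd F \<Longrightarrow> sm F m = \<zero>\<^bsub>M\<^esub>"
proof -
  assume m: "m \<in> carrier M" and "var_x * var_y * var_z dvd F"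
  then have "xyz_class F = \<zero>\<^bsub>xyz_ring\<^esub>" unfolding xyz_class_zero by (simp add: xyz_class_eq_iff)
  then show ?thesis unfolding sm_def using smult_l_null[OF m] by simp
qed

lemma sm_zero: "m \<in> carrier M \<Longrightarrow> sm 0 m = \<zero>\<^bsub>M\<^esub>" by (rule sm_xyz) simp_all

lemma sm_zero_right: "sm F \<zero>\<^bsub>M\<^esub> = \<zero>\<^bsub>M\<^esub>"
  unfolding sm_def by (simp add: xyz_class_simps)

lemma sm_eq_iff:
  assumes "m \<in> carrier M" shows "sm F m = sm G m \<longleftrightarrow> sm (F - G) m = \<zero>\<^bsub>M\<^esub>"
proof -
  have c: "sm F m \<in> carrier M" "sm G m \<in> carrier M" "sm (F - G) m \<in> carrier M" using assms by simp_all
  have "sm F m = sm (F - G) m \<oplus>\<^bsub>M\<^esub> sm G m" using sm_add_left[OF assms, of "F - G" G] by simp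
  then show ?thesis using M.add.right_cancel[OF c(2,3) M.zero_closed] c(2) by simp
qed

text \<open>Freeness at a prime, restated for the action \<open>sm\<close>. Two primes containing
  \<open>xyz\<close> are equal if their images in the quotient are, so
  \<open>J \<noteq> max_set\<close> yields a non-maximal prime of the quotient.\<close>

lemma free_at:
  assumes free: "rank_one xyz_ring M" and J: "prime_set J" "var_x * var_y * var_z \<in> J" "J \<noteq> max_set"
  obtains e where "e \<in> carrier M" "\<And>m. m \<in> carrier M \<Longrightarrow> \<exists>r r'. r \<notin> J \<and> sm r m = sm r' e"
    "\<And>r. sm r e = \<zero>\<^bsub>M\<^esub> \<Longrightarrow> \<exists>t. t \<notin> J \<and> var_x * var_y * var_z dvd t * r"
proof -
  let ?p = "xyz_class ` J"
  have Ji: "ideal_set J" using J unfolding prime_set_def by blast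
  have p: "primeideal ?p xyz_ring" by (rule primeideal_class_image[OF J(1,2)])
  have iff: "xyz_class f \<in> ?p \<longleftrightarrow> f \<in> J" for f by (rule class_image_mem_iff[OF Ji J(2)])
  have "ideal_set (max_set :: 'k fps3 set)" using prime_max_set unfolding prime_set_def by blast
  then have iff2: "xyz_class f \<in> xyz_class ` max_set \<longleftrightarrow> f \<in> max_set" for f :: "'k fps3"
    by (rule class_image_mem_iff[OF _ xyz_in_max_set])
  have "?p \<noteq> xyz_class ` max_set"
  proof
    assume "?p = xyz_class ` max_set"
    then have "f \<in> J \<longleftrightarrow> f \<in> max_set" for f using iff iff2 by metis
    then show False using J(3) by blast
  qed
  then have "localized_free_of_rank xyz_ring M ?p 1"
    using free p unfolding rank_one_def maximalideal_iff by blast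
  then show ?thesis
  proof (rule localized_free_of_rank_one[OF p])
    fix e assume e: "e \<in> carrier M"
      "\<And>m. m \<in> carrier M \<Longrightarrow> \<exists>r\<in>carrier xyz_ring - ?p. \<exists>r'\<in>carrier xyz_ring. r \<odot>\<^bsub>M\<^esub> m = r' \<odot>\<^bsub>M\<^esub> e"
      "\<And>r. r \<in> carrier xyz_ring \<Longrightarrow> r \<odot>\<^bsub>M\<^esub> e = \<zero>\<^bsub>M\<^esub> \<Longrightarrow> \<exists>u\<in>carrier xyz_ring - ?p. u \<otimes>\<^bsub>xyz_ring\<^esub> r = \<zero>\<^bsub>xyz_ring\<^esub>"
    show ?thesis
    proof (rule that[OF e(1)])
      fix m assume "m \<in> carrier M"
      then obtain r r' where r: "r \<in> carrier xyz_ring - ?p" "r' \<in> carrier xyz_ring" "r \<odot>\<^bsub>M\<^esub> m = r' \<odot>\<^bsub>M\<^esub> e"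
        using e(2) by blast
      obtain F where F: "r = xyz_class F" using r(1) xyz_classE by blast
      obtain G where G: "r' = xyz_class G" using r(2) xyz_classE by blast
      show "\<exists>r r'. r \<notin> J \<and> sm r m = sm r' e" using r unfolding F G sm_def by (auto simp: iff)
    next
      fix r assume "sm r e = \<zero>\<^bsub>M\<^esub>"
      then obtain t where t: "t \<in> carrier xyz_ring - ?p" "t \<otimes>\<^bsub>xyz_ring\<^esub> xyz_class r = \<zero>\<^bsub>xyz_ring\<^esub>"
        using e(3)[OF xyz_class_simps(1), of r] unfolding sm_def by metis
      obtain T where T: "t = xyz_class T" using t(1) xyz_classE by blast
      show "\<exists>t. t \<notin> J \<and> var_x * var_y * var_z dvd t * r"
        using t unfolding T xyz_class_simps xyz_class_zero xyz_class_eq_iff by (auto simp: iff)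
    qed
  qed
qed

lemma regular_pair:
  assumes mcm: "max_cohen_macaulay xyz_ring M" and nz: "carrier M \<noteq> {\<zero>\<^bsub>M\<^esub>}"
  shows "\<exists>a b. cc a = 0 \<and> cc b = 0 \<and> (\<forall>m\<in>carrier M. sm a m = \<zero>\<^bsub>M\<^esub> \<longrightarrow> m = \<zero>\<^bsub>M\<^esub>) \<and>
    (\<forall>m\<in>carrier M. \<forall>n\<in>carrier M. sm b m = sm a n \<longrightarrow> (\<exists>q\<in>carrier M. m = sm a q))"
proof -
  have "depth xyz_ring M = krull_dim (xyz_ring :: 'k fps3 set ring)" using mcm nz unfolding max_cohen_macaulay_def by blast
  then have "2 \<le> depth xyz_ring M" using krull_dim_xyz by metis
  have "\<exists>as. set as \<subseteq> max_ideal xyz_ring \<and> regular_sequence xyz_ring M as \<and> length as \<ge> 2"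
  proof (rule ccontr)
    assume "\<not> ?thesis"
    \<comment> \<open>The depth is a supremum of lengths; were all of them below two, it would be at
      most one.\<close>
    then have "depth xyz_ring M \<le> enat 1"
      unfolding depth_def by (intro Sup_least) force
    then have "(2::enat) \<le> enat 1" using \<open>2 \<le> depth xyz_ring M\<close> by (rule order_trans[rotated])
    then show False by (simp add: numeral_eq_enat)
  qed
  then obtain as where as: "set as \<subseteq> xyz_class ` max_set" "regular_sequence xyz_ring M as" "length as \<ge> 2"
    unfolding max_ideal_xyz by blast
  show ?thesis
  proof (rule regular_sequence_two[OF as(2,3)])
    fix a b assume ab: "a \<in> set as" "b \<in> set as"
      "\<And>x. x \<in> carrier M \<Longrightarrow> a \<odot>\<^bsub>M\<^esub> x = \<zero>\<^bsub>M\<^esub> \<Longrightarrow> x = \<zero>\<^bsub>M\<^esub>"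
      "\<And>x y. x \<in> carrier M \<Longrightarrow> y \<in> carrier M \<Longrightarrow> b \<odot>\<^bsub>M\<^esub> x = a \<odot>\<^bsub>M\<^esub> y \<Longrightarrow> \<exists>z\<in>carrier M. x = a \<odot>\<^bsub>M\<^esub> z"
    obtain F G where "F \<in> max_set" "a = xyz_class F" "G \<in> max_set" "b = xyz_class G" using as(1) ab(1,2) by blast
    then show ?thesis using ab(3,4) unfolding max_set_def
      by (intro exI[of _ F] exI[of _ G]) (simp add: sm_def)
  qed
qed

end

text \<open>The intended \<open>\<phi>\<close> is the localization of M at the minimal prime
  \<open>ker \<pi>\<close>, multiplied by a common denominator so that its values are power series.
  The third clause says that its kernel consists of elements that die in this localization.\<close>

definition (in xyz_module) component :: "('k fps3 \<Rightarrow> 'k fps fps) \<Rightarrow> ('m \<Rightarrow> 'k fps fps) \<Rightarrow> bool" where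
  "component \<pi> \<phi> \<longleftrightarrow>
     (\<forall>m\<in>carrier M. \<forall>n\<in>carrier M. \<phi> (m \<oplus>\<^bsub>M\<^esub> n) = \<phi> m + \<phi> n) \<and>
     (\<forall>F. \<forall>m\<in>carrier M. \<phi> (sm F m) = \<pi> F * \<phi> m) \<and>
     (\<forall>m\<in>carrier M. \<phi> m = 0 \<longrightarrow> (\<exists>r. \<pi> r \<noteq> 0 \<and> sm r m = \<zero>\<^bsub>M\<^esub>)) \<and>
     (\<exists>m\<in>carrier M. \<phi> m \<noteq> 0)"

locale coord_module = xyz_module M + coord \<pi>1 \<pi>2 \<pi>3 u v w
  for M :: "('k::field fps3 set, 'm) module" and \<pi>1 \<pi>2 \<pi>3 :: "'k fps3 \<Rightarrow> 'k fps fps" and u v w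
begin

lemma coord_module_rot: "coord_module M \<pi>2 \<pi>3 \<pi>1 v w u"
  by (intro coord_module.intro xyz_module_axioms coord_rot)

lemma coord_module_refl: "coord_module M (\<lambda>F. swap2 (\<pi>1 F)) (\<lambda>F. swap2 (\<pi>3 F)) (\<lambda>F. swap2 (\<pi>2 F)) u w v"
  by (intro coord_module.intro xyz_module_axioms coord_refl)

lemma pi_xyz: "\<pi>1 (var_x * var_y * var_z) = 0" "\<pi>2 (var_x * var_y * var_z) = 0" "\<pi>3 (var_x * var_y * var_z) = 0"
  unfolding uvw[symmetric] by (simp_all add: hom_simps)

lemma pi_dvd: "var_x * var_y * var_z dvd F \<Longrightarrow> \<pi>1 F = 0 \<and> \<pi>2 F = 0 \<and> \<pi>3 F = 0"
  by (elim dvdE) (simp add: p1.hom_mult[of "var_x * var_y * var_z"] p2.hom_mult[of "var_x * var_y * var_z"]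
    p3.hom_mult[of "var_x * var_y * var_z"] pi_xyz)

text \<open>A product of denominators serves the finitely many generators, and the elements that it
  serves form a submodule.\<close>

lemma common_denominator:
  assumes fg: "finitely_generated xyz_ring M" and J: "prime_set J" and e: "e \<in> carrier M"
    and den: "\<And>m. m \<in> carrier M \<Longrightarrow> \<exists>r r'. r \<notin> J \<and> sm r m = sm r' e"
  shows "\<exists>d. d \<notin> J \<and> (\<forall>m\<in>carrier M. \<exists>r'. sm d m = sm r' e)"
proof -
  obtain S where S: "S \<subseteq> carrier M" "finite S" "submodule_span xyz_ring M S = carrier M"
    using fg unfolding finitely_generated_def generated_by_def by blast
  have "\<exists>d. d \<notin> J \<and> (\<forall>s\<in>T. \<exists>r'. sm d s = sm r' e)" if "T \<subseteq> S" for T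
    using finite_subset[OF that S(2)] that
  proof (induction T rule: finite_induct)
    case empty
    then show ?case using J unfolding prime_set_def by blast
  next
    case (insert s T)
    then obtain d where d: "d \<notin> J" "\<And>t. t \<in> T \<Longrightarrow> \<exists>r'. sm d t = sm r' e" by blast
    have s: "s \<in> carrier M" using insert S(1) by blast
    then obtain r r' where r: "r \<notin> J" "sm r s = sm r' e" using den by blast
    have "\<exists>q. sm (r * d) t = sm q e" if t: "t \<in> insert s T" for t
    proof (cases "t = s")
      case True
      have "sm (r * d) s = sm d (sm r s)" using s by (simp add: sm_mult[symmetric] mult.commute)
      also have "\<dots> = sm (d * r') e" using r(2) e by (simp add: sm_mult)
      finally show ?thesis using True by blast
    next
      case False
      then obtain q where q: "sm d t = sm q e" using t d(2) by blast
      have "t \<in> carrier M" using t insert.prems S(1) by blast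
      then have "sm (r * d) t = sm (r * q) e" using q e by (simp add: sm_mult)
      then show ?thesis by blast
    qed
    moreover have "r * d \<notin> J" using J r(1) d(1) unfolding prime_set_def by blast
    ultimately show ?case by blast
  qed
  then obtain d where d: "d \<notin> J" "\<And>s. s \<in> S \<Longrightarrow> \<exists>r'. sm d s = sm r' e" by blast
  define N where "N = {m \<in> carrier M. \<exists>r'. sm d m = sm r' e}"
  have "submodule N xyz_ring M"
  proof (rule submoduleI)
    show "\<zero>\<^bsub>M\<^esub> \<in> N" unfolding N_def using e by (auto intro!: exI[of _ 0] simp: sm_zero sm_zero_right)
    show "a \<oplus>\<^bsub>M\<^esub> b \<in> N" if ab: "a \<in> N" "b \<in> N" for a b
    proof -
      obtain p q where "sm d a = sm p e" "sm d b = sm q e" using ab unfolding N_def by blast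
      then have "sm d (a \<oplus>\<^bsub>M\<^esub> b) = sm (p + q) e" using ab e unfolding N_def by (simp add: sm_add sm_add_left)
      then show ?thesis using ab unfolding N_def by blast
    qed
    have act: "sm F a \<in> N" if a: "a \<in> N" for a F
    proof -
      obtain p where p: "sm d a = sm p e" using a unfolding N_def by blast
      have "sm d (sm F a) = sm F (sm d a)" using a unfolding N_def by (simp add: sm_mult[symmetric] mult.commute)
      also have "\<dots> = sm (F * p) e" using p e by (simp add: sm_mult)
      finally show ?thesis using a unfolding N_def by auto
    qed
    show "a \<odot>\<^bsub>M\<^esub> x \<in> N" if "a \<in> carrier xyz_ring" "x \<in> N" for a x
      using act[OF that(2)] that(1) unfolding carrier_xyz sm_def by auto
    show "\<ominus>\<^bsub>M\<^esub> a \<in> N" if a: "a \<in> N" for a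
    proof -
      have aM: "a \<in> carrier M" using a unfolding N_def by blast
      have "sm (-1) a \<oplus>\<^bsub>M\<^esub> a = sm (-1 + 1) a" using aM by (simp only: sm_add_left sm_one)
      also have "\<dots> = \<zero>\<^bsub>M\<^esub>" using aM by (simp add: sm_zero)
      finally have "\<ominus>\<^bsub>M\<^esub> a = sm (-1) a" using aM by (intro M.minus_equality) simp_all
      then show ?thesis using act[OF a] by simp
    qed
  qed (auto simp: N_def)
  moreover have "S \<subseteq> N" using S(1) d(2) unfolding N_def by blast
  ultimately have "carrier M \<subseteq> N" using submodule_span_minimal S(3) by blast
  then show ?thesis using d(1) unfolding N_def by blast
qed

lemma component_map:
  assumes fg: "finitely_generated xyz_ring M" and rank: "rank_one xyz_ring M"
  shows "\<exists>\<phi>. component \<pi>1 \<phi>"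
proof -
  define J where "J = {F. \<pi>1 F = 0}"
  have J: "prime_set J" unfolding J_def by (rule prime_set_kernel[OF p1.comm_ring_hom_axioms])
  have "v \<in> max_set" "v \<notin> J" unfolding max_set_def J_def by simp_all
  then have Jm: "J \<noteq> max_set" by blast
  have Jx: "var_x * var_y * var_z \<in> J" unfolding J_def by (simp add: pi_xyz)
  show ?thesis
  proof (rule free_at[OF rank J Jx Jm])
    fix e assume e: "e \<in> carrier M" "\<And>m. m \<in> carrier M \<Longrightarrow> \<exists>r r'. r \<notin> J \<and> sm r m = sm r' e"
      "\<And>r. sm r e = \<zero>\<^bsub>M\<^esub> \<Longrightarrow> \<exists>t. t \<notin> J \<and> var_x * var_y * var_z dvd t * r"
    obtain d where d: "d \<notin> J" "\<forall>m\<in>carrier M. \<exists>r'. sm d m = sm r' e"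
      using common_denominator[OF fg J e(1,2)] by blast
    \<comment> \<open>\<open>\<nu> m\<close> chooses a numerator of \<open>m\<close> over the basis
      \<open>e\<close> with denominator \<open>d\<close>. On the plane the choice is irrelevant by
      \<open>uniq\<close>, so restricting the numerator gives a well-defined component map.\<close>
    define \<nu> where "\<nu> = (\<lambda>m. SOME r'. sm d m = sm r' e)"
    have nu: "sm d m = sm (\<nu> m) e" if "m \<in> carrier M" for m
      unfolding \<nu>_def by (rule someI_ex) (use d(2) that in blast)
    have uniq: "\<pi>1 r = \<pi>1 r'" if "sm r e = sm r' e" for r r'
    proof -
      have "sm (r - r') e = \<zero>\<^bsub>M\<^esub>" using that sm_eq_iff[OF e(1)] by simp
      then obtain t where t: "t \<notin> J" "var_x * var_y * var_z dvd t * (r - r')" using e(3) by blast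
      then have "\<pi>1 t * (\<pi>1 r - \<pi>1 r') = 0" using pi_dvd[OF t(2)] by (simp add: hom_simps)
      then show ?thesis using t(1) unfolding J_def by simp
    qed
    show ?thesis
      unfolding component_def
    proof (intro exI[of _ "\<lambda>m. \<pi>1 (\<nu> m)"] conjI ballI allI impI)
      fix m n assume mn: "m \<in> carrier M" "n \<in> carrier M"
      have "sm (\<nu> (m \<oplus>\<^bsub>M\<^esub> n)) e = sm (\<nu> m + \<nu> n) e"
        using nu[OF M.a_closed[OF mn]] nu[OF mn(1)] nu[OF mn(2)] mn e(1) by (simp add: sm_add sm_add_left)
      then show "\<pi>1 (\<nu> (m \<oplus>\<^bsub>M\<^esub> n)) = \<pi>1 (\<nu> m) + \<pi>1 (\<nu> n)" using uniq by (metis p1.hom_add)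
    next
      fix F m assume m: "m \<in> carrier M"
      have "sm (\<nu> (sm F m)) e = sm d (sm F m)" using nu[of "sm F m"] m by simp
      also have "\<dots> = sm F (sm d m)" using m by (simp add: sm_mult[symmetric] mult.commute)
      also have "\<dots> = sm (F * \<nu> m) e" using nu[OF m] e(1) by (simp add: sm_mult)
      finally show "\<pi>1 (\<nu> (sm F m)) = \<pi>1 F * \<pi>1 (\<nu> m)" using uniq by (metis p1.hom_mult)
    next
      fix m assume m: "m \<in> carrier M" "\<pi>1 (\<nu> m) = 0"
      \<comment> \<open>On the second and third plane \<open>v * w\<close> vanishes, and on the
        first one \<open>\<nu> m\<close> does, so the product is a multiple of
        \<open>xyz\<close>.\<close>
      have "var_x * var_y * var_z dvd v * w * \<nu> m"
        unfolding uvw[symmetric] by (rule ker_uvw) (simp_all add: hom_simps m(2))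
      then have "sm (v * w * \<nu> m) e = \<zero>\<^bsub>M\<^esub>" by (rule sm_xyz[OF e(1)])
      then have "sm (v * w * d) m = \<zero>\<^bsub>M\<^esub>" using nu[OF m(1)] m(1) e(1) by (simp add: sm_mult)
      moreover have "\<pi>1 (v * w * d) \<noteq> 0" using d(1) unfolding J_def by (simp add: hom_simps)
      ultimately show "\<exists>r. \<pi>1 r \<noteq> 0 \<and> sm r m = \<zero>\<^bsub>M\<^esub>" by blast
    next
      have "\<pi>1 (\<nu> e) = \<pi>1 d" by (rule uniq) (simp add: nu[OF e(1)])
      then show "\<exists>m\<in>carrier M. \<pi>1 (\<nu> m) \<noteq> 0" using d(1) e(1) unfolding J_def by (intro bexI[of _ e]) simp_all
    qed
  qed
qed

definition rep :: "'k triple set \<Rightarrow> bool" where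
  "rep L \<longleftrightarrow> (\<exists>\<phi>. bij_betw \<phi> (carrier M) L \<and>
     (\<forall>m\<in>carrier M. \<forall>n\<in>carrier M. \<phi> (m \<oplus>\<^bsub>M\<^esub> n) = \<phi> m + \<phi> n) \<and>
     (\<forall>F. \<forall>m\<in>carrier M. \<phi> (sm F m) = act F (\<phi> m)))"

text \<open>An element killed by the three component maps has an annihilator that is contained in no prime
  except the maximal ideal, so it vanishes by depth.\<close>

lemma killed_imp_zero:
  assumes rank: "rank_one xyz_ring M" and m: "m \<in> carrier M"
    and a: "cc a = 0" "\<And>n. n \<in> carrier M \<Longrightarrow> sm a n = \<zero>\<^bsub>M\<^esub> \<Longrightarrow> n = \<zero>\<^bsub>M\<^esub>"
    and r: "\<pi>1 r1 \<noteq> 0" "sm r1 m = \<zero>\<^bsub>M\<^esub>" "\<pi>2 r2 \<noteq> 0" "sm r2 m = \<zero>\<^bsub>M\<^esub>" "\<pi>3 r3 \<noteq> 0" "sm r3 m = \<zero>\<^bsub>M\<^esub>"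
  shows "m = \<zero>\<^bsub>M\<^esub>"
proof -
  define I where "I = {F. sm F m = \<zero>\<^bsub>M\<^esub>}"
  have I: "ideal_set I"
    unfolding ideal_set_def I_def using m by (auto simp: sm_zero sm_add_left sm_mult sm_zero_right)
  have "\<exists>k. a ^ k \<in> I"
  proof (rule ccontr)
    assume "\<not> ?thesis"
    then obtain J where J: "prime_set J" "I \<subseteq> J" "a \<notin> J" using ex_prime_set[OF I] by blast
    have Ji: "\<And>p q. p * q \<in> J \<Longrightarrow> p \<in> J \<or> q \<in> J" using J(1) unfolding prime_set_def by blast
    have "var_x * var_y * var_z \<in> I" unfolding I_def using sm_xyz[OF m] by simp
    then have Jx: "var_x * var_y * var_z \<in> J" using J(2) by blast
    have Jm: "J \<noteq> max_set" using J(3) a(1) unfolding max_set_def by blast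
    show False
    proof (rule free_at[OF rank J(1) Jx Jm])
      fix e assume e: "e \<in> carrier M" "\<And>m. m \<in> carrier M \<Longrightarrow> \<exists>r r'. r \<notin> J \<and> sm r m = sm r' e"
        "\<And>r. sm r e = \<zero>\<^bsub>M\<^esub> \<Longrightarrow> \<exists>t. t \<notin> J \<and> var_x * var_y * var_z dvd t * r"
      obtain q q' where q: "q \<notin> J" "sm q m = sm q' e" using e(2)[OF m] by blast
      have ex: "\<exists>t. t \<notin> J \<and> var_x * var_y * var_z dvd t * (F * q')" if F: "sm F m = \<zero>\<^bsub>M\<^esub>" for F
      proof (rule e(3))
        have "sm (F * q') e = sm F (sm q m)" using q(2) e(1) by (simp add: sm_mult)
        also have "\<dots> = sm q (sm F m)" using m by (simp add: sm_mult[symmetric] mult.commute)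
        finally show "sm (F * q') e = \<zero>\<^bsub>M\<^esub>" using F by (simp add: sm_zero_right)
      qed
      \<comment> \<open>On the plane where \<open>r1\<close> is nonzero, this relation forces
        \<open>t1 * q'\<close> to vanish, and likewise for \<open>t2\<close> and \<open>t3\<close>.
        The product of all three with \<open>q'\<close> therefore vanishes on every plane.\<close>
      obtain t1 where t1: "t1 \<notin> J" "var_x * var_y * var_z dvd t1 * (r1 * q')" using ex[OF r(2)] by blast
      obtain t2 where t2: "t2 \<notin> J" "var_x * var_y * var_z dvd t2 * (r2 * q')" using ex[OF r(4)] by blast
      obtain t3 where t3: "t3 \<notin> J" "var_x * var_y * var_z dvd t3 * (r3 * q')" using ex[OF r(6)] by blast
      have "var_x * var_y * var_z dvd t1 * t2 * t3 * q'"
        unfolding uvw[symmetric]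
      proof (rule ker_uvw)
        show "\<pi>1 (t1 * t2 * t3 * q') = 0" using pi_dvd[OF t1(2)] r(1) by (auto simp: hom_simps)
        show "\<pi>2 (t1 * t2 * t3 * q') = 0" using pi_dvd[OF t2(2)] r(3) by (auto simp: hom_simps)
        show "\<pi>3 (t1 * t2 * t3 * q') = 0" using pi_dvd[OF t3(2)] r(5) by (auto simp: hom_simps)
      qed
      then have "sm (t1 * t2 * t3 * q') e = \<zero>\<^bsub>M\<^esub>" by (rule sm_xyz[OF e(1)])
      then have "sm (t1 * t2 * t3 * q) m = \<zero>\<^bsub>M\<^esub>" using q(2) m e(1) by (simp add: sm_mult)
      then have "t1 * t2 * t3 * q \<in> J" using J(2) unfolding I_def by blast
      then show False using Ji[of "t1 * t2 * t3" q] Ji[of "t1 * t2" t3] Ji[of t1 t2] t1(1) t2(1) t3(1) q(1) by simp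
    qed
  qed
  then obtain k where k: "sm (a ^ k) m = \<zero>\<^bsub>M\<^esub>" unfolding I_def by blast
  have "sm (a ^ j) n = \<zero>\<^bsub>M\<^esub> \<longrightarrow> n = \<zero>\<^bsub>M\<^esub>" if "n \<in> carrier M" for j n
  proof (induction j)
    case (Suc j)
    show ?case
    proof
      assume "sm (a ^ Suc j) n = \<zero>\<^bsub>M\<^esub>"
      then have "sm a (sm (a ^ j) n) = \<zero>\<^bsub>M\<^esub>" using that by (simp add: sm_mult)
      then have "sm (a ^ j) n = \<zero>\<^bsub>M\<^esub>" using a(2)[of "sm (a ^ j) n"] that by simp
      then show "n = \<zero>\<^bsub>M\<^esub>" using Suc.IH by simp
    qed
  qed (use that in \<open>simp add: sm_one\<close>)
  from this[OF m, of k] k show ?thesis by simp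
qed

theorem ex_triple_module:
  assumes mcm: "max_cohen_macaulay xyz_ring M" and rank: "rank_one xyz_ring M"
  shows "\<exists>L. rep L \<and> triple_module \<pi>1 \<pi>2 \<pi>3 u v w L"
proof -
  interpret r: coord_module M \<pi>2 \<pi>3 \<pi>1 v w u by (rule coord_module_rot)
  interpret rr: coord_module M \<pi>3 \<pi>1 \<pi>2 w u v by (rule r.coord_module_rot)
  have fg: "finitely_generated xyz_ring M" using mcm unfolding max_cohen_macaulay_def by blast
  obtain \<phi>1 where c1: "component \<pi>1 \<phi>1" using component_map[OF fg rank] by blast
  have 1: "\<phi>1 (m \<oplus>\<^bsub>M\<^esub> n) = \<phi>1 m + \<phi>1 n" "\<phi>1 (sm F m) = \<pi>1 F * \<phi>1 m"
    "\<phi>1 m = 0 \<Longrightarrow> \<exists>r. \<pi>1 r \<noteq> 0 \<and> sm r m = \<zero>\<^bsub>M\<^esub>" if "m \<in> carrier M" "n \<in> carrier M" for m n F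
    using c1 that unfolding component_def by simp_all
  have nz1: "\<exists>m\<in>carrier M. \<phi>1 m \<noteq> 0" using c1 unfolding component_def by simp
  obtain \<phi>2 where c2: "component \<pi>2 \<phi>2" using r.component_map[OF fg rank] by blast
  have 2: "\<phi>2 (m \<oplus>\<^bsub>M\<^esub> n) = \<phi>2 m + \<phi>2 n" "\<phi>2 (sm F m) = \<pi>2 F * \<phi>2 m"
    "\<phi>2 m = 0 \<Longrightarrow> \<exists>r. \<pi>2 r \<noteq> 0 \<and> sm r m = \<zero>\<^bsub>M\<^esub>" if "m \<in> carrier M" "n \<in> carrier M" for m n F
    using c2 that unfolding component_def by simp_all
  have nz2: "\<exists>m\<in>carrier M. \<phi>2 m \<noteq> 0" using c2 unfolding component_def by simp
  obtain \<phi>3 where c3: "component \<pi>3 \<phi>3" using rr.component_map[OF fg rank] by blast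
  have 3: "\<phi>3 (m \<oplus>\<^bsub>M\<^esub> n) = \<phi>3 m + \<phi>3 n" "\<phi>3 (sm F m) = \<pi>3 F * \<phi>3 m"
    "\<phi>3 m = 0 \<Longrightarrow> \<exists>r. \<pi>3 r \<noteq> 0 \<and> sm r m = \<zero>\<^bsub>M\<^esub>" if "m \<in> carrier M" "n \<in> carrier M" for m n F
    using c3 that unfolding component_def by simp_all
  have nz3: "\<exists>m\<in>carrier M. \<phi>3 m \<noteq> 0" using c3 unfolding component_def by simp
  define \<phi> where "\<phi> = (\<lambda>m. (\<phi>1 m, \<phi>2 m, \<phi>3 m))"
  define L where "L = \<phi> ` carrier M"
  have add: "\<phi> (m \<oplus>\<^bsub>M\<^esub> n) = \<phi> m + \<phi> n" if "m \<in> carrier M" "n \<in> carrier M" for m n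
    unfolding \<phi>_def using that 1(1) 2(1) 3(1) by simp
  have eqv: "\<phi> (sm F m) = act F (\<phi> m)" if "m \<in> carrier M" for F m
    unfolding \<phi>_def using that 1(2) 2(2) 3(2) by simp
  have z: "\<phi> \<zero>\<^bsub>M\<^esub> = 0" using eqv[OF M.zero_closed, of 0] by (simp add: sm_zero_right)
  \<comment> \<open>The definition of maximal Cohen-Macaulay modules admits the zero module without
    a condition on its depth; a nonzero component excludes it.\<close>
  have "carrier M \<noteq> {\<zero>\<^bsub>M\<^esub>}"
  proof
    assume *: "carrier M = {\<zero>\<^bsub>M\<^esub>}"
    then have "\<phi>1 \<zero>\<^bsub>M\<^esub> \<noteq> 0" using nz1 by simp
    then show False using z unfolding \<phi>_def by (simp add: zero_prod_def)
  qed
  then obtain a b where ab: "cc a = 0" "cc b = 0" "\<forall>m\<in>carrier M. sm a m = \<zero>\<^bsub>M\<^esub> \<longrightarrow> m = \<zero>\<^bsub>M\<^esub>"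
    "\<forall>m\<in>carrier M. \<forall>n\<in>carrier M. sm b m = sm a n \<longrightarrow> (\<exists>q\<in>carrier M. m = sm a q)"
    using regular_pair[OF mcm] by blast
  have ker: "m = \<zero>\<^bsub>M\<^esub>" if m: "m \<in> carrier M" and 0: "\<phi> m = 0" for m
  proof -
    have "\<phi>1 m = 0" "\<phi>2 m = 0" "\<phi>3 m = 0" using 0 unfolding \<phi>_def by (simp_all add: zero_prod_def)
    then obtain r1 where r1: "\<pi>1 r1 \<noteq> 0" "sm r1 m = \<zero>\<^bsub>M\<^esub>" using 1(3)[OF m m] by blast
    obtain r2 where r2: "\<pi>2 r2 \<noteq> 0" "sm r2 m = \<zero>\<^bsub>M\<^esub>" using 2(3)[OF m m \<open>\<phi>2 m = 0\<close>] by blast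
    obtain r3 where r3: "\<pi>3 r3 \<noteq> 0" "sm r3 m = \<zero>\<^bsub>M\<^esub>" using 3(3)[OF m m \<open>\<phi>3 m = 0\<close>] by blast
    show ?thesis by (rule killed_imp_zero[OF rank m ab(1) _ r1 r2 r3]) (use ab(3) in blast)
  qed
  have inj: "m = n" if m: "m \<in> carrier M" and n: "n \<in> carrier M" and eq: "\<phi> m = \<phi> n" for m n
  proof -
    have "\<phi> (m \<oplus>\<^bsub>M\<^esub> sm (-1) n) = \<phi> m + act (-1) (\<phi> n)" using m n by (simp add: add eqv)
    also have "\<dots> = 0" unfolding eq by (simp add: act_uminus)
    finally have "m \<oplus>\<^bsub>M\<^esub> sm (-1) n = \<zero>\<^bsub>M\<^esub>" using ker m n by simp
    moreover have "n \<oplus>\<^bsub>M\<^esub> sm (-1) n = sm (1 + (-1)) n" using n by (simp only: sm_add_left sm_one)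
    then have "n \<oplus>\<^bsub>M\<^esub> sm (-1) n = \<zero>\<^bsub>M\<^esub>" using n by (simp add: sm_zero)
    ultimately show ?thesis using M.add.right_cancel[of "sm (-1) n" m n] m n by simp
  qed
  have bij: "bij_betw \<phi> (carrier M) L" unfolding bij_betw_def L_def using inj by (auto intro: inj_onI)
  then have "rep L" unfolding rep_def using add eqv by blast
  have eq: "\<phi> m = \<phi> n \<longleftrightarrow> m = n" if "m \<in> carrier M" "n \<in> carrier M" for m n using inj that by blast
  have eq0: "\<phi> m = 0 \<longleftrightarrow> m = \<zero>\<^bsub>M\<^esub>" if "m \<in> carrier M" for m using eq[OF that M.zero_closed] z by simp
  \<comment> \<open>Here \<open>h\<close> is the restriction to an axis and \<open>p\<close> a
    variable that is nonzero on it. As \<open>p\<close> lies in the maximal ideal but not in the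
    kernel of \<open>h\<close>, this kernel is a prime at which M is free.\<close>
  have loc: "\<exists>e\<in>L. \<forall>l\<in>L. \<exists>r r'. h r \<noteq> 0 \<and> act r l = act r' e"
    if h: "comm_ring_hom h" "h (var_x * var_y * var_z) = 0" and p: "cc p = 0" "h p \<noteq> 0" for h :: "'k fps3 \<Rightarrow> 'k fps" and p
  proof -
    define J where "J = {F. h F = 0}"
    have J: "prime_set J" unfolding J_def by (rule prime_set_kernel[OF h(1)])
    have Jx: "var_x * var_y * var_z \<in> J" unfolding J_def using h(2) by simp
    have Jm: "J \<noteq> max_set" using p unfolding J_def max_set_def by blast
    show ?thesis
    proof (rule free_at[OF rank J Jx Jm])
      fix e assume e: "e \<in> carrier M" "\<And>m. m \<in> carrier M \<Longrightarrow> \<exists>r r'. r \<notin> J \<and> sm r m = sm r' e"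
      have "\<exists>r r'. h r \<noteq> 0 \<and> act r l = act r' (\<phi> e)" if l: "l \<in> L" for l
      proof -
        obtain m where m: "m \<in> carrier M" "l = \<phi> m" using l unfolding L_def by blast
        then obtain r r' where r: "r \<notin> J" "sm r m = sm r' e" using e(2) by blast
        have "act r l = act r' (\<phi> e)" unfolding m(2) eqv[OF m(1), symmetric] eqv[OF e(1), symmetric] r(2) ..
        then show ?thesis using r(1) unfolding J_def by blast
      qed
      then show ?thesis using e(1) unfolding L_def by blast
    qed
  qed
  have hom: "comm_ring_hom (\<lambda>F. res_s (\<pi> F))" if "comm_ring_hom \<pi>" for \<pi> :: "'k fps3 \<Rightarrow> 'k fps fps"
    by (rule comm_ring_hom_comp[OF res_s.comm_ring_hom_axioms that])
  have "triple_module \<pi>1 \<pi>2 \<pi>3 u v w L"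
  proof
    show "l + l' \<in> L" if "l \<in> L" "l' \<in> L" for l l'
      using that unfolding L_def by (auto simp: add[symmetric])
    show "act F l \<in> L" if "l \<in> L" for F l
      using that unfolding L_def by (auto simp: eqv[symmetric])
    show "\<exists>a b. cc a = 0 \<and> cc b = 0 \<and> (\<forall>l\<in>L. act a l = 0 \<longrightarrow> l = 0) \<and>
      (\<forall>l\<in>L. \<forall>l'\<in>L. act b l = act a l' \<longrightarrow> (\<exists>l''\<in>L. l = act a l''))"
      by (intro exI[of _ a] exI[of _ b])
        (use ab in \<open>simp add: L_def eqv[symmetric] eq eq0\<close>)
    show "\<exists>f g h. (f, g, h) \<in> L \<and> f \<noteq> 0" using nz1 unfolding L_def \<phi>_def by blast
    show "\<exists>f g h. (f, g, h) \<in> L \<and> g \<noteq> 0" using nz2 unfolding L_def \<phi>_def by blast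
    show "\<exists>f g h. (f, g, h) \<in> L \<and> h \<noteq> 0" using nz3 unfolding L_def \<phi>_def by blast
    show "\<exists>e\<in>L. \<forall>l\<in>L. \<exists>r r'. res_s (\<pi>1 r) \<noteq> 0 \<and> act r l = act r' e"
      by (rule loc[OF hom[OF p1.comm_ring_hom_axioms], of w]) (simp_all add: pi_xyz)
    show "\<exists>e\<in>L. \<forall>l\<in>L. \<exists>r r'. res_s (\<pi>2 r) \<noteq> 0 \<and> act r l = act r' e"
      by (rule loc[OF hom[OF p2.comm_ring_hom_axioms], of u]) (simp_all add: pi_xyz)
    show "\<exists>e\<in>L. \<forall>l\<in>L. \<exists>r r'. res_s (\<pi>3 r) \<noteq> 0 \<and> act r l = act r' e"
      by (rule loc[OF hom[OF p3.comm_ring_hom_axioms], of v]) (simp_all add: pi_xyz)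
  qed
  then show ?thesis using \<open>rep L\<close> by blast
qed

end

section \<open>From presentations to cokernels and minimal numbers of generators\<close>

lemma finsum_xyz_class:
  fixes f :: "'i \<Rightarrow> 'k::field fps3"
  assumes "finite A"
  shows "(\<Oplus>\<^bsub>xyz_ring\<^esub>j\<in>A. xyz_class (f j)) = xyz_class (\<Sum>j\<in>A. f j)"
proof -
  interpret cring "xyz_ring :: 'k fps3 set ring" by (rule cring_xyz)
  show ?thesis
    using assms by (induction A rule: finite_induct) (simp_all add: xyz_class_zero xyz_class_simps)
qed

text \<open>If m were less than n, padding with zeros would give square matrices with A B = 1, hence
  B A = 1, although row m of B is zero.\<close>

lemma right_inverse_dim_le:
  fixes R Q :: "nat \<Rightarrow> nat \<Rightarrow> 'k::field"
  assumes one: "\<And>i l. i < n \<Longrightarrow> l < n \<Longrightarrow> (\<Sum>s<m. R i s * Q s l) = (if i = l then 1 else 0)"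
  shows "n \<le> m"
proof (rule ccontr)
  assume mn: "\<not> n \<le> m"
  define A where "A = mat n n (\<lambda>(i, s). if s < m then R i s else 0)"
  define B where "B = mat n n (\<lambda>(s, l). if s < m then Q s l else 0)"
  have A: "A \<in> carrier_mat n n" and B: "B \<in> carrier_mat n n" unfolding A_def B_def by auto
  have "A * B = 1\<^sub>m n"
  proof (rule eq_matI)
    fix i l assume il: "i < dim_row (1\<^sub>m n :: 'k mat)" "l < dim_col (1\<^sub>m n :: 'k mat)"
    then have "(A * B) $$ (i, l) = (\<Sum>s\<in>{0..<n}. (if s < m then R i s else 0) * (if s < m then Q s l else 0))"
      using A B by (simp add: A_def B_def scalar_prod_def)
    also have "\<dots> = (\<Sum>s<m. R i s * Q s l)"
      using mn by (intro sum.mono_neutral_cong_right) auto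
    finally show "(A * B) $$ (i, l) = 1\<^sub>m n $$ (i, l)" using one il by simp
  qed (use A B in auto)
  then have BA: "B * A = 1\<^sub>m n" by (rule mat_mult_left_right_inverse[OF A B])
  have "(B * A) $$ (m, m) = (\<Sum>s\<in>{0..<n}. B $$ (m, s) * A $$ (s, m))"
    using A B mn by (simp add: scalar_prod_def)
  also have "\<dots> = 0" using mn by (intro sum.neutral) (simp add: A_def)
  finally show False unfolding BA using mn by simp
qed

context xyz_module
begin

lemma generated_by_mono: "generated_by xyz_ring M k \<Longrightarrow> k \<le> n \<Longrightarrow> generated_by xyz_ring M n"
  unfolding generated_by_def by (metis order_trans)

text \<open>Stated for M alone, with the variables quantified, so that it is the same proposition in
  every interpretation of the coordinates; a result proved after a rotation or reflection applies
  without translation.\<close>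

definition outcome :: bool where
  "outcome \<longleftrightarrow> module_iso xyz_ring M (regular_module xyz_ring) \<or>
     (generated_by xyz_ring M 2 \<and> \<not> generated_by xyz_ring M 1 \<and>
       (\<exists>u v w p q c.
          {u, v, w} = {var_x, var_y, var_z} \<and> p \<ge> 1 \<and> q \<ge> 1 \<and> c \<noteq> 0 \<and>
          (\<exists>\<theta> \<in> {theta1 u v w (p, q) c, theta2 u v w (p, q) c, theta3 u v w (p, q) c}.
             module_iso xyz_ring M (xyz_coker \<theta>)))) \<or>
     (generated_by xyz_ring M 3 \<and> \<not> generated_by xyz_ring M 2 \<and>
       (\<exists>u v w m n l c.
          {u, v, w} = {var_x, var_y, var_z} \<and> m \<ge> 1 \<and> n \<ge> 1 \<and> l \<ge> 1 \<and> c \<noteq> 0 \<and>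
          (\<exists>\<theta> \<in> {theta4 u v w (m, n, l) c, theta5 u v w (m, n, l) c,
                  theta6 u v w (m, n, l) c, theta7 u v w (m, n, l) c}.
             module_iso xyz_ring M (xyz_coker \<theta>))))"

end

context coord_module
begin

lemma act_cong: "xyz_class F = xyz_class G \<Longrightarrow> act F l = act G l"
proof -
  assume "xyz_class F = xyz_class G"
  then have "\<pi>1 (F - G) = 0" "\<pi>2 (F - G) = 0" "\<pi>3 (F - G) = 0" unfolding xyz_class_eq_iff using pi_dvd by blast+
  then show ?thesis by (cases l) (simp add: hom_simps)
qed

lemma comb_add: "comb n (\<lambda>i. r i + s i) e = comb n r e + comb n s e"
  unfolding comb_def by (simp add: act_add_left sum.distrib)

lemma act_sum: "act F (\<Sum>i\<in>A. g i) = (\<Sum>i\<in>A. act F (g i))"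
  by (induction A rule: infinite_finite_induct) (simp_all add: act_add)

lemma act_sum_left: "act (\<Sum>i\<in>A. g i) l = (\<Sum>i\<in>A. act (g i) l)"
  by (induction A rule: infinite_finite_induct) (simp_all add: act_add_left)

lemma act_comb: "act F (comb n r e) = comb n (\<lambda>i. F * r i) e"
  unfolding comb_def by (simp add: act_sum act_mult)

lemma comb_sum: "finite A \<Longrightarrow> comb n (\<lambda>i. \<Sum>j\<in>A. r j i) e = (\<Sum>j\<in>A. comb n (r j) e)"
  unfolding comb_def act_sum_left by (rule sum.swap)

lemma comb_diff: "comb n (\<lambda>i. r i - s i) e = comb n r e - comb n s e"
proof -
  have "comb n r e = comb n (\<lambda>i. (r i - s i) + s i) e" by simp
  then show ?thesis unfolding comb_add by simp
qed

lemma comb_unit: "i < n \<Longrightarrow> comb n (\<lambda>l. if l = i then 1 else 0) e = e i"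
proof -
  assume i: "i < n"
  have "comb n (\<lambda>l. if l = i then 1 else 0) e = (\<Sum>l<n. if l = i then e l else 0)"
    unfolding comb_def by (intro sum.cong) auto
  then show ?thesis using i by simp
qed

lemma comb_cong_class:
  "(\<And>i. i < n \<Longrightarrow> xyz_class (r i) = xyz_class (s i)) \<Longrightarrow> comb n r e = comb n s e"
  unfolding comb_def by (intro sum.cong refl act_cong) auto

text \<open>The generators give a surjection from the free module onto M whose kernel is, by
  \<open>presents\<close>, the image of the matrix. Minimality is Nakayama's lemma in matrix form:
  all relations vanish modulo the maximal ideal, so passing to any other generating set and back
  gives constant matrices whose product is the identity.\<close>

lemma presented:
  assumes rep: "rep L" and pres: "presents n \<theta> L"
  shows presented_iso: "module_iso xyz_ring M (xyz_coker \<theta>)"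
    and presented_generated: "generated_by xyz_ring M n"
    and presented_minimal: "generated_by xyz_ring M k \<Longrightarrow> n \<le> k"
proof -
  obtain \<phi> where bij: "bij_betw \<phi> (carrier M) L"
    and add: "\<And>m n. m \<in> carrier M \<Longrightarrow> n \<in> carrier M \<Longrightarrow> \<phi> (m \<oplus>\<^bsub>M\<^esub> n) = \<phi> m + \<phi> n"
    and eqv: "\<And>F m. m \<in> carrier M \<Longrightarrow> \<phi> (sm F m) = act F (\<phi> m)"
    using rep unfolding rep_def by blast
  have dim: "dim_row \<theta> = n" "dim_col \<theta> = n" and cc0: "\<And>i j. i < n \<Longrightarrow> j < n \<Longrightarrow> cc (\<theta> $$ (i, j)) = 0"
    using pres unfolding presents_def by auto
  obtain e where e: "\<And>i. i < n \<Longrightarrow> e i \<in> L" and gen: "\<And>l. l \<in> L \<Longrightarrow> \<exists>r. l = comb n r e"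
    and rel: "\<And>j. j < n \<Longrightarrow> comb n (\<lambda>i. \<theta> $$ (i, j)) e = 0"
    and ker: "\<And>r. comb n r e = 0 \<Longrightarrow> \<exists>q. \<forall>i<n. var_x * var_y * var_z dvd r i - (\<Sum>j<n. \<theta> $$ (i, j) * q j)"
    using pres unfolding presents_def by blast
  define \<gamma> where "\<gamma> = inv_into (carrier M) \<phi>"
  have inj: "inj_on \<phi> (carrier M)" and img: "\<phi> ` carrier M = L" using bij unfolding bij_betw_def by auto
  have gl: "\<gamma> l \<in> carrier M" "\<phi> (\<gamma> l) = l" if "l \<in> L" for l
    using that img unfolding \<gamma>_def by (auto simp: inv_into_into f_inv_into_f)
  have eqM: "m = m'" if "m \<in> carrier M" "m' \<in> carrier M" "\<phi> m = \<phi> m'" for m m' using inj_onD[OF inj that(3,1,2)] .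
  have phi_in: "\<phi> m \<in> L" if "m \<in> carrier M" for m using that img by blast
  have L_add: "l + l' \<in> L" if "l \<in> L" "l' \<in> L" for l l'
    using add[OF gl(1)[OF that(1)] gl(1)[OF that(2)]] phi_in[OF M.a_closed[OF gl(1)[OF that(1)] gl(1)[OF that(2)]]]
      gl(2) that by simp
  have L_act: "act F l \<in> L" if "l \<in> L" for F l
    using eqv[OF gl(1)[OF that], of F] phi_in[OF sm_closed[OF gl(1)[OF that]], of F] gl(2)[OF that] by simp
  have phi0: "\<phi> \<zero>\<^bsub>M\<^esub> = 0" using eqv[OF M.zero_closed, of 0] by (simp add: sm_zero_right)
  have L0: "0 \<in> L" using phi_in[OF M.zero_closed] phi0 by simp
  have comb_in: "comb k r e \<in> L" if "k \<le> n" for k r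
    using that by (induction k) (simp_all add: comb_def L0 L_add L_act e)

  have rp: "\<exists>F. xyz_class F = c" if "c \<in> carrier xyz_ring" for c :: "'k fps3 set" using xyz_classE[OF that] by metis
  \<comment> \<open>Since \<open>act\<close> depends only on classes, any choice of representatives
    for the entries of a vector gives the same combination of the generators.\<close>
  define rp :: "'k fps3 set \<Rightarrow> 'k fps3" where "rp = (\<lambda>c. SOME F. xyz_class F = c)"
  have rp: "xyz_class (rp c) = c" if "c \<in> carrier xyz_ring" for c
    unfolding rp_def by (rule someI_ex[OF rp[OF that]])
  let ?F = "free_module (xyz_ring :: 'k fps3 set ring) n"
  have carF: "x \<in> carrier ?F \<longleftrightarrow> dim_vec x = n \<and> (\<forall>i<n. vec_index x i \<in> carrier xyz_ring)" for x :: "'k fps3 set vec"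
    unfolding free_module_def carrier_vec_def by auto
  define h where "h = (\<lambda>x :: 'k fps3 set vec. comb n (\<lambda>i. rp (vec_index x i)) e)"
  have hL: "h x \<in> L" for x unfolding h_def by (rule comb_in) simp
  have h_class: "h (vec n (\<lambda>i. xyz_class (r i))) = comb n r e" for r
    unfolding h_def by (rule comb_cong_class) (simp add: rp xyz_class_simps)
  have hadd: "h (x \<oplus>\<^bsub>?F\<^esub> y) = h x + h y" if "x \<in> carrier ?F" "y \<in> carrier ?F" for x y
  proof -
    have "h (x \<oplus>\<^bsub>?F\<^esub> y) = comb n (\<lambda>i. rp (vec_index x i) + rp (vec_index y i)) e"
      unfolding h_def
    proof (rule comb_cong_class)
      fix i assume i: "i < n"
      have x: "vec_index x i \<in> carrier xyz_ring" "vec_index y i \<in> carrier xyz_ring" using that i unfolding carF by auto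
      have "vec_index (x \<oplus>\<^bsub>?F\<^esub> y) i = vec_index x i \<oplus>\<^bsub>xyz_ring\<^esub> vec_index y i"
        using i by (simp add: free_module_def)
      also have "\<dots> = xyz_class (rp (vec_index x i) + rp (vec_index y i))"
        unfolding xyz_class_simps(2)[symmetric] rp[OF x(1)] rp[OF x(2)] ..
      finally have eq: "vec_index (x \<oplus>\<^bsub>?F\<^esub> y) i = xyz_class (rp (vec_index x i) + rp (vec_index y i))" .
      show "xyz_class (rp (vec_index (x \<oplus>\<^bsub>?F\<^esub> y) i)) = xyz_class (rp (vec_index x i) + rp (vec_index y i))"
        unfolding eq by (rule rp) (rule xyz_class_simps)
    qed
    then show ?thesis unfolding comb_add h_def .
  qed
  have hlin: "h (a \<odot>\<^bsub>?F\<^esub> x) = act (rp a) (h x)" if "a \<in> carrier xyz_ring" "x \<in> carrier ?F" for a x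
  proof -
    have "h (a \<odot>\<^bsub>?F\<^esub> x) = comb n (\<lambda>i. rp a * rp (vec_index x i)) e"
      unfolding h_def
    proof (rule comb_cong_class)
      fix i assume i: "i < n"
      have x: "vec_index x i \<in> carrier xyz_ring" using that i unfolding carF by auto
      have "vec_index (a \<odot>\<^bsub>?F\<^esub> x) i = a \<otimes>\<^bsub>xyz_ring\<^esub> vec_index x i"
        using i by (simp add: free_module_def)
      also have "\<dots> = xyz_class (rp a * rp (vec_index x i))"
        unfolding xyz_class_simps(3)[symmetric] rp[OF x] rp[OF that(1)] ..
      finally have eq: "vec_index (a \<odot>\<^bsub>?F\<^esub> x) i = xyz_class (rp a * rp (vec_index x i))" .
      show "xyz_class (rp (vec_index (a \<odot>\<^bsub>?F\<^esub> x) i)) = xyz_class (rp a * rp (vec_index x i))"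
        unfolding eq by (rule rp) (rule xyz_class_simps)
    qed
    then show ?thesis unfolding act_comb[symmetric] h_def .
  qed

  let ?N = "mat_apply xyz_ring (map_mat xyz_class \<theta>) ` carrier ?F"
  have mat_apply: "mat_apply xyz_ring (map_mat xyz_class \<theta>) (vec n (\<lambda>i. xyz_class (q i)))
      = vec n (\<lambda>i. xyz_class (\<Sum>j<n. \<theta> $$ (i, j) * q j))" for q
  proof (rule eq_vecI)
    fix i assume "i < dim_vec (vec n (\<lambda>i. xyz_class (\<Sum>j<n. \<theta> $$ (i, j) * q j)))"
    then have i: "i < n" by simp
    interpret R: cring "xyz_ring :: 'k fps3 set ring" by (rule cring_xyz)
    have "(\<Oplus>\<^bsub>xyz_ring\<^esub>j\<in>{..<n}. map_mat xyz_class \<theta> $$ (i, j) \<otimes>\<^bsub>xyz_ring\<^esub> vec_index (vec n (\<lambda>i. xyz_class (q i))) j)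
        = (\<Oplus>\<^bsub>xyz_ring\<^esub>j\<in>{..<n}. xyz_class (\<theta> $$ (i, j) * q j))"
      using i dim by (intro R.finsum_cong') (auto simp: xyz_class_simps)
    then show "vec_index (mat_apply xyz_ring (map_mat xyz_class \<theta>) (vec n (\<lambda>i. xyz_class (q i)))) i
        = vec_index (vec n (\<lambda>i. xyz_class (\<Sum>j<n. \<theta> $$ (i, j) * q j))) i"
      using i dim by (simp add: mat_apply_def finsum_xyz_class)
  qed (simp add: mat_apply_def dim)
  have vec_rp: "x = vec n (\<lambda>i. xyz_class (rp (vec_index x i)))" if "x \<in> carrier ?F" for x
    using that unfolding carF by (intro eq_vecI) (auto simp: rp)
  have N: "?N = {x \<in> carrier ?F. \<gamma> (h x) = \<zero>\<^bsub>M\<^esub>}"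
  proof -
    have iff: "\<gamma> (h x) = \<zero>\<^bsub>M\<^esub> \<longleftrightarrow> h x = 0" for x
      using gl[OF hL[of x]] phi0 eqM[OF gl(1)[OF hL[of x]] M.zero_closed] by auto
    have in1: "mat_apply xyz_ring (map_mat xyz_class \<theta>) x \<in> carrier ?F \<and>
        h (mat_apply xyz_ring (map_mat xyz_class \<theta>) x) = 0" if x: "x \<in> carrier ?F" for x
    proof -
      define q where "q = (\<lambda>i. rp (vec_index x i))"
      have x: "x = vec n (\<lambda>i. xyz_class (q i))" unfolding q_def by (rule vec_rp[OF x])
      have "comb n (\<lambda>i. \<Sum>j<n. \<theta> $$ (i, j) * q j) e = (\<Sum>j<n. act (q j) (comb n (\<lambda>i. \<theta> $$ (i, j)) e))"
        by (simp add: comb_sum act_comb mult.commute)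
      also have "\<dots> = 0" by (simp add: rel)
      finally show ?thesis unfolding x mat_apply h_class carF by (simp add: xyz_class_simps)
    qed
    have in2: "x \<in> ?N" if x: "x \<in> carrier ?F" "h x = 0" for x
    proof -
      obtain q where q: "\<And>i. i < n \<Longrightarrow> var_x * var_y * var_z dvd rp (vec_index x i) - (\<Sum>j<n. \<theta> $$ (i, j) * q j)"
        using ker[of "\<lambda>i. rp (vec_index x i)"] x(2) unfolding h_def by blast
      have "x = vec n (\<lambda>i. xyz_class (\<Sum>j<n. \<theta> $$ (i, j) * q j))"
        using x(1) q unfolding carF by (intro eq_vecI) (auto simp: xyz_class_eq_iff[symmetric] rp)
      then have "x = mat_apply xyz_ring (map_mat xyz_class \<theta>) (vec n (\<lambda>i. xyz_class (q i)))" unfolding mat_apply .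
      moreover have "vec n (\<lambda>i. xyz_class (q i)) \<in> carrier ?F" unfolding carF by (simp add: xyz_class_simps)
      ultimately show ?thesis by (rule image_eqI)
    qed
    show ?thesis unfolding iff using in1 in2 by blast
  qed
  have "module_iso xyz_ring M (quot_module xyz_ring ?F ?N)"
  proof (rule module_iso_quot[where g = "\<lambda>x. \<gamma> (h x)"])
    show "module xyz_ring ?F" by (rule free_module_module[OF cring_xyz])
    show "module xyz_ring M" by (rule module_axioms)
    show "(\<lambda>x. \<gamma> (h x)) \<in> carrier ?F \<rightarrow> carrier M" by (intro Pi_I gl(1) hL)
    show "(\<lambda>x. \<gamma> (h x)) ` carrier ?F = carrier M"
    proof
      show "(\<lambda>x. \<gamma> (h x)) ` carrier ?F \<subseteq> carrier M" by (intro image_subsetI gl(1) hL)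
      show "carrier M \<subseteq> (\<lambda>x. \<gamma> (h x)) ` carrier ?F"
      proof
        fix m assume m: "m \<in> carrier M"
        obtain r where r: "\<phi> m = comb n r e" using gen[OF phi_in[OF m]] by blast
        have "\<gamma> (h (vec n (\<lambda>i. xyz_class (r i)))) = m"
          unfolding h_class r[symmetric] using gl[OF phi_in[OF m]] m by (intro eqM)
        moreover have "vec n (\<lambda>i. xyz_class (r i)) \<in> carrier ?F" unfolding carF by (simp add: xyz_class_simps)
        ultimately show "m \<in> (\<lambda>x. \<gamma> (h x)) ` carrier ?F" by (metis image_eqI)
      qed
    qed
    show "\<gamma> (h (x \<oplus>\<^bsub>?F\<^esub> y)) = \<gamma> (h x) \<oplus>\<^bsub>M\<^esub> \<gamma> (h y)" if "x \<in> carrier ?F" "y \<in> carrier ?F" for x y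
      using that gl hL L_add by (intro eqM) (simp_all add: add hadd)
    show "\<gamma> (h (a \<odot>\<^bsub>?F\<^esub> x)) = a \<odot>\<^bsub>M\<^esub> \<gamma> (h x)" if a: "a \<in> carrier xyz_ring" and x: "x \<in> carrier ?F" for a x
    proof -
      have "a \<odot>\<^bsub>M\<^esub> \<gamma> (h x) = sm (rp a) (\<gamma> (h x))" unfolding sm_def rp[OF a] ..
      moreover have "\<gamma> (h (a \<odot>\<^bsub>?F\<^esub> x)) = sm (rp a) (\<gamma> (h x))"
        using gl hL by (intro eqM) (simp_all add: eqv hlin[OF a x] L_act)
      ultimately show ?thesis by simp
    qed
    show "?N = {x \<in> carrier ?F. \<gamma> (h x) = \<zero>\<^bsub>M\<^esub>}" by (rule N)
  qed
  then show "module_iso xyz_ring M (xyz_coker \<theta>)" unfolding xyz_coker_def coker_def by (simp add: dim)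

  show "generated_by xyz_ring M n"
  proof -
    define S where "S = (\<lambda>i. \<gamma> (e i)) ` {..<n}"
    have S: "S \<subseteq> carrier M" unfolding S_def by (intro image_subsetI gl(1) e) simp
    have "m \<in> submodule_span xyz_ring M S" if m: "m \<in> carrier M" for m
    proof -
      let ?T = "submodule_span xyz_ring M S"
      have T: "submodule ?T xyz_ring M" by (rule submodule_submodule_span[OF S])
      obtain r where r: "\<phi> m = comb n r e" using gen[OF phi_in[OF m]] by blast
      have ind: "k \<le> n \<longrightarrow> \<gamma> (comb k r e) \<in> ?T" for k
      proof (induction k)
        case 0
        have "\<gamma> (comb 0 r e) = \<zero>\<^bsub>M\<^esub>" using gl[OF L0] phi0 by (intro eqM) (simp_all add: comb_def)
        then show ?case using zero_mem_submodule[OF T] by simp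
      next
        case (Suc k)
        show ?case
        proof
          assume Sk: "Suc k \<le> n"
          then have k: "k < n" "k \<le> n" by auto
          have "comb (Suc k) r e = comb k r e + act (r k) (e k)" by (simp add: comb_def)
          then have "\<phi> (\<gamma> (comb (Suc k) r e)) = \<phi> (\<gamma> (comb k r e) \<oplus>\<^bsub>M\<^esub> sm (r k) (\<gamma> (e k)))"
            using gl(2)[OF comb_in[OF Sk, of r]] gl[OF comb_in[OF k(2), of r]] gl[OF e[OF k(1)]] by (simp add: add eqv)
          then have "\<gamma> (comb (Suc k) r e) = \<gamma> (comb k r e) \<oplus>\<^bsub>M\<^esub> sm (r k) (\<gamma> (e k))"
            using gl(1)[OF comb_in[OF Sk, of r]] gl(1)[OF comb_in[OF k(2), of r]] gl(1)[OF e[OF k(1)]] by (intro eqM) simp_all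
          moreover have "\<gamma> (e k) \<in> S" unfolding S_def by (rule image_eqI[of _ _ k]) (simp_all add: k)
          then have "\<gamma> (e k) \<in> ?T" by (rule subsetD[OF submodule_span_incl])
          then have "sm (r k) (\<gamma> (e k)) \<in> ?T" unfolding sm_def by (rule submoduleE(4)[OF T xyz_class_simps(1)])
          ultimately show "\<gamma> (comb (Suc k) r e) \<in> ?T" using submoduleE(5)[OF T] Suc.IH k(2) by simp
        qed
      qed
      have "\<gamma> (comb n r e) = m" unfolding r[symmetric] using gl[OF phi_in[OF m]] m by (intro eqM)
      then show ?thesis using ind[of n] by simp
    qed
    then have "submodule_span xyz_ring M S = carrier M"
      by (intro subset_antisym submodule_span_minimal[OF submodule_carrier S] subsetI)
    moreover have "card S \<le> n" unfolding S_def using card_image_le[of "{..<n}"] by simp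
    moreover have "finite S" unfolding S_def by simp
    ultimately show ?thesis unfolding generated_by_def using S by (intro exI[of _ S] conjI)
  qed

  show "n \<le> k" if gk: "generated_by xyz_ring M k"
  proof -
    obtain S where S: "S \<subseteq> carrier M" "finite S" "card S \<le> k" "submodule_span xyz_ring M S = carrier M"
      using gk unfolding generated_by_def by (elim exE conjE) (rule that)
    define N where "N = {m \<in> carrier M. \<exists>r. \<phi> m = (\<Sum>s\<in>S. act (r s) (\<phi> s))}"
    have "submodule N xyz_ring M"
    proof (rule submoduleI)
      have "\<phi> \<zero>\<^bsub>M\<^esub> = (\<Sum>s\<in>S. act 0 (\<phi> s))" by (simp add: phi0)
      then show "\<zero>\<^bsub>M\<^esub> \<in> N"
        unfolding N_def by (intro CollectI conjI M.zero_closed) (rule exI[of _ "\<lambda>_. 0"])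
      show "a \<oplus>\<^bsub>M\<^esub> b \<in> N" if ab: "a \<in> N" "b \<in> N" for a b
      proof -
        obtain p q where "\<phi> a = (\<Sum>s\<in>S. act (p s) (\<phi> s))" "\<phi> b = (\<Sum>s\<in>S. act (q s) (\<phi> s))" using ab unfolding N_def by blast
        then have "\<phi> (a \<oplus>\<^bsub>M\<^esub> b) = (\<Sum>s\<in>S. act (p s + q s) (\<phi> s))"
          using ab unfolding N_def by (simp add: add act_add_left sum.distrib)
        then show ?thesis using ab unfolding N_def by (intro CollectI conjI exI[of _ "\<lambda>s. p s + q s"]) simp_all
      qed
      have actN: "sm F a \<in> N" if a: "a \<in> N" for a F
      proof -
        obtain p where "\<phi> a = (\<Sum>s\<in>S. act (p s) (\<phi> s))" using a unfolding N_def by blast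
        then have "\<phi> (sm F a) = (\<Sum>s\<in>S. act (F * p s) (\<phi> s))"
          using a unfolding N_def by (simp add: eqv act_sum act_mult)
        then show ?thesis using a unfolding N_def by (intro CollectI conjI exI[of _ "\<lambda>s. F * p s"]) simp_all
      qed
      show "a \<odot>\<^bsub>M\<^esub> x \<in> N" if "a \<in> carrier xyz_ring" "x \<in> N" for a x
        using actN[OF that(2), of "rp a"] unfolding sm_def rp[OF that(1)] .
      show "\<ominus>\<^bsub>M\<^esub> a \<in> N" if a: "a \<in> N" for a
      proof -
        have aM: "a \<in> carrier M" using a unfolding N_def by blast
        have "sm (-1) a \<oplus>\<^bsub>M\<^esub> a = sm (-1 + 1) a" using aM by (simp only: sm_add_left sm_one)
        also have "\<dots> = \<zero>\<^bsub>M\<^esub>" using aM by (simp add: sm_zero)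
        finally have "\<ominus>\<^bsub>M\<^esub> a = sm (-1) a" using aM by (intro M.minus_equality) simp_all
        then show ?thesis using actN[OF a] by simp
      qed
    qed (auto simp: N_def)
    moreover have "S \<subseteq> N"
    proof
      fix t assume t: "t \<in> S"
      have "(\<Sum>s\<in>S. act (if s = t then 1 else 0) (\<phi> s)) = (\<Sum>s\<in>S. if s = t then \<phi> s else 0)"
        by (intro sum.cong) auto
      also have "\<dots> = \<phi> t" using t S(2) by simp
      finally show "t \<in> N" unfolding N_def using t S(1)
        by (intro CollectI conjI exI[of _ "\<lambda>s. if s = t then 1 else 0"]) auto
    qed
    ultimately have MN: "carrier M \<subseteq> N" using submodule_span_minimal[of N S] S(4) by simp
    obtain b where b: "bij_betw b {..<card S} S" using ex_bij_betw_nat_finite[OF S(2)] by (auto simp: atLeast0LessThan)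
    have "\<exists>R. \<forall>i\<in>{..<n}. e i = (\<Sum>s\<in>S. act (R i s) (\<phi> s))"
    proof (intro bchoice ballI)
      fix i assume "i \<in> {..<n}"
      then have i: "i < n" by simp
      have "\<gamma> (e i) \<in> N" using MN gl(1)[OF e[OF i]] by blast
      then show "\<exists>r. e i = (\<Sum>s\<in>S. act (r s) (\<phi> s))" unfolding N_def using gl(2)[OF e[OF i]] by simp
    qed
    then obtain R where R: "\<And>i. i < n \<Longrightarrow> e i = (\<Sum>s\<in>S. act (R i s) (\<phi> s))" by blast
    have "\<exists>Q. \<forall>s\<in>S. \<phi> s = comb n (Q s) e"
      using gen[OF phi_in] S(1) by (intro bchoice ballI) blast
    then obtain Q where Q: "\<And>s. s \<in> S \<Longrightarrow> \<phi> s = comb n (Q s) e" by blast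
    \<comment> \<open>\<open>R\<close> writes the given generators in terms of S, and
      \<open>Q\<close> writes S in terms of them, so the rows of \<open>RQ - 1\<close> are
      relations. Relations are combinations of the columns of \<open>\<theta>\<close> plus multiples
      of \<open>xyz\<close>, all with zero constant term.\<close>
    have key: "(\<Sum>s\<in>S. cc (R i s) * cc (Q s l)) = (if i = l then 1 else 0)" if i: "i < n" and l: "l < n" for i l
    proof -
      have "e i = (\<Sum>s\<in>S. act (R i s) (comb n (Q s) e))" unfolding R[OF i] by (intro sum.cong refl) (simp add: Q)
      also have "\<dots> = comb n (\<lambda>l. \<Sum>s\<in>S. R i s * Q s l) e" by (simp add: act_comb comb_sum S(2))
      finally have "comb n (\<lambda>l. (\<Sum>s\<in>S. R i s * Q s l) - (if l = i then 1 else 0)) e = 0"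
        unfolding comb_diff comb_unit[OF i] by simp
      then obtain q where "var_x * var_y * var_z dvd ((\<Sum>s\<in>S. R i s * Q s l) - (if l = i then 1 else 0)) - (\<Sum>j<n. \<theta> $$ (l, j) * q j)"
        using ker l by blast
      then obtain t where "((\<Sum>s\<in>S. R i s * Q s l) - (if l = i then 1 else 0)) - (\<Sum>j<n. \<theta> $$ (l, j) * q j) = var_x * var_y * var_z * t"
        by (rule dvdE)
      then have "cc (((\<Sum>s\<in>S. R i s * Q s l) - (if l = i then 1 else 0)) - (\<Sum>j<n. \<theta> $$ (l, j) * q j)) = 0"
        by (simp add: cc.hom_mult)
      then show ?thesis using l by (simp add: cc.hom_minus cc.hom_sum cc.hom_mult cc0 split: if_splits)
    qed
    have "n \<le> card S"
    proof (rule right_inverse_dim_le)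
      show "(\<Sum>s<card S. cc (R i (b s)) * cc (Q (b s) l)) = (if i = l then 1 else 0)" if "i < n" "l < n" for i l
        unfolding key[OF that, symmetric] by (rule sum.reindex_bij_betw[OF b])
    qed
    then show ?thesis using S(3) by simp
  qed
qed

text \<open>The preimage \<open>e\<close> of \<open>(1, 1, 1)\<close> is a basis:
  \<open>ker_uvw\<close> gives injectivity of the map from the ring to M, and \<open>image\<close>
  gives surjectivity.\<close>

lemma regular:
  assumes rep: "rep (glue 1 1 1 1 1 1)"
  shows "module_iso xyz_ring M (regular_module xyz_ring)"
proof -
  let ?L = "glue 1 1 1 1 1 (1 :: 'k fps)"
  obtain \<phi> where bij: "bij_betw \<phi> (carrier M) ?L"
    and add: "\<And>m n. m \<in> carrier M \<Longrightarrow> n \<in> carrier M \<Longrightarrow> \<phi> (m \<oplus>\<^bsub>M\<^esub> n) = \<phi> m + \<phi> n"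
    and eqv: "\<And>F m. m \<in> carrier M \<Longrightarrow> \<phi> (sm F m) = act F (\<phi> m)"
    using rep unfolding rep_def by blast
  have inj: "inj_on \<phi> (carrier M)" and img: "\<phi> ` carrier M = ?L" using bij unfolding bij_betw_def by auto
  have "(1, 1, 1) \<in> ?L" unfolding glue_def by simp
  then have "(1, 1, 1) \<in> \<phi> ` carrier M" unfolding img .
  then obtain e where e: "e \<in> carrier M" "\<phi> e = (1, 1, 1)" by (elim imageE) simp
  show ?thesis
  proof (rule module_isoI_inverse[where f = "\<lambda>c. c \<odot>\<^bsub>M\<^esub> e"])
    have car: "carrier (regular_module xyz_ring) = (carrier xyz_ring :: 'k fps3 set set)" by (simp add: regular_module_def)
    have "inj_on (\<lambda>c. c \<odot>\<^bsub>M\<^esub> e) (carrier xyz_ring)"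
    proof (rule inj_onI)
      fix c c' :: "'k fps3 set" assume c: "c \<in> carrier xyz_ring" "c' \<in> carrier xyz_ring" "c \<odot>\<^bsub>M\<^esub> e = c' \<odot>\<^bsub>M\<^esub> e"
      obtain F where F: "c = xyz_class F" using xyz_classE[OF c(1)] by blast
      obtain G where G: "c' = xyz_class G" using xyz_classE[OF c(2)] by blast
      have "sm F e = sm G e" using c(3) unfolding F G sm_def .
      then have "act F (1, 1, 1) = act G (1, 1, 1)" using eqv[OF e(1), of F] eqv[OF e(1), of G] e(2) by simp
      then have "u * v * w dvd F - G" by (intro ker_uvw) (simp_all add: hom_simps)
      then show "c = c'" unfolding F G xyz_class_eq_iff uvw .
    qed
    moreover have "(\<lambda>c. c \<odot>\<^bsub>M\<^esub> e) ` carrier xyz_ring = carrier M"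
    proof
      show "(\<lambda>c. c \<odot>\<^bsub>M\<^esub> e) ` carrier xyz_ring \<subseteq> carrier M" using e(1) by auto
      show "carrier M \<subseteq> (\<lambda>c. c \<odot>\<^bsub>M\<^esub> e) ` carrier xyz_ring"
      proof
        fix m assume m: "m \<in> carrier M"
        obtain f g h where fgh: "\<phi> m = (f, g, h)" by (cases "\<phi> m")
        have "\<phi> m \<in> ?L" using m img by blast
        then have "res_s f = res_t g" "res_s g = res_t h" "res_s h = res_t f" unfolding fgh glue_def by simp_all
        then obtain F where "\<pi>1 F = f" "\<pi>2 F = g" "\<pi>3 F = h" using image[of f g h] by blast
        then have "\<phi> (sm F e) = \<phi> m" unfolding eqv[OF e(1)] e(2) fgh by simp
        then have "sm F e = m" by (rule inj_onD[OF inj]) (simp_all add: m e(1))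
        then show "m \<in> (\<lambda>c. c \<odot>\<^bsub>M\<^esub> e) ` carrier xyz_ring"
          unfolding sm_def by (intro image_eqI[of _ _ "xyz_class F"]) (simp_all add: xyz_class_simps)
      qed
    qed
    ultimately show "bij_betw (\<lambda>c. c \<odot>\<^bsub>M\<^esub> e) (carrier (regular_module xyz_ring)) (carrier M)"
      unfolding bij_betw_def car by blast
  qed (use e(1) in \<open>simp_all add: regular_module_def smult_l_distr smult_assoc1\<close>)
qed

end

section \<open>The classification\<close>

definition refl3 :: "'k::field triple set \<Rightarrow> 'k triple set" where
  "refl3 L = {(swap2 f, swap2 h, swap2 g) | f g h. (f, g, h) \<in> L}"

lemma rot3_glue: "rot3 (glue A1 B1 A2 B2 A3 B3) = glue A2 B2 A3 B3 A1 B1"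
  by (auto simp: glue_def rot3_def)

lemma refl3_glue: "refl3 (glue A1 B1 A2 B2 A3 B3) = glue B3 A3 B2 A2 B1 A1"
proof -
  have "(a, b, c) \<in> refl3 L \<longleftrightarrow> (swap2 a, swap2 c, swap2 b) \<in> L" for a b c :: "'a fps fps" and L
  proof
    assume "(swap2 a, swap2 c, swap2 b) \<in> L"
    then show "(a, b, c) \<in> refl3 L"
      unfolding refl3_def by (intro CollectI exI[of _ "swap2 a"] exI[of _ "swap2 c"] exI[of _ "swap2 b"]) simp
  qed (auto simp: refl3_def)
  then show ?thesis by (auto simp: glue_def)
qed

text \<open>The sign patterns of the gluing exponents, up to rotation and reflection.\<close>

definition canonical_signs :: "int \<Rightarrow> int \<Rightarrow> int \<Rightarrow> bool" where
  "canonical_signs d1 d2 d3 \<longleftrightarrow> (d1 \<ge> 0 \<and> d2 \<ge> 0 \<and> d3 \<ge> 0) \<or> (d1 > 0 \<and> d2 < 0 \<and> d3 = 0) \<or>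
     (d1 < 0 \<and> d2 > 0 \<and> d3 = 0) \<or> (d1 > 0 \<and> d2 < 0 \<and> d3 > 0)"

text \<open>A reflection reverses the order of the exponents and changes their signs, so at most one
  negative exponent among nonzero ones has to be considered. With one zero, one positive and one
  negative exponent a rotation moves the zero to the end; reflections do not exchange the two
  resulting patterns, and both are canonical.\<close>

lemma canonical_up_to_symmetry:
  "canonical_signs d1 d2 d3 \<or> canonical_signs d2 d3 d1 \<or> canonical_signs d3 d1 d2 \<or>
   canonical_signs (- d3) (- d2) (- d1) \<or> canonical_signs (- d2) (- d1) (- d3) \<or> canonical_signs (- d1) (- d3) (- d2)"
  unfolding canonical_signs_def
  by (cases rule: linorder_cases[of d1 0]; cases rule: linorder_cases[of d2 0]; cases rule: linorder_cases[of d3 0]) simp_all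

definition sdiff :: "'k::field fps \<Rightarrow> 'k fps \<Rightarrow> int" where
  "sdiff A B = int (subdegree A) - int (subdegree B)"

context coord_module
begin

lemma rep_iso: "rep L \<Longrightarrow> triple_iso \<kappa> L L' \<Longrightarrow> rep L'"
proof -
  assume "rep L" and iso: "triple_iso \<kappa> L L'"
  then obtain \<phi> where bij: "bij_betw \<phi> (carrier M) L"
    and add: "\<And>m n. m \<in> carrier M \<Longrightarrow> n \<in> carrier M \<Longrightarrow> \<phi> (m \<oplus>\<^bsub>M\<^esub> n) = \<phi> m + \<phi> n"
    and eqv: "\<And>F m. m \<in> carrier M \<Longrightarrow> \<phi> (sm F m) = act F (\<phi> m)"
    unfolding rep_def by blast
  have im: "\<phi> m \<in> L" if "m \<in> carrier M" for m using bij_betw_apply[OF bij that] .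
  show ?thesis
    unfolding rep_def
  proof (intro exI[of _ "\<lambda>m. \<kappa> (\<phi> m)"] conjI ballI allI)
    show "bij_betw (\<lambda>m. \<kappa> (\<phi> m)) (carrier M) L'"
      using bij_betw_trans[OF bij, of \<kappa> L'] iso unfolding triple_iso_def by (simp add: comp_def)
  qed (use iso im in \<open>simp_all add: triple_iso_def add eqv\<close>)
qed

text \<open>The module M stays the same; only the components of the values are permuted, and
  \<open>rep\<close> is taken with respect to the rotated coordinates.\<close>

lemma rep_rot:
  assumes "rep L" shows "coord_module.rep M \<pi>2 \<pi>3 \<pi>1 (rot3 L)"
proof -
  interpret r: coord_module M \<pi>2 \<pi>3 \<pi>1 v w u by (rule coord_module_rot)
  obtain \<phi> where bij: "bij_betw \<phi> (carrier M) L"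
    and add: "\<And>m n. m \<in> carrier M \<Longrightarrow> n \<in> carrier M \<Longrightarrow> \<phi> (m \<oplus>\<^bsub>M\<^esub> n) = \<phi> m + \<phi> n"
    and eqv: "\<And>F m. m \<in> carrier M \<Longrightarrow> \<phi> (sm F m) = act F (\<phi> m)"
    using assms unfolding rep_def by blast
  define \<rho> where "\<rho> = (\<lambda>(f, g, h). (g, h, f) :: 'k triple)"
  have ract: "\<rho> (act F l) = r.act F (\<rho> l)" for F l by (cases l) (simp add: \<rho>_def)
  have radd: "\<rho> (l + l') = \<rho> l + \<rho> l'" for l l' by (cases l; cases l') (simp add: \<rho>_def)
  have "bij_betw \<rho> L (rot3 L)"
    by (rule bij_betw_byWitness[where f' = "\<lambda>(g, h, f). (f, g, h)"]) (auto simp: \<rho>_def)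
  then have "bij_betw (\<lambda>m. \<rho> (\<phi> m)) (carrier M) (rot3 L)" using bij_betw_trans[OF bij] by (simp add: comp_def)
  then show ?thesis unfolding r.rep_def by (intro exI[of _ "\<lambda>m. \<rho> (\<phi> m)"]) (simp add: add eqv ract radd)
qed

lemma rep_refl:
  assumes "rep L" shows "coord_module.rep M (\<lambda>F. swap2 (\<pi>1 F)) (\<lambda>F. swap2 (\<pi>3 F)) (\<lambda>F. swap2 (\<pi>2 F)) (refl3 L)"
proof -
  interpret r: coord_module M "\<lambda>F. swap2 (\<pi>1 F)" "\<lambda>F. swap2 (\<pi>3 F)" "\<lambda>F. swap2 (\<pi>2 F)" u w v by (rule coord_module_refl)
  obtain \<phi> where bij: "bij_betw \<phi> (carrier M) L"
    and add: "\<And>m n. m \<in> carrier M \<Longrightarrow> n \<in> carrier M \<Longrightarrow> \<phi> (m \<oplus>\<^bsub>M\<^esub> n) = \<phi> m + \<phi> n"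
    and eqv: "\<And>F m. m \<in> carrier M \<Longrightarrow> \<phi> (sm F m) = act F (\<phi> m)"
    using assms unfolding rep_def by blast
  define \<rho> where "\<rho> = (\<lambda>(f, g, h). (swap2 f, swap2 h, swap2 g) :: 'k triple)"
  have ract: "\<rho> (act F l) = r.act F (\<rho> l)" for F l by (cases l) (simp add: \<rho>_def swap2.hom_mult)
  have radd: "\<rho> (l + l') = \<rho> l + \<rho> l'" for l l' by (cases l; cases l') (simp add: \<rho>_def swap2.hom_add)
  have "bij_betw \<rho> L (refl3 L)"
    by (rule bij_betw_byWitness[where f' = \<rho>]) (auto simp: \<rho>_def refl3_def)
  then have "bij_betw (\<lambda>m. \<rho> (\<phi> m)) (carrier M) (refl3 L)" using bij_betw_trans[OF bij] by (simp add: comp_def)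
  then show ?thesis unfolding r.rep_def by (intro exI[of _ "\<lambda>m. \<rho> (\<phi> m)"]) (simp add: add eqv ract radd)
qed

lemma outcome2I:
  assumes "rep L" "presents 2 \<theta> L" "{x, y, z} = {u, v, w}" "p \<ge> 1" "q \<ge> 1" "c \<noteq> 0"
    "\<theta> \<in> {theta1 x y z (p, q) c, theta2 x y z (p, q) c, theta3 x y z (p, q) c}"
  shows outcome
proof -
  have "generated_by xyz_ring M 2" by (rule presented_generated[OF assms(1,2)])
  moreover have "\<not> generated_by xyz_ring M 1" using presented_minimal[OF assms(1,2), of 1] by auto
  moreover have "module_iso xyz_ring M (xyz_coker \<theta>)" by (rule presented_iso[OF assms(1,2)])
  then have "\<exists>\<theta> \<in> {theta1 x y z (p, q) c, theta2 x y z (p, q) c, theta3 x y z (p, q) c}.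
             module_iso xyz_ring M (xyz_coker \<theta>)" using assms(7) by (rule bexI)
  moreover have "{x, y, z} = {var_x, var_y, var_z}" using assms(3) perm by simp
  ultimately show ?thesis unfolding outcome_def using assms(4-6)
    by (intro disjI2 disjI1 conjI exI[of _ x] exI[of _ y] exI[of _ z] exI[of _ p] exI[of _ q] exI[of _ c])
qed

lemma outcome3I:
  assumes "rep L" "presents 3 \<theta> L" "{x, y, z} = {u, v, w}" "m \<ge> 1" "n \<ge> 1" "l \<ge> 1" "c \<noteq> 0"
    "\<theta> \<in> {theta4 x y z (m, n, l) c, theta5 x y z (m, n, l) c, theta6 x y z (m, n, l) c, theta7 x y z (m, n, l) c}"
  shows outcome
proof -
  have "generated_by xyz_ring M 3" by (rule presented_generated[OF assms(1,2)])
  moreover have "\<not> generated_by xyz_ring M 2" using presented_minimal[OF assms(1,2), of 2] by auto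
  moreover have "module_iso xyz_ring M (xyz_coker \<theta>)" by (rule presented_iso[OF assms(1,2)])
  then have "\<exists>\<theta> \<in> {theta4 x y z (m, n, l) c, theta5 x y z (m, n, l) c, theta6 x y z (m, n, l) c, theta7 x y z (m, n, l) c}.
             module_iso xyz_ring M (xyz_coker \<theta>)" using assms(8) by (rule bexI)
  moreover have "{x, y, z} = {var_x, var_y, var_z}" using assms(3) perm by simp
  ultimately show ?thesis unfolding outcome_def using assms(4-7)
    by (intro disjI2 conjI exI[of _ x] exI[of _ y] exI[of _ z] exI[of _ m] exI[of _ n] exI[of _ l] exI[of _ c])
qed

text \<open>After normalization only the positive parts of the exponents and of their negatives
  remain, as truncated differences, and the sign pattern decides which of them are zero. Each
  pattern leads to one kind of matrix, except that \<open>+, -, +\<close> leads to two.\<close>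

lemma outcome_canonical:
  assumes rep: "rep (glue A1 B1 A2 B2 A3 B3)"
    and nz: "A1 \<noteq> 0" "B1 \<noteq> 0" "A2 \<noteq> 0" "B2 \<noteq> 0" "A3 \<noteq> 0" "B3 \<noteq> 0"
    and signs: "canonical_signs (sdiff A1 B1) (sdiff A2 B2) (sdiff A3 B3)"
  shows outcome
proof -
  define a1 b1 a2 b2 a3 b3 where "a1 = subdegree A1 - subdegree B1" and "b1 = subdegree B1 - subdegree A1"
    and "a2 = subdegree A2 - subdegree B2" and "b2 = subdegree B2 - subdegree A2"
    and "a3 = subdegree A3 - subdegree B3" and "b3 = subdegree B3 - subdegree A3"
  note defs = a1_def b1_def a2_def b2_def a3_def b3_def
  obtain \<kappa> c where c: "c \<noteq> 0" and iso: "triple_iso \<kappa> (glue A1 B1 A2 B2 A3 B3)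
    (glue (fps_X ^ a1) (fps_X ^ b1) (fps_X ^ a2) (fps_X ^ b2) (fps_X ^ a3) (fps_const c * fps_X ^ b3))"
    using glue_normalize[OF nz] unfolding defs by blast
  note R = rep_iso[OF rep iso]
  have sign_cases: "(b1 = 0 \<and> b2 = 0 \<and> b3 = 0) \<or> (a1 \<ge> 1 \<and> b1 = 0 \<and> a2 = 0 \<and> b2 \<ge> 1 \<and> a3 = 0 \<and> b3 = 0) \<or>
    (a1 = 0 \<and> b1 \<ge> 1 \<and> a2 \<ge> 1 \<and> b2 = 0 \<and> a3 = 0 \<and> b3 = 0) \<or>
    (a1 \<ge> 1 \<and> b1 = 0 \<and> a2 = 0 \<and> b2 \<ge> 1 \<and> a3 \<ge> 1 \<and> b3 = 0)"
  proof -
    have sd: "sdiff A B \<ge> 0 \<Longrightarrow> subdegree B - subdegree A = 0" "sdiff A B = 0 \<Longrightarrow> subdegree B - subdegree A = 0"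
      "sdiff A B = 0 \<Longrightarrow> subdegree A - subdegree B = 0" "sdiff A B < 0 \<Longrightarrow> subdegree A - subdegree B = 0"
      "sdiff A B > 0 \<Longrightarrow> subdegree B - subdegree A = 0"
      "sdiff A B > 0 \<Longrightarrow> 1 \<le> subdegree A - subdegree B" "sdiff A B < 0 \<Longrightarrow> 1 \<le> subdegree B - subdegree A"
      for A B :: "'k fps" unfolding sdiff_def by auto
    from signs[unfolded canonical_signs_def] show ?thesis
    proof (elim disjE conjE)
      assume "0 \<le> sdiff A1 B1" "0 \<le> sdiff A2 B2" "0 \<le> sdiff A3 B3"
      then show ?thesis unfolding defs by (intro disjI1 conjI sd(1))
    next
      assume "0 < sdiff A1 B1" "sdiff A2 B2 < 0" "sdiff A3 B3 = 0"
      then show ?thesis unfolding defs by (intro disjI2[OF disjI1] conjI sd(2-7))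
    next
      assume "sdiff A1 B1 < 0" "0 < sdiff A2 B2" "sdiff A3 B3 = 0"
      then show ?thesis unfolding defs by (intro disjI2[OF disjI2[OF disjI1]] conjI sd(2-7))
    next
      assume "0 < sdiff A1 B1" "sdiff A2 B2 < 0" "0 < sdiff A3 B3"
      then show ?thesis unfolding defs by (intro disjI2[OF disjI2[OF disjI2]] conjI sd(2-7))
    qed
  qed
  have pm: "{u, w, v} = {u, v, w}" "{v, u, w} = {u, v, w}" "{w, u, v} = {u, v, w}" by blast+
  have ic: "inverse c \<noteq> 0" "- c \<noteq> 0" "- inverse c \<noteq> 0" using c by auto
  from sign_cases show ?thesis
  proof (elim disjE conjE)
    assume b: "b1 = 0" "b2 = 0" "b3 = 0"
    show ?thesis
    \<comment> \<open>With no negative exponent, all exponents zero and scalar 1 give A itself, the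
      first alternative of \<open>outcome\<close>; every other choice gives three
      generators.\<close>
    proof (cases "a1 = 0 \<and> a2 = 0 \<and> a3 = 0 \<and> c = 1")
      case True
      then have "rep (glue 1 1 1 1 1 1)" using R b by simp
      then show ?thesis unfolding outcome_def by (intro disjI1 regular)
    next
      case False
      then have nreg: "a1 \<noteq> 0 \<or> a2 \<noteq> 0 \<or> a3 \<noteq> 0 \<or> c \<noteq> 1" unfolding de_Morgan_conj .
      have "rep (glue (fps_X ^ a1) 1 (fps_X ^ a2) 1 (fps_X ^ a3) (fps_const c))" using R b by simp
      then show ?thesis
        by (rule outcome3I[OF _ presents_theta4[OF c nreg], of u w v "a2 + 1" "a1 + 1" "a3 + 1" "- inverse c"])
          (use ic pm in simp_all)
    qed
  next
    assume a: "a1 \<ge> 1" "b1 = 0" "a2 = 0" "b2 \<ge> 1" "a3 = 0" "b3 = 0"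
    then have "rep (glue (fps_X ^ a1) 1 1 (fps_X ^ b2) 1 (fps_const c))" using R by simp
    then show ?thesis
      by (rule outcome2I[OF _ presents_theta3[OF c a(4,1)], of v u w b2 a1 "inverse c"])
        (use ic a pm in simp_all)
  next
    assume a: "a1 = 0" "b1 \<ge> 1" "a2 \<ge> 1" "b2 = 0" "a3 = 0" "b3 = 0"
    then have "rep (glue 1 (fps_X ^ b1) (fps_X ^ a2) 1 1 (fps_const c))" using R by simp
    then show ?thesis
      by (rule outcome2I[OF _ presents_theta1[OF c a(3,2)], of v u w a2 b1 c])
        (use c a pm in simp_all)
  next
    assume a: "a1 \<ge> 1" "b1 = 0" "a2 = 0" "b2 \<ge> 1" "a3 \<ge> 1" "b3 = 0"
    \<comment> \<open>In the pattern \<open>+, -, +\<close> a middle exponent of 1 leaves two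
      generators; from 2 on there are three, and the matrix contains the exponent
      \<open>b2 - 1\<close>.\<close>
    define k where "k = b2 - 1"
    have k: "b2 = k + 1" using a unfolding k_def by simp
    have R': "rep (glue (fps_X ^ a1) 1 1 (fps_X ^ (k + 1)) (fps_X ^ a3) (fps_const c))" using R a k by simp
    show ?thesis
    proof (cases "k = 0")
      case True
      then have "rep (glue (fps_X ^ a1) 1 1 (fps_X ^ 1) (fps_X ^ a3) (fps_const c))" using R' by simp
      then show ?thesis
        by (rule outcome2I[OF _ presents_theta2[OF c a(1,5)], of u w v a1 a3 c])
          (use c a pm in simp_all)
    next
      case False
      then have k1: "k \<ge> 1" by simp
      show ?thesis
        by (rule outcome3I[OF R' presents_theta7[OF c a(1) k1 a(5)], of w u v a1 k a3 "- c"])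
          (use ic a k1 pm in simp_all)
    qed
  qed
qed

lemma outcome_rotations:
  assumes rep: "rep (glue A1 B1 A2 B2 A3 B3)"
    and nz: "A1 \<noteq> 0" "B1 \<noteq> 0" "A2 \<noteq> 0" "B2 \<noteq> 0" "A3 \<noteq> 0" "B3 \<noteq> 0"
    and signs: "canonical_signs (sdiff A1 B1) (sdiff A2 B2) (sdiff A3 B3) \<or>
      canonical_signs (sdiff A2 B2) (sdiff A3 B3) (sdiff A1 B1) \<or>
      canonical_signs (sdiff A3 B3) (sdiff A1 B1) (sdiff A2 B2)"
  shows outcome
proof -
  interpret r: coord_module M \<pi>2 \<pi>3 \<pi>1 v w u by (rule coord_module_rot)
  interpret rr: coord_module M \<pi>3 \<pi>1 \<pi>2 w u v by (rule r.coord_module_rot)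
  have rep1: "r.rep (glue A2 B2 A3 B3 A1 B1)" using rep_rot[OF rep] unfolding rot3_glue .
  have rep2: "rr.rep (glue A3 B3 A1 B1 A2 B2)" using r.rep_rot[OF rep1] unfolding rot3_glue .
  from signs show ?thesis
  proof (elim disjE)
    assume "canonical_signs (sdiff A1 B1) (sdiff A2 B2) (sdiff A3 B3)"
    then show ?thesis by (rule outcome_canonical[OF rep nz])
  next
    assume "canonical_signs (sdiff A2 B2) (sdiff A3 B3) (sdiff A1 B1)"
    then show ?thesis by (rule r.outcome_canonical[OF rep1 nz(3-6) nz(1,2)])
  next
    assume "canonical_signs (sdiff A3 B3) (sdiff A1 B1) (sdiff A2 B2)"
    then show ?thesis by (rule rr.outcome_canonical[OF rep2 nz(5,6) nz(1-4)])
  qed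
qed

text \<open>Reflecting the coordinates turns the gluing data into
  \<open>B3, A3, B2, A2, B1, A1\<close>, so the exponents appear reversed with opposite signs.
  Together with the rotations this covers the six arrangements of
  \<open>canonical_up_to_symmetry\<close>.\<close>

theorem outcome_glue:
  assumes rep: "rep (glue A1 B1 A2 B2 A3 B3)"
    and nz: "A1 \<noteq> 0" "B1 \<noteq> 0" "A2 \<noteq> 0" "B2 \<noteq> 0" "A3 \<noteq> 0" "B3 \<noteq> 0"
  shows outcome
proof -
  interpret r: coord_module M "\<lambda>F. swap2 (\<pi>1 F)" "\<lambda>F. swap2 (\<pi>3 F)" "\<lambda>F. swap2 (\<pi>2 F)" u w v by (rule coord_module_refl)
  have rep1: "r.rep (glue B3 A3 B2 A2 B1 A1)" using rep_refl[OF rep] unfolding refl3_glue .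
  have neg: "sdiff B A = - sdiff A B" for A B :: "'k fps" unfolding sdiff_def by simp
  have "(canonical_signs (sdiff A1 B1) (sdiff A2 B2) (sdiff A3 B3) \<or>
      canonical_signs (sdiff A2 B2) (sdiff A3 B3) (sdiff A1 B1) \<or>
      canonical_signs (sdiff A3 B3) (sdiff A1 B1) (sdiff A2 B2)) \<or>
    (canonical_signs (sdiff B3 A3) (sdiff B2 A2) (sdiff B1 A1) \<or>
      canonical_signs (sdiff B2 A2) (sdiff B1 A1) (sdiff B3 A3) \<or>
      canonical_signs (sdiff B1 A1) (sdiff B3 A3) (sdiff B2 A2))"
    using canonical_up_to_symmetry[of "sdiff A1 B1" "sdiff A2 B2" "sdiff A3 B3"]
    unfolding neg[of B1 A1] neg[of B2 A2] neg[of B3 A3] disj_assoc .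
  then show ?thesis
    by (rule disjE) (erule outcome_rotations[OF rep nz], erule r.outcome_rotations[OF rep1 nz(6,5,4,3,2,1)])
qed

end

theorem proposition8p6:
  fixes M :: "('k::field fps3 set, 'm) module"
  assumes "CM_lf xyz_ring M"
    and "rank_one xyz_ring M"
    and "\<not> module_iso xyz_ring M (regular_module xyz_ring)"
  shows "(min_generators xyz_ring M = 2 \<or> min_generators xyz_ring M = 3) \<and>
    (generated_by xyz_ring M 2 \<longrightarrow>
       (\<exists>u v w p q c.
          {u, v, w} = {var_x, var_y, var_z} \<and> p \<ge> 1 \<and> q \<ge> 1 \<and> c \<noteq> 0 \<and>
          (\<exists>\<theta> \<in> {theta1 u v w (p, q) c, theta2 u v w (p, q) c, theta3 u v w (p, q) c}.
             module_iso xyz_ring M (xyz_coker \<theta>)))) \<and>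
    (min_generators xyz_ring M = 3 \<longrightarrow>
       (\<exists>u v w m n l c.
          {u, v, w} = {var_x, var_y, var_z} \<and> m \<ge> 1 \<and> n \<ge> 1 \<and> l \<ge> 1 \<and> c \<noteq> 0 \<and>
          (\<exists>\<theta> \<in> {theta4 u v w (m, n, l) c, theta5 u v w (m, n, l) c,
                  theta6 u v w (m, n, l) c, theta7 u v w (m, n, l) c}.
             module_iso xyz_ring M (xyz_coker \<theta>))))"
proof -
  have mcm: "max_cohen_macaulay xyz_ring M" using assms(1) unfolding CM_lf_def by blast
  then have "module xyz_ring M" unfolding max_cohen_macaulay_def by blast
  then interpret xyz_module M by (rule xyz_module.intro)
  interpret coord_module M pr1 pr2 pr3 var_x var_y var_z
    by (intro coord_module.intro xyz_module_axioms coord_std)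
  obtain L where L: "rep L" "triple_module pr1 pr2 pr3 var_x var_y var_z L"
    using ex_triple_module[OF mcm assms(2)] by blast
  then obtain \<kappa> L' where L': "triple_iso \<kappa> L L'" "normal_triple_module pr1 pr2 pr3 var_x var_y var_z L'"
    using triple_module.ex_normal by blast
  obtain A1 B1 A2 B2 A3 B3 where nz: "A1 \<noteq> 0" "B1 \<noteq> 0" "A2 \<noteq> 0" "B2 \<noteq> 0" "A3 \<noteq> 0" "B3 \<noteq> 0"
    and L'_eq: "L' = glue A1 B1 A2 B2 A3 B3"
    using normal_triple_module.eq_glue[OF L'(2)] by (elim exE conjE) (rule that)
  have "rep (glue A1 B1 A2 B2 A3 B3)" using rep_iso[OF L(1) L'(1)] unfolding L'_eq .
  then have out: outcome by (rule outcome_glue[OF _ nz])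
  \<comment> \<open>Being generated by at most k elements is monotone in k, so success at n and
    failure at n - 1 identify the least number.\<close>
  have min: "min_generators xyz_ring M = n" if "generated_by xyz_ring M n" "\<not> generated_by xyz_ring M (n - 1)" for n
    unfolding min_generators_def
  proof (rule Least_equality)
    fix k assume k: "generated_by xyz_ring M k"
    show "n \<le> k"
    proof (rule ccontr)
      assume "\<not> n \<le> k"
      then show False using generated_by_mono[OF k, of "n - 1"] that(2) by simp
    qed
  qed (rule that(1))
  from out show ?thesis
    unfolding outcome_def
  proof (elim disjE conjE)
    assume "module_iso xyz_ring M (regular_module xyz_ring)"
    then show ?thesis using assms(3) by blast
  next
    assume g: "generated_by xyz_ring M 2" "\<not> generated_by xyz_ring M 1"
      and ex: "\<exists>u v w p q c.
          {u, v, w} = {var_x, var_y, var_z} \<and> p \<ge> 1 \<and> q \<ge> 1 \<and> c \<noteq> 0 \<and>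
          (\<exists>\<theta> \<in> {theta1 u v w (p, q) c, theta2 u v w (p, q) c, theta3 u v w (p, q) c}.
             module_iso xyz_ring M (xyz_coker \<theta>))"
    have m: "min_generators xyz_ring M = 2" using min[of 2] g by simp
    show ?thesis
      by (intro conjI impI ex disjI1 m) (use m in simp)
  next
    assume g: "generated_by xyz_ring M 3" "\<not> generated_by xyz_ring M 2"
      and ex: "\<exists>u v w m n l c.
          {u, v, w} = {var_x, var_y, var_z} \<and> m \<ge> 1 \<and> n \<ge> 1 \<and> l \<ge> 1 \<and> c \<noteq> 0 \<and>
          (\<exists>\<theta> \<in> {theta4 u v w (m, n, l) c, theta5 u v w (m, n, l) c,
                  theta6 u v w (m, n, l) c, theta7 u v w (m, n, l) c}.
             module_iso xyz_ring M (xyz_coker \<theta>))"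
    have m: "min_generators xyz_ring M = 3" using min[of 3] g by simp
    \<comment> \<open>Part (1) assumes a generating set of at most two elements; this contradicts
      \<open>g\<close>, so it holds vacuously in this case.\<close>
    show ?thesis
      by (intro conjI impI ex disjI2 m) (use g(2) in contradiction)
  qed
qed

end
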